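(* Let $(X,\mu,T)$ be an ergodic $\mathbb{G}$-TDS. The following conditions are equivalent: (1) $(X,T)$ is $\mu$-mean equicontinuous. (2) $(X,T)$ is $\mu$-$1_B$-mean equicontinuous for every Borel set $B\subset X$ (where $1_B$ is the indicator function of $B$). (3) $(X,T)$ is $\mu$-$f$-mean equicontinuous for every $f\in L^2(X,\mu)$. (4) $(X,\mu,T)$ has discrete spectrum. (5) $(X,T)$ is not $\mu$-mean sensitive.
   Context: $\mathbb{G}$ is a locally compact abelian group (written additively, identity $e$) with Haar measure $\nu$. A Følner sequence is a sequence $(F_n)_{n\in\mathbb{N}}$ of measurable subsets of $\mathbb{G}$ with $0<\nu(F_n)<\infty$ and $\nu((g+F_n)\triangle F_n)/\nu(F_n)\to 0$ for every $g\in\mathbb{G}$. A Følner sequence $(F_n)$ is fixed that satisfies the pointwise ergodic theorem: for every ergodic measure preserving $\mathbb{G}$-action $T$ on a standard probability space $(X,\mu)$ and every $f\in L^1(X,\mu)$, for $\mu$-a.e. $x$, $\frac{1}{\nu(F_n)}\int_{F_n} f(T^jx)\,d\nu(j)\to\int f\,d\mu$. The upper density of $S\subset\mathbb{G}$ is $\overline{D}(S)=\limsup_n \nu(S\cap F_n)/\nu(F_n)$. A $\mathbb{G}$-TDS is a pair $(X,T)$ with $X$ a compact metric space (metric $d$) and $T:\mathbb{G}\times X\to X$, $(j,x)\mapsto T^jx$, a group action (jointly Borel measurable) with each $T^j:X\to X$ continuous. An ergodic $\mathbb{G}$-TDS $(X,\mu,T)$ is a $\mathbb{G}$-TDS with a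 Borel probability measure $\mu$ that is invariant under every $T^j$ and ergodic (every measurable set invariant under all $T^j$ has measure $0$ or $1$). $L^2(X,\mu)$ consists of complex-valued functions. An eigenfunction is a nonzero $f\in L^2(X,\mu)$ for which there is a continuous homomorphism $w:\mathbb{G}\to S^1=\{z\in\mathbb{C}:|z|=1\}$ with $f\circ T^j=w(j)f$ for all $j\in\mathbb{G}$. $(X,\mu,T)$ has discrete spectrum if $L^2(X,\mu)$ has an orthonormal basis consisting of eigenfunctions. Define $d_b(x,y)=\limsup_n\frac{1}{\nu(F_n)}\int_{F_n}d(T^jx,T^jy)\,d\nu(j)$. $(X,T)$ is $\mu$-mean equicontinuous if for every $\tau>0$ there is a compact $M\subset X$ with $\mu(M)\ge 1-\tau$ such that for every $\varepsilon>0$ there is $\delta>0$ such that $x,y\in M$ and $d(x,y)\le\delta$ imply $d_b(x,y)\le\varepsilon$. $(X,T)$ is $\mu$-mean sensitive if there is $\varepsilon>0$ such that every Borel set $A$ with $\mu(A)>0$ contains points $x,y$ with $d_b(x,y)>\varepsilon$. For $f\in L^2(X,\mu)$ (a fixed representative), define $\rho_f(x,y)=\inf\{\varepsilon>0:\overline{D}(\{i\in\mathbb{G}:|f(T^ix)-f(T^iy)|>\varepsilon\})<\varepsilon\}$. $(X,T)$ is $\mu$-$f$-mean equicontinuous if for every $\tau>0$ there is a compact $M\subset X$ with $\mu(M)\ge1-\tau$ such that for every $\varepsilon>0$ there is $\delta>0$ such that $x,y\in M$ and $d(x,y)\le\delta$ imply $\rho_f(x,y)\le\varepsilon$. *)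

theory Defs
  imports "HOL-Probability.Probability"
begin

section \<open>Haar measure, Foelner sequences, densities\<close>

text \<open>
  The group is an additive topological abelian group given as a type; Haar measures are regular
  Borel measures.
\<close>

definition haar_measure :: "'g::{topological_ab_group_add, t2_space} measure \<Rightarrow> bool" where
  "haar_measure \<nu> \<longleftrightarrow>
     sets \<nu> = sets borel \<and>
     emeasure \<nu> UNIV \<noteq> 0 \<and>
     (\<forall>g. \<forall>A\<in>sets borel. emeasure \<nu> ((+) g ` A) = emeasure \<nu> A) \<and>
     (\<forall>K. compact K \<longrightarrow> emeasure \<nu> K < \<infinity>) \<and>
     (\<forall>A\<in>sets borel. emeasure \<nu> A = (INF U\<in>{U. open U \<and> A \<subseteq> U}. emeasure \<nu> U)) \<and>
     (\<forall>U. open U \<longrightarrow> emeasure \<nu> U = (SUP K\<in>{K. compact K \<and> K \<subseteq> U}. emeasure \<nu> K))"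

definition folner_sequence :: "'g::ab_group_add measure \<Rightarrow> (nat \<Rightarrow> 'g set) \<Rightarrow> bool" where
  "folner_sequence \<nu> F \<longleftrightarrow>
     (\<forall>n. F n \<in> sets \<nu> \<and> 0 < emeasure \<nu> (F n) \<and> emeasure \<nu> (F n) < \<infinity>) \<and>
     (\<forall>g. (\<lambda>n. measure \<nu> (sym_diff ((+) g ` F n) (F n)) / measure \<nu> (F n)) \<longlonglongrightarrow> 0)"

definition upper_density :: "'g measure \<Rightarrow> (nat \<Rightarrow> 'g set) \<Rightarrow> 'g set \<Rightarrow> ereal" where
  "upper_density \<nu> F S = limsup (\<lambda>n. ereal (measure \<nu> (S \<inter> F n) / measure \<nu> (F n)))"

section \<open>Measure preserving actions and the pointwise ergodic theorem\<close>

definition mp_action ::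
  "'x measure \<Rightarrow> ('g::{topological_space, ab_group_add} \<Rightarrow> 'x \<Rightarrow> 'x) \<Rightarrow> bool" where
  "mp_action M T \<longleftrightarrow>
     (\<lambda>(j, x). T j x) \<in> borel \<Otimes>\<^sub>M M \<rightarrow>\<^sub>M M \<and>
     (\<forall>x\<in>space M. T 0 x = x) \<and>
     (\<forall>i j. \<forall>x\<in>space M. T (i + j) x = T i (T j x)) \<and>
     (\<forall>j. distr M M (T j) = M)"

definition ergodic_action ::
  "'x measure \<Rightarrow> ('g::{topological_space, ab_group_add} \<Rightarrow> 'x \<Rightarrow> 'x) \<Rightarrow> bool" where
  "ergodic_action M T \<longleftrightarrow>
     mp_action M T \<and>
     (\<forall>A\<in>sets M. (\<forall>j. T j -` A \<inter> space M = A) \<longrightarrow> measure M A = 0 \<or> measure M A = 1)"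

definition standard_borel :: "'x measure \<Rightarrow> bool" where
  "standard_borel M \<longleftrightarrow>
     (\<exists>X. completely_metrizable_space X \<and> second_countable X \<and> topspace X = space M \<and>
          sets M = sigma_sets (space M) {U. openin X U})"

text \<open>
  A formula cannot quantify over all underlying types, so the standard probability spaces range over
  those whose underlying set is some set of reals, with an arbitrary (not necessarily the usual)
  standard Borel structure. This loses nothing: a Polish space has at most continuum many points, so
  every standard probability space is isomorphic to one of these.
\<close>

definition satisfies_pointwise_ergodic_theorem ::
  "'g::{topological_space, ab_group_add} measure \<Rightarrow> (nat \<Rightarrow> 'g set) \<Rightarrow> bool" where
  "satisfies_pointwise_ergodic_theorem \<nu> F \<longleftrightarrow>
     (\<forall>(M :: real measure) (T :: 'g \<Rightarrow> real \<Rightarrow> real) (f :: real \<Rightarrow> complex).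
        prob_space M \<and> standard_borel M \<and> ergodic_action M T \<and> integrable M f \<longrightarrow>
        (AE x in M. (\<lambda>n. (LINT j:F n|\<nu>. f (T j x)) / of_real (measure \<nu> (F n)))
                      \<longlonglongrightarrow> (LINT x|M. f x)))"

section \<open>Ergodic topological dynamical systems\<close>

text \<open>
  The phase space is a whole type. Class \<^class>\<open>polish_space\<close> (a metric space that is complete and
  second countable) is implied by compactness and only records these properties at the type
  level. Second countability also makes the product sigma-algebra in \<^const>\<open>mp_action\<close> the Borel
  sigma-algebra of the product, whether or not the group is second countable.
\<close>

definition ergodic_TDS ::
  "'x::polish_space measure \<Rightarrow> ('g::{topological_space, ab_group_add} \<Rightarrow> 'x \<Rightarrow> 'x) \<Rightarrow> bool" where
  "ergodic_TDS M T \<longleftrightarrow>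
     compact (UNIV :: 'x set) \<and>
     (\<forall>j. continuous_on UNIV (T j)) \<and>
     sets M = sets borel \<and> prob_space M \<and> ergodic_action M T"

definition L2_fun :: "'x measure \<Rightarrow> ('x \<Rightarrow> complex) \<Rightarrow> bool" where
  "L2_fun M f \<longleftrightarrow> f \<in> borel_measurable M \<and> integrable M (\<lambda>x. (norm (f x))\<^sup>2)"

definition eigenfunction ::
  "'x measure \<Rightarrow> ('g::{topological_space, ab_group_add} \<Rightarrow> 'x \<Rightarrow> 'x) \<Rightarrow> ('x \<Rightarrow> complex) \<Rightarrow> bool" where
  "eigenfunction M T f \<longleftrightarrow>
     L2_fun M f \<and> \<not> (AE x in M. f x = 0) \<and>
     (\<exists>w :: 'g \<Rightarrow> complex.
        continuous_on UNIV w \<and> (\<forall>j. norm (w j) = 1) \<and> (\<forall>i j. w (i + j) = w i * w j) \<and>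
        (\<forall>j. AE x in M. f (T j x) = w j * f x))"

text \<open>
  Elements of the basis are given by representatives; orthonormality rules out two distinct
  representatives of the same class.
\<close>

definition L2_orthonormal_basis :: "'x measure \<Rightarrow> ('x \<Rightarrow> complex) set \<Rightarrow> bool" where
  "L2_orthonormal_basis M B \<longleftrightarrow>
     (\<forall>b\<in>B. L2_fun M b) \<and>
     (\<forall>b\<in>B. \<forall>c\<in>B. (LINT x|M. b x * cnj (c x)) = (if b = c then 1 else 0)) \<and>
     (\<forall>f. L2_fun M f \<longrightarrow> (\<forall>\<epsilon>>0. \<exists>S a. finite S \<and> S \<subseteq> B \<and>
        sqrt (LINT x|M. (norm (f x - (\<Sum>b\<in>S. a b * b x)))\<^sup>2) < \<epsilon>))"

definition discrete_spectrum ::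
  "'x measure \<Rightarrow> ('g::{topological_space, ab_group_add} \<Rightarrow> 'x \<Rightarrow> 'x) \<Rightarrow> bool" where
  "discrete_spectrum M T \<longleftrightarrow>
     (\<exists>B. L2_orthonormal_basis M B \<and> (\<forall>b\<in>B. eigenfunction M T b))"

section \<open>Mean equicontinuity and mean sensitivity\<close>

definition d_b ::
  "'g measure \<Rightarrow> (nat \<Rightarrow> 'g set) \<Rightarrow> ('g \<Rightarrow> 'x::metric_space \<Rightarrow> 'x) \<Rightarrow> 'x \<Rightarrow> 'x \<Rightarrow> ereal" where
  "d_b \<nu> F T x y =
     limsup (\<lambda>n. ereal ((LINT j:F n|\<nu>. dist (T j x) (T j y)) / measure \<nu> (F n)))"

definition mean_equicontinuous ::
  "'g measure \<Rightarrow> (nat \<Rightarrow> 'g set) \<Rightarrow> 'x::metric_space measure \<Rightarrow> ('g \<Rightarrow> 'x \<Rightarrow> 'x) \<Rightarrow> bool" where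
  "mean_equicontinuous \<nu> F M T \<longleftrightarrow>
     (\<forall>\<tau>>0. \<exists>K. compact K \<and> measure M K \<ge> 1 - \<tau> \<and>
        (\<forall>\<epsilon>>0. \<exists>\<delta>>0. \<forall>x\<in>K. \<forall>y\<in>K. dist x y \<le> \<delta> \<longrightarrow> d_b \<nu> F T x y \<le> ereal \<epsilon>))"

definition mean_sensitive ::
  "'g measure \<Rightarrow> (nat \<Rightarrow> 'g set) \<Rightarrow> 'x::metric_space measure \<Rightarrow> ('g \<Rightarrow> 'x \<Rightarrow> 'x) \<Rightarrow> bool" where
  "mean_sensitive \<nu> F M T \<longleftrightarrow>
     (\<exists>\<epsilon>>0. \<forall>A\<in>sets M. measure M A > 0 \<longrightarrow> (\<exists>x\<in>A. \<exists>y\<in>A. d_b \<nu> F T x y > ereal \<epsilon>))"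

definition rho ::
  "'g measure \<Rightarrow> (nat \<Rightarrow> 'g set) \<Rightarrow> ('g \<Rightarrow> 'x \<Rightarrow> 'x) \<Rightarrow> ('x \<Rightarrow> complex) \<Rightarrow> 'x \<Rightarrow> 'x \<Rightarrow> real" where
  "rho \<nu> F T f x y =
     Inf {\<epsilon>. \<epsilon> > 0 \<and> upper_density \<nu> F {i. norm (f (T i x) - f (T i y)) > \<epsilon>} < ereal \<epsilon>}"

definition fun_mean_equicontinuous ::
  "'g measure \<Rightarrow> (nat \<Rightarrow> 'g set) \<Rightarrow> 'x::metric_space measure \<Rightarrow> ('g \<Rightarrow> 'x \<Rightarrow> 'x) \<Rightarrow>
     ('x \<Rightarrow> complex) \<Rightarrow> bool" where
  "fun_mean_equicontinuous \<nu> F M T f \<longleftrightarrow>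
     (\<forall>\<tau>>0. \<exists>K. compact K \<and> measure M K \<ge> 1 - \<tau> \<and>
        (\<forall>\<epsilon>>0. \<exists>\<delta>>0. \<forall>x\<in>K. \<forall>y\<in>K. dist x y \<le> \<delta> \<longrightarrow> rho \<nu> F T f x y \<le> \<epsilon>))"

end

theory Submission
  imports Defs "HOL-Library.Diagonal_Subsequence" "HOL-Computational_Algebra.Fundamental_Theorem_Algebra"
begin

text \<open>The implications form a cycle. Equicontinuity on large compact sets with respect to a function \<open>D\<close> of
  two points amounts to the existence, for every \<open>\<epsilon>\<close>, of countably many Borel cells that cover almost
  everything and on which \<open>D\<close> is at most \<open>\<epsilon>\<close>; a cell of positive measure refutes mean sensitivity.

  If the system is not mean sensitive, then for every \<open>\<epsilon>\<close> the invariant relation \<open>d\<^sub>b(x, y) \<le> \<epsilon>\<close> has positive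
  measure, so its indicator is the kernel of a nonzero Hilbert-Schmidt operator \<open>K\<close> that commutes with the action.
  By ergodicity almost all sections of the relation have the same measure \<open>c\<close>, and averaging the metric along
  orbits shows that \<open>K f / c\<close> is close to \<open>f\<close> for Lipschitz \<open>f\<close>. The eigenspaces of \<open>K\<^sup>2\<close> are finite-dimensional and
  invariant, hence spanned by eigenfunctions of the action, whose characters are continuous by Steinhaus's theorem.
  Thus eigenfunctions span a dense subspace.

  Conversely, if \<open>f\<close> is close to a finite combination \<open>p\<close> of eigenfunctions, the pointwise ergodic theorem bounds the
  density of the times at which \<open>f - p\<close> is large, and the variation of \<open>p\<close> along two orbits is controlled by the
  values of the eigenfunctions at the two starting points. A finite cover by small balls passes from indicators back
  to the metric.\<close>

section \<open>Equicontinuity and countable covers by small cells\<close>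

text \<open>The group need not be second countable, so identities that hold almost everywhere for
  each group element cannot in general be gathered on one null set. Two devices answer this. Fubini
  on a Foelner set times the phase space gives the identity for almost all times along almost every
  orbit, which is all that orbit averages see. And the kernel of \<open>K\<close> is the indicator
  of a relation that is invariant at every pair of points, so \<open>K f\<close> is an honest
  function whose translates are computed exactly: eigenvalue equations produced by \<open>K\<close>
  hold at every point, the eigenvalue is a quotient of values along one orbit, and it is therefore a
  Borel function of the group element. Square integrable functions are kept as functions rather than
  classes, hence the pointwise limits throughout. The error in approximating a Lipschitz function by
  \<open>K f / c\<close> must not involve \<open>c\<close>, since \<open>c\<close> may tend to zero
  with \<open>\<epsilon>\<close>; it does not, because the integral of the metric over the relation
  is itself at most \<open>\<epsilon> * c\<close>.\<close>

definition mu_equicontinuous :: "'x::metric_space measure \<Rightarrow> ('x \<Rightarrow> 'x \<Rightarrow> ereal) \<Rightarrow> bool" where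
  "mu_equicontinuous M D \<longleftrightarrow>
     (\<forall>\<tau>>0. \<exists>K. compact K \<and> measure M K \<ge> 1 - \<tau> \<and>
        (\<forall>\<epsilon>>0. \<exists>\<delta>>0. \<forall>x\<in>K. \<forall>y\<in>K. dist x y \<le> \<delta> \<longrightarrow> D x y \<le> ereal \<epsilon>))"

text \<open>No topology enters here and null sets may be dropped, so two such covers have a common
  refinement; compact sets as in \<open>mu_equicontinuous\<close> would have to be shrunk anew at
  each combination.\<close>

definition small_cells :: "'x measure \<Rightarrow> ('x \<Rightarrow> 'x \<Rightarrow> ereal) \<Rightarrow> bool" where
  "small_cells M D \<longleftrightarrow>
     (\<forall>\<epsilon>>0. \<exists>A :: nat \<Rightarrow> 'x set. range A \<subseteq> sets M \<and> (AE x in M. x \<in> (\<Union>n. A n)) \<and>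
        (\<forall>n. \<forall>x\<in>A n. \<forall>y\<in>A n. D x y \<le> ereal \<epsilon>))"

lemma small_cellsE:
  fixes M :: "'x measure"
  assumes "small_cells M D" "\<epsilon> > 0"
  obtains A :: "nat \<Rightarrow> 'x set" where "range A \<subseteq> sets M" "AE x in M. x \<in> (\<Union>n. A n)"
    "\<And>n x y. x \<in> A n \<Longrightarrow> y \<in> A n \<Longrightarrow> D x y \<le> ereal \<epsilon>"
  using assms(1)[unfolded small_cells_def, rule_format, OF assms(2)] by blast

lemma compact_compact_separated:
  fixes S T :: "'a::metric_space set"
  assumes "compact S" "compact T" "S \<inter> T = {}"
  shows "\<exists>d>0. \<forall>x\<in>S. \<forall>y\<in>T. d \<le> dist x y"
proof (cases "S \<times> T = {}")
  case True
  then show ?thesis by (intro exI[of _ 1]) auto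
next
  case False
  have "continuous_on (S \<times> T) (\<lambda>q. dist (fst q) (snd q))"
    by (intro continuous_intros)
  then obtain p where "p \<in> S \<times> T" "\<forall>q\<in>S \<times> T. dist (fst p) (snd p) \<le> dist (fst q) (snd q)"
    using continuous_attains_inf[OF compact_Times[OF assms(1,2)] False] by blast
  then show ?thesis
    using assms(3) by (intro exI[of _ "dist (fst p) (snd p)"]) auto
qed

text \<open>Finitely many disjoint compact sets have positive mutual distances. In a union of
  compact parts of cells, close points therefore lie in the same cell.\<close>

lemma disjoint_compacts_separated:
  fixes K :: "nat \<Rightarrow> 'a::metric_space set"
  assumes "\<And>i. compact (K i)" "disjoint_family K"
  shows "\<exists>\<delta>>0. \<forall>i<N. \<forall>j<N. \<forall>x\<in>K i. \<forall>y\<in>K j. dist x y \<le> \<delta> \<longrightarrow> i = j"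
proof -
  have "\<forall>\<^sub>F \<delta> in at_right 0. \<forall>x\<in>K i. \<forall>y\<in>K j. dist x y \<le> \<delta> \<longrightarrow> i = j" for i j
  proof (cases "i = j")
    case False
    then have "K i \<inter> K j = {}"
      using assms(2) by (auto simp: disjoint_family_on_def)
    then obtain d where d: "d > 0" "\<forall>x\<in>K i. \<forall>y\<in>K j. d \<le> dist x y"
      using compact_compact_separated[of "K i" "K j"] assms(1) by metis
    have "\<forall>\<^sub>F \<delta> in at_right 0. \<delta> < d"
      using d(1) by (auto simp: eventually_at_right_field)
    then show ?thesis
      by (rule eventually_mono) (use d in force)
  qed auto
  then have "\<forall>\<^sub>F \<delta> in at_right (0::real). \<forall>i\<in>{..<N}. \<forall>j\<in>{..<N}. \<forall>x\<in>K i. \<forall>y\<in>K j. dist x y \<le> \<delta> \<longrightarrow> i = j"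
    by (intro eventually_ball_finite[OF finite_lessThan] ballI) blast
  then have "\<forall>\<^sub>F \<delta> in at_right (0::real). \<delta> > 0 \<and> (\<forall>i\<in>{..<N}. \<forall>j\<in>{..<N}. \<forall>x\<in>K i. \<forall>y\<in>K j. dist x y \<le> \<delta> \<longrightarrow> i = j)"
    using eventually_at_right_less[of 0] by (rule eventually_elim2) auto
  from eventually_happens[OF this] show ?thesis
    by (simp add: Ball_def)
qed

lemma inner_regular_measure:
  fixes M :: "'x::polish_space measure"
  assumes "prob_space M" "sets M = sets borel" "B \<in> sets borel" "e > 0"
  shows "\<exists>K. compact K \<and> K \<subseteq> B \<and> measure M K > measure M B - e"
proof -
  interpret prob_space M by fact
  have *: "emeasure M B = (SUP K\<in>{K. K \<subseteq> B \<and> compact K}. emeasure M K)"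
    using assms by (intro inner_regular) auto
  show ?thesis
  proof (cases "measure M B - e < 0")
    case True
    then show ?thesis by (intro exI[of _ "{}"]) auto
  next
    case False
    then have "ennreal (measure M B - e) < emeasure M B"
      using \<open>e > 0\<close> by (simp add: emeasure_eq_measure ennreal_less_iff)
    then obtain K where "K \<subseteq> B" "compact K" "ennreal (measure M B - e) < emeasure M K"
      unfolding * less_SUP_iff by auto
    then show ?thesis
      using False by (auto simp: emeasure_eq_measure ennreal_less_iff)
  qed
qed

text \<open>Make the cells disjoint, keep finitely many that carry more than
  \<open>1 - \<tau>/2\<close>, and shrink each to a compact subset. Below the separation distance of
  these compacts, closeness forces membership in a common cell.\<close>

lemma small_cells_compact:
  fixes M :: "'x::polish_space measure"
  assumes M: "prob_space M" "sets M = sets borel" and D: "small_cells M D"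
    and "\<epsilon> > 0" "\<tau> > 0"
  shows "\<exists>K \<delta>. compact K \<and> measure M K \<ge> 1 - \<tau> \<and> \<delta> > 0 \<and>
    (\<forall>x\<in>K. \<forall>y\<in>K. dist x y \<le> \<delta> \<longrightarrow> D x y \<le> ereal \<epsilon>)"
proof -
  interpret prob_space M by fact
  obtain A :: "nat \<Rightarrow> 'x set" where A: "range A \<subseteq> sets M" "AE x in M. x \<in> (\<Union>n. A n)"
    "\<And>n x y. x \<in> A n \<Longrightarrow> y \<in> A n \<Longrightarrow> D x y \<le> ereal \<epsilon>"
    using small_cellsE[OF D \<open>\<epsilon> > 0\<close>] by blast
  let ?B = "disjointed A"
  have B: "range ?B \<subseteq> sets M" "disjoint_family ?B" "(\<Union>n. ?B n) = (\<Union>n. A n)"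
    using sets.range_disjointed_sets[OF A(1)] disjoint_family_disjointed[of A] UN_disjointed_eq[of A] by auto
  have "prob (\<Union>n. ?B n) = 1"
    using A B by (subst prob_eq_1) auto
  moreover have "(\<lambda>n. prob (?B n)) sums prob (\<Union>n. ?B n)"
    using B by (intro finite_measure_UNION)
  ultimately have "(\<lambda>N. \<Sum>n<N. prob (?B n)) \<longlonglongrightarrow> 1"
    by (simp add: sums_def)
  then have "\<forall>\<^sub>F N in sequentially. 1 - \<tau>/2 < (\<Sum>n<N. prob (?B n))"
    by (rule order_tendstoD) (use \<open>\<tau> > 0\<close> in auto)
  then obtain N where N: "1 - \<tau>/2 < (\<Sum>n<N. prob (?B n))"
    using eventually_happens by fastforce
  \<comment> \<open>The \<open>N\<close> cells together lose at most \<open>\<tau>/2\<close>; the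
    summand 1 keeps the denominator positive when \<open>N = 0\<close>.\<close>
  have "\<exists>K. compact K \<and> K \<subseteq> ?B n \<and> measure M K > measure M (?B n) - \<tau> / (2 * (real N + 1))" for n
    using B M \<open>\<tau> > 0\<close> by (intro inner_regular_measure) auto
  then obtain K where K: "\<And>n. compact (K n)" "\<And>n. K n \<subseteq> ?B n"
      "\<And>n. measure M (K n) > measure M (?B n) - \<tau> / (2 * (real N + 1))"
    by metis
  have disj: "disjoint_family K"
    using B(2) K(2) unfolding disjoint_family_on_def by blast
  obtain \<delta> where \<delta>: "\<delta> > 0" "\<forall>i<N. \<forall>j<N. \<forall>x\<in>K i. \<forall>y\<in>K j. dist x y \<le> \<delta> \<longrightarrow> i = j"
    using disjoint_compacts_separated[OF K(1) disj] by blast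
  have "1 - \<tau> \<le> (\<Sum>n<N. prob (?B n)) - \<tau>/2"
    using N by auto
  also have "\<dots> \<le> (\<Sum>n<N. prob (?B n)) - real N * (\<tau> / (2 * (real N + 1)))"
    using \<open>\<tau> > 0\<close> by (auto simp: field_simps)
  also have "\<dots> = (\<Sum>n<N. prob (?B n) - \<tau> / (2 * (real N + 1)))"
    by (simp add: sum_subtractf)
  also have "\<dots> \<le> (\<Sum>n<N. prob (K n))"
    by (intro sum_mono less_imp_le K(3))
  also have "\<dots> = prob (\<Union>n<N. K n)"
    using K(1) disj M(2)
    by (intro finite_measure_finite_Union[symmetric]) (auto simp: disjoint_family_on_def borel_compact)
  finally have "1 - \<tau> \<le> prob (\<Union>n<N. K n)" .
  moreover have "D x y \<le> ereal \<epsilon>"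
    if xy: "x \<in> (\<Union>n<N. K n)" "y \<in> (\<Union>n<N. K n)" "dist x y \<le> \<delta>" for x y
  proof -
    obtain i j where ij: "i < N" "j < N" "x \<in> K i" "y \<in> K j"
      using xy by auto
    then have "i = j" using \<delta> xy by blast
    then show ?thesis
      using A(3)[of x i y] K(2)[of i] ij disjointed_subset[of A i] by auto
  qed
  ultimately show ?thesis
    using K(1) \<delta>(1) by (intro exI[of _ "\<Union>n<N. K n"] exI[of _ \<delta>]) auto
qed

text \<open>\<open>small_cells_compact\<close> yields a compact set for one
  \<open>\<epsilon>\<close> at a time, but a single set has to serve all of them. Intersecting the
  sets for \<open>\<epsilon> = 1/(m+1)\<close>, with losses \<open>\<tau> / 2^(m+1)\<close>, costs
  \<open>\<tau>\<close> in total.\<close>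

lemma small_cells_imp_mu_equicontinuous:
  fixes M :: "'x::polish_space measure"
  assumes M: "prob_space M" "sets M = sets borel" and D: "small_cells M D"
  shows "mu_equicontinuous M D"
  unfolding mu_equicontinuous_def
proof (intro allI impI)
  fix \<tau> :: real assume \<tau>: "\<tau> > 0"
  interpret prob_space M by fact
  have "\<exists>K \<delta>. compact K \<and> measure M K \<ge> 1 - \<tau> * (1/2)^Suc m \<and> \<delta> > 0 \<and>
    (\<forall>x\<in>K. \<forall>y\<in>K. dist x y \<le> \<delta> \<longrightarrow> D x y \<le> ereal (inverse (Suc m)))" for m
    using \<tau> by (intro small_cells_compact[OF M D]) auto
  then obtain K \<delta> where K: "\<And>m. compact (K m)" "\<And>m. measure M (K m) \<ge> 1 - \<tau> * (1/2)^Suc m"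
    and \<delta>: "\<And>m. \<delta> m > 0" "\<And>m x y. x\<in>K m \<Longrightarrow> y\<in>K m \<Longrightarrow> dist x y \<le> \<delta> m \<Longrightarrow> D x y \<le> ereal (inverse (Suc m))"
    by metis
  let ?K = "\<Inter>m. K m"
  have sets: "K m \<in> sets M" for m
    using K(1) M(2) by (simp add: borel_compact)
  have cK: "compact ?K"
    using compact_Int_closed[OF K(1)[of 0] closed_INT[of UNIV K]] K(1)
    by (simp add: compact_imp_closed Int_absorb1 INF_lower)
  have le: "prob (space M - K m) \<le> \<tau> * (1/2)^Suc m" for m
    using K(2)[of m] sets[of m] by (subst prob_compl) auto
  have geo: "(\<lambda>m. \<tau> * (1/2)^Suc m) sums \<tau>"
    using sums_mult[OF power_half_series, of \<tau>] by simp
  have "prob (space M - ?K) = prob (\<Union>m. space M - K m)"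
    by (rule arg_cong[of _ _ prob]) auto
  also have "\<dots> \<le> (\<Sum>m. prob (space M - K m))"
    using sets le geo
    by (intro finite_measure_subadditive_countably) (auto intro!: summable_comparison_test'[OF sums_summable[OF geo], of 0])
  also have "\<dots> \<le> (\<Sum>m. \<tau> * (1/2)^Suc m)"
    using sets le geo
    by (intro suminf_le sums_summable[OF geo]) (auto intro!: summable_comparison_test'[OF sums_summable[OF geo], of 0])
  also have "\<dots> = \<tau>"
    using geo by (rule sums_unique[symmetric])
  finally have "prob ?K \<ge> 1 - \<tau>"
    using sets by (subst (asm) prob_compl) auto
  moreover have "\<exists>\<delta>>0. \<forall>x\<in>?K. \<forall>y\<in>?K. dist x y \<le> \<delta> \<longrightarrow> D x y \<le> ereal \<epsilon>" if \<epsilon>: "\<epsilon> > 0" for \<epsilon>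
  proof -
    obtain m where "inverse (real (Suc m)) < \<epsilon>"
      using reals_Archimedean[OF \<epsilon>] by auto
    then show ?thesis
      using \<delta>(1)[of m] order_trans[OF \<delta>(2)[of _ m], of _ _ "ereal \<epsilon>"]
      by (intro exI[of _ "\<delta> m"]) simp
  qed
  ultimately show "\<exists>K. compact K \<and> 1 - \<tau> \<le> prob K \<and>
             (\<forall>\<epsilon>>0. \<exists>\<delta>>0. \<forall>x\<in>K. \<forall>y\<in>K. dist x y \<le> \<delta> \<longrightarrow> D x y \<le> ereal \<epsilon>)"
    using cK by blast
qed

lemma countable_small_cover:
  assumes "\<delta> > 0"
  shows "\<exists>A :: nat \<Rightarrow> 'x::polish_space set. range A \<subseteq> sets borel \<and> (\<Union>n. A n) = UNIV \<and>
    (\<forall>n. \<forall>x\<in>A n. \<forall>y\<in>A n. dist x y \<le> \<delta>)"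
proof -
  obtain X :: "'x set" where X: "countable X" "\<And>Y. open Y \<Longrightarrow> Y \<noteq> {} \<Longrightarrow> \<exists>d\<in>X. d \<in> Y"
    using countable_dense_setE[where 'a='x] by metis
  define A where "A n = ball (from_nat_into X n) (\<delta>/2)" for n
  have "x \<in> (\<Union>n. A n)" for x
  proof -
    obtain d where "d \<in> X" "x \<in> ball d (\<delta>/2)"
      using X(2)[of "ball x (\<delta>/2)"] assms by (auto simp: dist_commute)
    then show ?thesis
      using from_nat_into_surj[OF X(1)] unfolding A_def by (metis UNIV_I UN_I)
  qed
  moreover have "dist x y \<le> \<delta>" if "x \<in> A n" "y \<in> A n" for x y n
    using that dist_triangle_half_r[of "from_nat_into X n" x \<delta> y] by (auto simp: A_def)
  ultimately show ?thesis
    by (intro exI[of _ A]) (auto simp: A_def)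
qed

text \<open>For fixed \<open>\<epsilon>\<close>, cut each compact set \<open>K m\<close> of measure
  at least \<open>1 - 1/(m+1)\<close> into countably many pieces of diameter at most its own
  \<open>\<delta> m\<close>. The sets \<open>K m\<close> together have full measure.\<close>

lemma mu_equicontinuous_imp_small_cells:
  fixes M :: "'x::polish_space measure"
  assumes M: "prob_space M" "sets M = sets borel" and D: "mu_equicontinuous M D"
  shows "small_cells M D"
  unfolding small_cells_def
proof (intro allI impI)
  fix \<epsilon> :: real assume \<epsilon>: "\<epsilon> > 0"
  interpret prob_space M by fact
  have "\<exists>K \<delta>. compact K \<and> measure M K \<ge> 1 - inverse (Suc m) \<and> \<delta> > 0 \<and> (\<forall>x\<in>K. \<forall>y\<in>K. dist x y \<le> \<delta> \<longrightarrow> D x y \<le> ereal \<epsilon>)" for m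
    using D[unfolded mu_equicontinuous_def, rule_format, of "inverse (Suc m)"] \<epsilon>
    by (metis inverse_positive_iff_positive of_nat_0_less_iff zero_less_Suc)
  then obtain K \<delta> where K: "\<And>m. compact (K m)" "\<And>m. measure M (K m) \<ge> 1 - inverse (Suc m)"
     "\<And>m. \<delta> m > 0" "\<And>m x y. x\<in>K m \<Longrightarrow> y\<in>K m \<Longrightarrow> dist x y \<le> \<delta> m \<Longrightarrow> D x y \<le> ereal \<epsilon>"
    by metis
  have "\<exists>A :: nat \<Rightarrow> 'x::polish_space set. range A \<subseteq> sets borel \<and> (\<Union>n. A n) = UNIV \<and>
    (\<forall>n. \<forall>x\<in>A n. \<forall>y\<in>A n. dist x y \<le> \<delta> m)" for m
    using K(3) by (rule countable_small_cover)
  then have "\<exists>A :: nat \<Rightarrow> nat \<Rightarrow> 'x::polish_space set. \<forall>m. range (A m) \<subseteq> sets borel \<and> (\<Union>n. A m n) = UNIV \<and>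
    (\<forall>n. \<forall>x\<in>A m n. \<forall>y\<in>A m n. dist x y \<le> \<delta> m)"
    by (intro choice) blast
  then obtain A :: "nat \<Rightarrow> nat \<Rightarrow> 'x set" where A': "\<forall>m. range (A m) \<subseteq> sets borel \<and> (\<Union>n. A m n) = UNIV \<and>
    (\<forall>n. \<forall>x\<in>A m n. \<forall>y\<in>A m n. dist x y \<le> \<delta> m)" ..
  have A: "\<And>m. (\<Union>n. A m n) = UNIV" "\<And>m n x y. x \<in> A m n \<Longrightarrow> y \<in> A m n \<Longrightarrow> dist x y \<le> \<delta> m"
    and Am: "\<And>m n. A m n \<in> sets borel"
    using A' by (simp, blast, blast)
  have setsK: "K m \<in> sets M" for m
    using K(1) M(2) by (simp add: borel_compact)
  define C where "C i = (case prod_decode i of (m, n) \<Rightarrow> K m \<inter> A m n)" for i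
  have UC: "(\<Union>i. C i) = (\<Union>m. K m)"
  proof
    show "(\<Union>m. K m) \<subseteq> (\<Union>i. C i)"
    proof
      fix x assume "x \<in> (\<Union>m. K m)"
      then obtain m where m: "x \<in> K m" by auto
      moreover obtain n where "x \<in> A m n" using A(1)[of m] by auto
      ultimately have "x \<in> C (prod_encode (m, n))" by (simp add: C_def)
      then show "x \<in> (\<Union>i. C i)" by blast
    qed
  qed (auto simp: C_def split: prod.splits)
  have "1 \<le> prob (\<Union>m. K m)"
  proof (rule LIMSEQ_le_const2)
    show "(\<lambda>m. 1 - inverse (real (Suc m))) \<longlonglongrightarrow> 1"
      using tendsto_diff[OF tendsto_const LIMSEQ_inverse_real_of_nat] by simp
    have "1 - inverse (real (Suc m)) \<le> prob (\<Union>m. K m)" for m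
      using K(2)[of m] finite_measure_mono[of "K m" "\<Union>m. K m"] setsK by (force intro: order_trans)
    then show "\<exists>N. \<forall>n\<ge>N. 1 - inverse (real (Suc n)) \<le> prob (\<Union>m. K m)" by blast
  qed
  then have "prob (\<Union>i. C i) = 1"
    unfolding UC by (intro antisym) auto
  moreover have C: "C i \<in> sets M" for i
    using setsK Am M(2) by (auto simp: C_def split: prod.splits)
  ultimately have "AE x in M. x \<in> (\<Union>i. C i)"
    by (subst (asm) prob_eq_1) auto
  moreover have "D x y \<le> ereal \<epsilon>" if "x \<in> C i" "y \<in> C i" for x y i
    using that K(4) A(2) by (auto simp: C_def split: prod.splits)
  ultimately show "\<exists>A :: nat \<Rightarrow> 'x set. range A \<subseteq> events \<and> (AE x in M. x \<in> \<Union> (range A)) \<and> (\<forall>n. \<forall>x\<in>A n. \<forall>y\<in>A n. D x y \<le> ereal \<epsilon>)"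
    using C by (intro exI[of _ C]) auto
qed

lemma mu_equicontinuous_iff_small_cells:
  fixes M :: "'x::polish_space measure"
  assumes "prob_space M" "sets M = sets borel"
  shows "mu_equicontinuous M D \<longleftrightarrow> small_cells M D"
  using small_cells_imp_mu_equicontinuous[OF assms] mu_equicontinuous_imp_small_cells[OF assms] by blast

text \<open>Countably many null cells cannot cover almost everything. Besides refuting mean
  sensitivity, this serves on the group itself, where it finds a set of positive Haar measure on
  which a character is nearly constant.\<close>

lemma small_cells_positive:
  fixes M :: "'x measure"
  assumes "prob_space M" "small_cells M D" "\<epsilon> > 0"
  shows "\<exists>A\<in>sets M. measure M A > 0 \<and> (\<forall>x\<in>A. \<forall>y\<in>A. D x y \<le> ereal \<epsilon>)"
proof -
  interpret prob_space M by fact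
  obtain A :: "nat \<Rightarrow> 'x set" where A: "range A \<subseteq> sets M" "AE x in M. x \<in> (\<Union>n. A n)"
    "\<And>n x y. x \<in> A n \<Longrightarrow> y \<in> A n \<Longrightarrow> D x y \<le> ereal \<epsilon>"
    using small_cellsE[OF assms(2,3)] by blast
  have "\<exists>n. prob (A n) \<noteq> 0"
  proof (rule ccontr)
    assume "\<not> ?thesis"
    then have "AE x in M. x \<notin> A n" for n
      using A(1) by (subst prob_eq_0[symmetric]) auto
    then have "AE x in M. \<forall>n. x \<notin> A n"
      by (subst AE_all_countable) auto
    with A(2) have "AE x in M. False" by eventually_elim auto
    then show False by simp
  qed
  then show ?thesis
    using A by (metis range_subsetD zero_less_measure_iff)
qed

lemma small_cells_add:
  fixes M :: "'x measure"
  assumes "small_cells M D1" "small_cells M D2" "AE x in M. x \<in> X0"  "X0 \<in> sets M"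
    "\<And>e. e > 0 \<Longrightarrow> \<exists>e1>0. \<exists>e2>0. \<forall>x\<in>X0. \<forall>y\<in>X0. D1 x y \<le> ereal e1 \<longrightarrow> D2 x y \<le> ereal e2 \<longrightarrow> D x y \<le> ereal e"
  shows "small_cells M D"
  unfolding small_cells_def
proof (intro allI impI)
  fix e :: real assume "e > 0"
  then obtain e1 e2 where e: "e1 > 0" "e2 > 0"
    "\<And>x y. x \<in> X0 \<Longrightarrow> y \<in> X0 \<Longrightarrow> D1 x y \<le> ereal e1 \<Longrightarrow> D2 x y \<le> ereal e2 \<Longrightarrow> D x y \<le> ereal e"
    using assms(5) by metis
  obtain A :: "nat \<Rightarrow> 'x set" where A: "range A \<subseteq> sets M" "AE x in M. x \<in> (\<Union>n. A n)"
    "\<And>n x y. x \<in> A n \<Longrightarrow> y \<in> A n \<Longrightarrow> D1 x y \<le> ereal e1"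
    using small_cellsE[OF assms(1) \<open>e1 > 0\<close>] by blast
  obtain B :: "nat \<Rightarrow> 'x set" where B: "range B \<subseteq> sets M" "AE x in M. x \<in> (\<Union>n. B n)"
    "\<And>n x y. x \<in> B n \<Longrightarrow> y \<in> B n \<Longrightarrow> D2 x y \<le> ereal e2"
    using small_cellsE[OF assms(2) \<open>e2 > 0\<close>] by blast
  define C where "C i = (case prod_decode i of (m, n) \<Rightarrow> X0 \<inter> A m \<inter> B n)" for i
  have "AE x in M. x \<in> (\<Union>i. C i)"
    using A(2) B(2) assms(3)
  proof eventually_elim
    case (elim x)
    then obtain m n where "x \<in> C (prod_encode (m, n))" by (auto simp: C_def)
    then show ?case by blast
  qed
  moreover have "C i \<in> sets M" for i
    using A(1) B(1) assms(4) by (auto simp: C_def range_subsetD split: prod.splits)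
  moreover have "D x y \<le> ereal e" if "x \<in> C i" "y \<in> C i" for x y i
    using that e A(3) B(3) by (auto simp: C_def split: prod.splits)
  ultimately show "\<exists>A :: nat \<Rightarrow> 'x set. range A \<subseteq> sets M \<and> (AE x in M. x \<in> \<Union> (range A)) \<and> (\<forall>n. \<forall>x\<in>A n. \<forall>y\<in>A n. D x y \<le> ereal e)"
    by (intro exI[of _ C]) auto
qed

section \<open>The pointwise ergodic theorem on the phase space\<close>

text \<open>The pointwise ergodic hypothesis concerns measures on sets of reals with an arbitrary
  standard Borel structure, so a bare injection suffices to transport the system there. A point is
  coded by the set of indices of the basic open sets that contain it.\<close>

lemma inj_polish_real: "\<exists>\<phi> :: 'x::polish_space \<Rightarrow> real. inj \<phi>"
proof -
  obtain \<B> :: "'x set set" where \<B>: "countable \<B>" "topological_basis \<B>"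
    using ex_countable_basis by blast
  have "\<B> \<noteq> {}"
    using topological_basisE[OF \<B>(2) open_UNIV UNIV_I] by blast
  then obtain B :: "nat \<Rightarrow> 'x set" where B: "topological_basis (range B)"
    using \<B> range_from_nat_into by metis
  define c where "c x = {n. x \<in> B n}" for x
  have "inj c"
  proof (rule injI, rule ccontr)
    fix x y assume c: "c x = c y" and "x \<noteq> y"
    then obtain U where "open U" "x \<in> U" "y \<notin> U"
      using t1_space by metis
    then obtain n where "x \<in> B n" "B n \<subseteq> U"
      using topological_basisE[OF B] by (metis rangeE)
    then show False
      using c \<open>y \<notin> U\<close> by (auto simp: c_def)
  qed
  moreover obtain h :: "nat set \<Rightarrow> real" where "inj h"
    using nat_sets_eqpoll_reals unfolding eqpoll_def bij_betw_def by blast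
  ultimately show ?thesis
    by (meson inj_compose)
qed

text \<open>The range of \<open>\<phi>\<close> receives the topology that makes
  \<open>\<phi>\<close> a homeomorphism onto it, namely the pullback under the inverse map; it has
  nothing to do with any topology already present on the target type.\<close>

lemma standard_borel_embed_measure:
  fixes M :: "'x::polish_space measure" and \<phi> :: "'x \<Rightarrow> 'y"
  assumes "sets M = sets borel" "inj \<phi>"
  shows "standard_borel (embed_measure M \<phi>)"
proof -
  have sp: "space M = UNIV"
    using assms(1) by (metis sets_eq_imp_space_eq space_borel)
  define \<psi> where "\<psi> = the_inv \<phi>"
  have \<psi>: "\<psi> (\<phi> x) = x" for x
    using assms(2) by (simp add: \<psi>_def the_inv_f_f)
  define X where "X = pullback_topology (range \<phi>) \<psi> euclidean"
  have vi: "\<psi> -` V \<inter> range \<phi> = \<phi> ` V" for V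
    using \<psi> by (auto simp: image_iff)
  have op: "openin X U \<longleftrightarrow> (\<exists>V. open V \<and> U = \<phi> ` V)" for U
    by (simp add: X_def openin_pullback_topology vi)
  have tX: "topspace X = range \<phi>"
    by (simp add: X_def topspace_pullback_topology)
  have "openin X U \<longleftrightarrow> open (\<phi> -` U)" if "U \<subseteq> range \<phi>" for U
    using that op assms(2) by (metis image_vimage_eq inf.absorb1 inj_vimage_image_eq)
  then have "homeomorphic_map (euclidean :: 'x topology) X \<phi>"
    unfolding homeomorphic_map_def quotient_map_def
    using assms(2) tX by (simp add: vimage_def)
  then have hom: "(euclidean :: 'x topology) homeomorphic_space X"
    using homeomorphic_map_imp_homeomorphic_space by blast
  have sc: "second_countable (euclidean :: 'x topology)"
  proof -
    obtain B :: "'x set set" where "countable B" "topological_basis B"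
      using ex_countable_basis by blast
    then show ?thesis
      unfolding second_countable_def
      by (intro exI[of _ B]) (auto simp: topological_basis_open elim!: topological_basisE)
  qed
  have "sets (embed_measure M \<phi>) = (`) \<phi> ` sigma_sets UNIV (Collect open)"
    using assms by (auto simp: sets_embed_measure borel_def)
  also have "\<dots> = sigma_sets (\<phi> ` UNIV) ((`) \<phi> ` Collect open)"
  proof -
    have "(`) \<phi> ` sigma_sets UNIV (Collect open) = (\<lambda>A. \<psi> -` A \<inter> range \<phi>) ` sigma_sets UNIV (Collect open)"
      by (simp only: vi)
    also have "\<dots> = sigma_sets (range \<phi>) ((\<lambda>A. \<psi> -` A \<inter> range \<phi>) ` Collect open)"
      using sigma_sets_vimage_commute[of \<psi> "range \<phi>" UNIV "Collect open"] by (simp only: Setcompr_eq_image) simp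
    also have "(\<lambda>A. \<psi> -` A \<inter> range \<phi>) ` Collect open = (`) \<phi> ` Collect open"
      by (simp only: vi)
    finally show ?thesis .
  qed
  also have "(`) \<phi> ` Collect open = {U. openin X U}"
    using op by auto
  finally show ?thesis
    unfolding standard_borel_def
    using hom sc tX sp completely_metrizable_space_euclidean[where 'a='x]
    by (intro exI[of _ X])
      (auto simp: space_embed_measure homeomorphic_space_second_countability homeomorphic_completely_metrizable_space)
qed

text \<open>Conjugation by \<open>\<phi>\<close>. Outside the range of \<open>\<phi>\<close> the
  value of \<open>the_inv \<phi>\<close> is arbitrary, but the range is the whole space of the
  embedded measure.\<close>

lemma ergodic_action_embed_measure:
  fixes M :: "'x measure" and \<phi> :: "'x \<Rightarrow> 'y" and T :: "'g::{topological_space, ab_group_add} \<Rightarrow> 'x \<Rightarrow> 'x"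
  assumes "ergodic_action M T" "inj \<phi>" "space M = UNIV"
  shows "ergodic_action (embed_measure M \<phi>) (\<lambda>j r. \<phi> (T j (the_inv \<phi> r)))"
proof -
  let ?M = "embed_measure M \<phi>"
  define \<psi> where "\<psi> = the_inv \<phi>"
  have \<psi>: "\<psi> (\<phi> x) = x" for x
    using assms(2) by (simp add: \<psi>_def the_inv_f_f)
  have sp: "space ?M = range \<phi>"
    by (simp add: space_embed_measure assms(3))
  have T: "(\<lambda>(j, x). T j x) \<in> borel \<Otimes>\<^sub>M M \<rightarrow>\<^sub>M M" "\<And>x. T 0 x = x" "\<And>i j x. T (i + j) x = T i (T j x)"
     "\<And>j. distr M M (T j) = M"
    using assms(1,3) unfolding ergodic_action_def mp_action_def by auto
  have [measurable]: "\<phi> \<in> M \<rightarrow>\<^sub>M ?M"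
    using assms(2) by (rule measurable_embed_measure2)
  have [measurable]: "\<psi> \<in> ?M \<rightarrow>\<^sub>M M"
    by (rule measurable_embed_measure1) (simp add: \<psi>)
  note T(1)[measurable]
  have Tm[measurable]: "T j \<in> M \<rightarrow>\<^sub>M M" for j
    using measurable_compose[OF measurable_Pair1' T(1), of j] by simp
  have "(\<lambda>(j, r). \<phi> (T j (\<psi> r))) \<in> borel \<Otimes>\<^sub>M ?M \<rightarrow>\<^sub>M ?M"
  proof -
    have "(\<lambda>p. \<phi> ((\<lambda>(j, x). T j x) (fst p, \<psi> (snd p)))) \<in> borel \<Otimes>\<^sub>M ?M \<rightarrow>\<^sub>M ?M"
      by measurable
    then show ?thesis by (simp add: case_prod_beta')
  qed
  moreover have "distr ?M ?M (\<lambda>r. \<phi> (T j (\<psi> r))) = ?M" for j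
  proof -
    have "distr ?M ?M (\<lambda>r. \<phi> (T j (\<psi> r))) = distr (distr M ?M \<phi>) ?M (\<lambda>r. \<phi> (T j (\<psi> r)))"
      using embed_measure_eq_distr[OF assms(2), of M] by simp
    also have "\<dots> = distr M ?M (\<lambda>x. \<phi> (T j x))"
      by (subst distr_distr) (auto simp: comp_def \<psi>)
    also have "\<dots> = distr (distr M M (T j)) ?M \<phi>"
      by (subst distr_distr) (auto simp: comp_def)
    also have "\<dots> = ?M"
      using embed_measure_eq_distr[OF assms(2), of M] T(4) by simp
    finally show ?thesis .
  qed
  ultimately have mp: "mp_action ?M (\<lambda>j r. \<phi> (T j (\<psi> r)))"
    unfolding mp_action_def using T(2,3) \<psi> by (auto simp: sp)
  have "measure ?M A = 0 \<or> measure ?M A = 1"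
    if A: "A \<in> sets ?M" "\<forall>j. (\<lambda>r. \<phi> (T j (\<psi> r))) -` A \<inter> space ?M = A" for A
  proof -
    obtain B where B: "B \<in> sets M" "A = \<phi> ` B"
      using A(1) assms(2) by (auto simp: sets_embed_measure)
    have "x \<in> T j -` B \<longleftrightarrow> x \<in> B" for j x
    proof -
      have "\<phi> x \<in> (\<lambda>r. \<phi> (T j (\<psi> r))) -` A \<inter> space ?M \<longleftrightarrow> \<phi> x \<in> A"
        using A(2) by simp
      then show ?thesis
        using assms(2) \<psi> unfolding B(2) sp by (simp add: inj_image_mem_iff)
    qed
    then have "T j -` B = B" for j
      by blast
    then have "measure M B = 0 \<or> measure M B = 1"
      using assms(1,3) B(1) by (auto simp: ergodic_action_def)
    moreover have "measure ?M A = measure M B"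
      using B assms(2) by (simp add: measure_def emeasure_embed_measure in_sets_embed_measure inj_vimage_image_eq)
    ultimately show ?thesis by simp
  qed
  with mp show ?thesis
    unfolding ergodic_action_def \<psi>_def by blast
qed

lemma norm_integral_le:
  fixes f :: "'a \<Rightarrow> 'b::{banach, second_countable_topology}"
  assumes "integrable M f" "integrable M g" "\<And>x. norm (f x) \<le> g x"
  shows "norm (\<integral>x. f x \<partial>M) \<le> (\<integral>x. g x \<partial>M)"
  by (rule order_trans[OF integral_norm_bound integral_mono]) (use assms in auto)

lemma AE_imp_measurable_set:
  assumes "AE x in M. Q x"
  shows "\<exists>A\<in>sets M. (AE x in M. x \<in> A) \<and> (\<forall>x\<in>A. Q x)"
proof -
  obtain N where N: "\<And>x. x \<in> space M - N \<Longrightarrow> Q x" "N \<in> null_sets M"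
    using AE_E3[OF assms] by blast
  then show ?thesis
    using AE_not_in[OF N(2)] by (intro bexI[of _ "space M - N"]) auto
qed

section \<open>Foelner averages along orbits\<close>

locale folner_tds =
  fixes \<nu> :: "'g::{topological_ab_group_add, t2_space} measure"
    and F :: "nat \<Rightarrow> 'g set"
    and M :: "'x::polish_space measure"
    and T :: "'g \<Rightarrow> 'x \<Rightarrow> 'x"
  assumes haar: "haar_measure \<nu>"
    and folner: "folner_sequence \<nu> F"
    and pointwise_ergodic: "satisfies_pointwise_ergodic_theorem \<nu> F"
    and tds: "ergodic_TDS M T"
begin

sublocale prob_space M
  using tds by (simp add: ergodic_TDS_def)

text \<open>Averages over a Foelner set become expectations, so facts on probability spaces and
  Fubini apply to them directly.\<close>

abbreviation P :: "nat \<Rightarrow> 'g measure" where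
  "P n \<equiv> uniform_measure \<nu> (F n)"

lemma sets_M[measurable_cong, simp]: "sets M = sets borel"
  using tds by (simp add: ergodic_TDS_def)

lemma space_M[simp]: "space M = UNIV"
  by (metis sets_M sets_eq_imp_space_eq space_borel)

lemma sets_nu[measurable_cong, simp]: "sets \<nu> = sets borel"
  using haar by (simp add: haar_measure_def)


lemma space_nu[simp]: "space \<nu> = UNIV"
  by (metis sets_nu sets_eq_imp_space_eq space_borel)

lemma sets_P[measurable_cong, simp]: "sets (P n) = sets borel"
  by simp

lemma F_sets[measurable]: "F n \<in> sets borel"
  and F_pos: "emeasure \<nu> (F n) \<noteq> 0" and F_finite: "emeasure \<nu> (F n) < \<infinity>" "emeasure \<nu> (F n) \<noteq> \<infinity>"
  using folner[unfolded folner_sequence_def, THEN conjunct1, rule_format, of n] by auto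

lemma measure_F_pos: "measure \<nu> (F n) > 0"
  using F_pos F_finite by (simp add: measure_def enn2real_positive_iff top.not_eq_extremum zero_less_iff_neq_zero)

lemma emeasure_F: "emeasure \<nu> (F n) = ennreal (measure \<nu> (F n))"
  using F_finite by (simp add: emeasure_eq_ennreal_measure)

sublocale P: prob_space "P n" for n
  using F_pos F_finite by (intro prob_space_uniform_measure) auto

lemma action: "(\<lambda>(j, x). T j x) \<in> borel \<Otimes>\<^sub>M M \<rightarrow>\<^sub>M M" "T 0 x = x" "T (i + j) x = T i (T j x)"
     "distr M M (T j) = M"
  using tds unfolding ergodic_TDS_def ergodic_action_def mp_action_def by auto

lemma ergodic: "ergodic_action M T"
  using tds by (simp add: ergodic_TDS_def)

lemma compact_UNIV: "compact (UNIV :: 'x set)"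
  using tds by (simp add: ergodic_TDS_def)

lemma T_measurable[measurable (raw)]:
  assumes [measurable]: "f \<in> N \<rightarrow>\<^sub>M borel" "g \<in> N \<rightarrow>\<^sub>M borel"
  shows "(\<lambda>z. T (f z) (g z)) \<in> N \<rightarrow>\<^sub>M borel"
proof -
  have "(\<lambda>z. (\<lambda>(j, x). T j x) (f z, g z)) \<in> N \<rightarrow>\<^sub>M M"
    by (rule measurable_compose[OF _ action(1)]) measurable
  then show ?thesis by (simp add: measurable_cong_sets[OF refl sets_M])
qed

lemma T_measurable_M[measurable]: "T j \<in> M \<rightarrow>\<^sub>M M"
  by (subst measurable_cong_sets[OF refl sets_M]) measurable

lemma T_uminus[simp]: "T (- j) (T j x) = x" "T j (T (- j) x) = x"
  using action(2)[of x] action(3)[of "- j" j x] action(3)[of j "- j" x] by auto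

lemma T_commute: "T i (T j x) = T j (T i x)"
  by (metis action(3) add.commute)

lemma integral_P:
  fixes f :: "'g \<Rightarrow> 'a::{banach, second_countable_topology}"
  assumes [measurable]: "f \<in> borel_measurable borel"
  shows "(\<integral>j. f j \<partial>P n) = (LINT j:F n|\<nu>. f j) /\<^sub>R measure \<nu> (F n)"
proof -
  have "(\<integral>j. f j \<partial>P n) = (\<integral>j. f j \<partial>density \<nu> (\<lambda>j. ennreal (indicator (F n) j / measure \<nu> (F n))))"
    unfolding uniform_measure_def
    by (intro arg_cong2[where f=lebesgue_integral] refl arg_cong2[where f=density] ext)
      (use measure_F_pos[of n] in \<open>auto simp: emeasure_F divide_ennreal split: split_indicator simp flip: ennreal_1\<close>)
  also have "\<dots> = (\<integral>j. (indicator (F n) j / measure \<nu> (F n)) *\<^sub>R f j \<partial>\<nu>)"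
    by (subst integral_density) auto
  also have "\<dots> = (\<integral>j. (indicator (F n) j *\<^sub>R f j) /\<^sub>R measure \<nu> (F n) \<partial>\<nu>)"
    by (intro Bochner_Integration.integral_cong) (auto simp: divide_inverse mult.commute)
  finally show ?thesis
    by (simp add: set_lebesgue_integral_def del: scaleR_scaleR)
qed

lemma avg_real:
  "f \<in> borel_measurable borel \<Longrightarrow> (LINT j:F n|\<nu>. f j) / measure \<nu> (F n) = (\<integral>j. f j \<partial>P n :: real)"
  by (simp add: integral_P divide_inverse mult.commute)

lemma avg_complex:
  "f \<in> borel_measurable borel \<Longrightarrow> (LINT j:F n|\<nu>. f j) / of_real (measure \<nu> (F n)) = (\<integral>j. f j \<partial>P n :: complex)"
  by (simp add: integral_P divide_inverse mult.commute scaleR_conv_of_real of_real_inverse)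

lemma pointwise_ergodic_M:
  fixes f :: "'x \<Rightarrow> complex"
  assumes f: "integrable M f"
  shows "AE x in M. (\<lambda>n. \<integral>j. f (T j x) \<partial>P n) \<longlonglongrightarrow> (\<integral>x. f x \<partial>M)"
proof -
  obtain \<phi> :: "'x \<Rightarrow> real" where \<phi>: "inj \<phi>"
    using inj_polish_real by blast
  have \<psi>: "the_inv \<phi> (\<phi> x) = x" for x
    using \<phi> by (simp add: the_inv_f_f)
  let ?M = "embed_measure M \<phi>"
  have meas[measurable]: "\<phi> \<in> M \<rightarrow>\<^sub>M ?M"
    using \<phi> by (rule measurable_embed_measure2)
  have eq: "?M = distr M ?M \<phi>"
    using \<phi> by (rule embed_measure_eq_distr)
  have fm[measurable]: "f \<in> borel_measurable borel"
    using f borel_measurable_integrable[OF f] by simp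
  have m: "(\<lambda>r. f (the_inv \<phi> r)) \<in> borel_measurable ?M"
    by (rule measurable_embed_measure1) (simp add: \<psi>)
  have pM: "prob_space ?M"
    by (subst eq, rule prob_space_distr) (rule meas)
  have int: "integrable ?M (\<lambda>r. f (the_inv \<phi> r))"
    using m f by (subst eq, subst integrable_distr_eq) (auto simp: \<psi>)
  have lim: "(\<integral>r. f (the_inv \<phi> r) \<partial>?M) = (\<integral>x. f x \<partial>M)"
    using m by (subst eq, subst integral_distr) (auto simp: \<psi>)
  have "AE r in ?M. (\<lambda>n. (LINT j:F n|\<nu>. f (the_inv \<phi> (\<phi> (T j (the_inv \<phi> r))))) / of_real (measure \<nu> (F n)))
     \<longlonglongrightarrow> (\<integral>r. f (the_inv \<phi> r) \<partial>?M)"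
    using pointwise_ergodic[unfolded satisfies_pointwise_ergodic_theorem_def, rule_format,
        OF conjI[OF pM conjI[OF standard_borel_embed_measure[OF sets_M \<phi>]
          conjI[OF ergodic_action_embed_measure[OF ergodic \<phi> space_M] int]]]] .
  then have "AE r in distr M ?M \<phi>. (\<lambda>n. (LINT j:F n|\<nu>. f (T j (the_inv \<phi> r))) / of_real (measure \<nu> (F n)))
     \<longlonglongrightarrow> (\<integral>x. f x \<partial>M)"
    unfolding lim \<psi> by (subst eq[symmetric])
  from AE_distrD[OF meas this] show ?thesis
    by eventually_elim (simp add: \<psi> avg_complex)
qed

lemma pointwise_ergodic_real:
  fixes f :: "'x \<Rightarrow> real"
  assumes f: "integrable M f"
  shows "AE x in M. (\<lambda>n. \<integral>j. f (T j x) \<partial>P n) \<longlonglongrightarrow> (\<integral>x. f x \<partial>M)"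
  using pointwise_ergodic_M[OF integrable_of_real[OF f, where 'a=complex]]
  by eventually_elim (simp add: tendsto_of_real_iff)


lemma integral_T:
  fixes f :: "'x \<Rightarrow> 'a::{banach, second_countable_topology}"
  assumes "f \<in> borel_measurable borel"
  shows "(\<integral>x. f (T j x) \<partial>M) = (\<integral>x. f x \<partial>M)"
  using integral_distr[of "T j" M M f] assms action(4)[of j] by simp

lemma integrable_T:
  fixes f :: "'x \<Rightarrow> 'a::{banach, second_countable_topology}"
  assumes "integrable M f"
  shows "integrable M (\<lambda>x. f (T j x))"
  using integrable_distr[of "T j" M M f] assms action(4)[of j] by simp

text \<open>The exceptional set of \<open>x\<close> may depend on \<open>j\<close>, and there may be
  uncountably many \<open>j\<close>. Fubini on each Foelner set trades "for every \<open>j\<close>"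
  for "for almost every \<open>j\<close>" and in return gives one null set of \<open>x\<close>,
  common to all \<open>n\<close>.\<close>

lemma AE_orbit:
  assumes m: "Measurable.pred (borel \<Otimes>\<^sub>M borel) (\<lambda>p. R (fst p) (snd p))" and "\<And>j. AE x in M. R j x"
  shows "AE x in M. \<forall>n. AE j in P n. R j x"
proof -
  have "AE x in M. AE j in P n. R j x" for n
  proof -
    interpret pair_sigma_finite "P n" M ..
    have "{z \<in> space (P n \<Otimes>\<^sub>M M). R (fst z) (snd z)} \<in> sets (P n \<Otimes>\<^sub>M M)"
      using m by measurable
    from AE_commute[OF this] assms(2) show ?thesis by simp
  qed
  then show ?thesis by (subst AE_all_countable) simp
qed

text \<open>The invariance hypothesis holds only up to null sets depending on the group element, and the
  group may be uncountable; Fubini along the Foelner sets together with the pointwise ergodic theorem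
  replaces the usual passage to a strictly invariant representative.\<close>

lemma invariant_imp_const:
  fixes f :: "'x \<Rightarrow> complex"
  assumes f: "integrable M f" and inv: "\<And>j. AE x in M. f (T j x) = f x"
  shows "AE x in M. f x = (\<integral>x. f x \<partial>M)"
proof -
  have [measurable]: "f \<in> borel_measurable borel"
    using borel_measurable_integrable[OF f] by simp
  have "AE x in M. \<forall>n. AE j in P n. f (T j x) = f x"
    by (rule AE_orbit[OF _ inv]) measurable
  with pointwise_ergodic_M[OF f] show ?thesis
  proof eventually_elim
    case (elim x)
    have "(\<integral>j. f (T j x) \<partial>P n) = (\<integral>j. f x \<partial>P n)" for n
      using elim(2) by (intro integral_cong_AE) auto
    then show ?case
      using elim(1) P.prob_space by (simp add: LIMSEQ_const_iff)
  qed
qed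

lemma invariant_imp_const_real:
  fixes f :: "'x \<Rightarrow> real"
  assumes f: "integrable M f" and inv: "\<And>j. AE x in M. f (T j x) = f x"
  shows "AE x in M. f x = (\<integral>x. f x \<partial>M)"
proof -
  have "AE x in M. complex_of_real (f x) = (\<integral>x. complex_of_real (f x) \<partial>M)"
    by (intro invariant_imp_const integrable_of_real f) (use inv in simp)
  then show ?thesis by (simp only: integral_complex_of_real of_real_eq_iff)
qed

section \<open>Translation of Haar measure and of Foelner averages\<close>

lemma plus_measurable[measurable]: "(+) g \<in> borel \<rightarrow>\<^sub>M (borel :: 'g measure)"
  by (intro borel_measurable_continuous_onI continuous_intros)

lemma nu_shift: "A \<in> sets borel \<Longrightarrow> emeasure \<nu> ((+) g ` A) = emeasure \<nu> A"
  using haar[unfolded haar_measure_def, THEN conjunct2, THEN conjunct2, THEN conjunct1, rule_format] by simp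

lemma distr_plus: "distr \<nu> \<nu> ((+) g) = \<nu>"
proof (rule measure_eqI)
  fix A assume "A \<in> sets (distr \<nu> \<nu> ((+) g))"
  then have A: "A \<in> sets borel" by simp
  have "(+) g -` A = (+) (- g) ` A"
    by (auto simp: image_iff intro!: bexI[of _ "g + _"])
  then have "emeasure (distr \<nu> \<nu> ((+) g)) A = emeasure \<nu> ((+) (- g) ` A)"
    using A by (subst emeasure_distr) auto
  also have "\<dots> = emeasure \<nu> A"
    using nu_shift A by blast
  finally show "emeasure (distr \<nu> \<nu> ((+) g)) A = emeasure \<nu> A" .
qed simp

text \<open>Substitution moves the shift from the integrand to the domain. The integrals over
  \<open>g + F n\<close> and over \<open>F n\<close> differ only on the symmetric difference, whose
  relative measure tends to zero.\<close>

lemma folner_shift: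
  fixes f :: "'g \<Rightarrow> real"
  assumes [measurable]: "f \<in> borel_measurable borel" and C: "\<And>j. \<bar>f j\<bar> \<le> C"
  shows "(\<lambda>n. (\<integral>j. f (g + j) \<partial>P n) - (\<integral>j. f j \<partial>P n)) \<longlonglongrightarrow> 0"
proof (rule Lim_null_comparison)
  let ?S = "\<lambda>n. sym_diff ((+) g ` F n) (F n)"
  have img: "(+) g ` F n = (+) (- g) -` F n" for n
    by (auto simp: image_iff intro!: bexI[of _ "- g + _"])
  have [measurable]: "(+) g ` F n \<in> sets borel" for n
    using measurable_sets[OF plus_measurable F_sets] by (simp add: img)
  have fin: "emeasure \<nu> ((+) g ` F n) = emeasure \<nu> (F n)" for n
    by (rule nu_shift) (rule F_sets)
  show "(\<lambda>n. C * (measure \<nu> (?S n) / measure \<nu> (F n))) \<longlonglongrightarrow> 0"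
    using folner by (intro tendsto_mult_right_zero) (auto simp: folner_sequence_def)
  show "\<forall>\<^sub>F n in sequentially. norm ((\<integral>j. f (g + j) \<partial>P n) - (\<integral>j. f j \<partial>P n)) \<le> C * (measure \<nu> (?S n) / measure \<nu> (F n))"
  proof (rule always_eventually, rule allI)
    fix n
    have C0: "0 \<le> C" using C[of undefined] by linarith
    have int: "integrable \<nu> (\<lambda>j. indicator A j * f j)" if "A \<in> sets borel" "emeasure \<nu> A < \<infinity>" for A
      using integrableI_bounded_set_indicator[of A \<nu> f C] that C by (auto simp: real_scaleR_def)
    have "emeasure \<nu> (?S n) \<le> emeasure \<nu> ((+) g ` F n \<union> F n)"
      by (intro emeasure_mono) auto
    also have "\<dots> \<le> emeasure \<nu> ((+) g ` F n) + emeasure \<nu> (F n)"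
      by (intro emeasure_subadditive) auto
    also have "\<dots> < \<infinity>"
      using F_finite fin by simp
    finally have Sf: "emeasure \<nu> (?S n) < \<infinity>" .
    have 1: "(LINT j:F n|\<nu>. f (g + j)) = (\<integral>j. indicator ((+) g ` F n) j * f j \<partial>\<nu>)"
    proof -
      have "(\<integral>j. indicator ((+) g ` F n) j * f j \<partial>\<nu>) = (\<integral>j. indicator ((+) g ` F n) j * f j \<partial>distr \<nu> \<nu> ((+) g))"
        by (simp add: distr_plus)
      also have "\<dots> = (\<integral>j. indicator ((+) g ` F n) (g + j) * f (g + j) \<partial>\<nu>)"
        by (subst integral_distr) auto
      also have "\<dots> = (LINT j:F n|\<nu>. f (g + j))"
        unfolding set_lebesgue_integral_def
        by (intro Bochner_Integration.integral_cong) (auto split: split_indicator)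
      finally show ?thesis by simp
    qed
    have "(\<integral>j. f (g + j) \<partial>P n) - (\<integral>j. f j \<partial>P n) =
        ((LINT j:F n|\<nu>. f (g + j)) - (LINT j:F n|\<nu>. f j)) / measure \<nu> (F n)"
      by (simp add: avg_real[symmetric] diff_divide_distrib)
    also have "(LINT j:F n|\<nu>. f (g + j)) - (LINT j:F n|\<nu>. f j) =
      (\<integral>j. indicator ((+) g ` F n) j * f j - indicator (F n) j * f j \<partial>\<nu>)"
      unfolding 1 using F_finite fin
      by (subst Bochner_Integration.integral_diff) (auto intro!: int simp: set_lebesgue_integral_def)
    finally have eq: "(\<integral>j. f (g + j) \<partial>P n) - (\<integral>j. f j \<partial>P n) =
      (\<integral>j. indicator ((+) g ` F n) j * f j - indicator (F n) j * f j \<partial>\<nu>) / measure \<nu> (F n)" .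
    have "\<bar>\<integral>j. indicator ((+) g ` F n) j * f j - indicator (F n) j * f j \<partial>\<nu>\<bar>
       \<le> (\<integral>j. indicator (?S n) j * C \<partial>\<nu>)"
      unfolding real_norm_def[symmetric]
    proof (rule norm_integral_le)
      show "integrable \<nu> (\<lambda>j. indicator ((+) g ` F n) j * f j - indicator (F n) j * f j)"
        using F_finite fin by (intro Bochner_Integration.integrable_diff int) auto
      show "integrable \<nu> (\<lambda>j. indicator (?S n) j * C)"
        using Sf by auto
      show "norm (indicator ((+) g ` F n) j * f j - indicator (F n) j * f j) \<le> indicator (?S n) j * C" for j
        using C[of j] C0 by (auto split: split_indicator)
    qed
    also have "\<dots> = C * measure \<nu> (?S n)"
      using Sf by simp
    finally show "norm ((\<integral>j. f (g + j) \<partial>P n) - (\<integral>j. f j \<partial>P n)) \<le> C * (measure \<nu> (?S n) / measure \<nu> (F n))"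
      unfolding eq using measure_F_pos[of n] by (auto simp: divide_right_mono)
  qed
qed

end

section \<open>From discrete spectrum to mean equicontinuity\<close>

text \<open>The supremum expresses finitely many simultaneous smallness conditions. It is taken in
  \<open>ereal\<close>, where the empty supremum is minus infinity, so the induction starts with
  nothing to check.\<close>

lemma small_cells_SUP:
  fixes M :: "'x measure"
  assumes "finite C" "\<And>c. c \<in> C \<Longrightarrow> small_cells M (D c)"
  shows "small_cells M (\<lambda>x y. SUP c\<in>C. D c x y)"
  using assms
proof (induction C)
  case empty
  show ?case
    unfolding small_cells_def by (auto intro!: exI[of _ "\<lambda>_. space M"])
next
  case (insert c C)
  show ?case
  proof (rule small_cells_add)
    show "small_cells M (D c)" "small_cells M (\<lambda>x y. SUP c\<in>C. D c x y)"
      using insert by auto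
    show "AE x in M. x \<in> space M" by (rule AE_space)
    show "\<exists>e1>0. \<exists>e2>0. \<forall>x\<in>space M. \<forall>y\<in>space M. D c x y \<le> ereal e1 \<longrightarrow> (SUP c\<in>C. D c x y) \<le> ereal e2 \<longrightarrow>
        (SUP c\<in>insert c C. D c x y) \<le> ereal e" if "e > 0" for e
      using that by (intro exI[of _ e] conjI) auto
  qed auto
qed

text \<open>The cells are preimages of small sets covering the target. This is applied to
  eigenfunctions on the phase space and to a character on the group.\<close>

lemma small_cells_measurable:
  fixes M :: "'x measure" and g :: "'x \<Rightarrow> 'b::polish_space"
  assumes [measurable]: "g \<in> borel_measurable M"
  shows "small_cells M (\<lambda>x y. ereal (dist (g x) (g y)))"
  unfolding small_cells_def
proof (intro allI impI)
  fix e :: real assume "e > 0"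
  then obtain A :: "nat \<Rightarrow> 'b set" where A: "range A \<subseteq> sets borel" "(\<Union>n. A n) = UNIV"
    "\<forall>n. \<forall>x\<in>A n. \<forall>y\<in>A n. dist x y \<le> e"
    using countable_small_cover[where 'x='b and \<delta>=e] by blast
  have A1: "A n \<in> sets borel" for n
    using A(1) by auto
  have "x \<in> (\<Union>n. g -` A n \<inter> space M)" if "x \<in> space M" for x
    using A(2) that by (simp add: set_eq_iff)
  moreover have "g -` A n \<inter> space M \<in> sets M" for n
    using A1 by measurable
  ultimately show "\<exists>A :: nat \<Rightarrow> 'x set. range A \<subseteq> sets M \<and> (AE x in M. x \<in> \<Union> (range A)) \<and>
      (\<forall>n. \<forall>x\<in>A n. \<forall>y\<in>A n. ereal (dist (g x) (g y)) \<le> ereal e)"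
    using A(3) by (intro exI[of _ "\<lambda>n. g -` A n \<inter> space M"]) auto
qed

section \<open>Linear operations on square integrable functions\<close>

lemma L2_measurable: "L2_fun M f \<Longrightarrow> f \<in> borel_measurable M"
  by (simp add: L2_fun_def)

lemma norm_add_squared_le: "(norm (x + y))\<^sup>2 \<le> 2 * (norm x)\<^sup>2 + 2 * (norm y)\<^sup>2"
  for x y :: "'a::real_normed_vector"
proof -
  have "(norm (x + y))\<^sup>2 \<le> (norm x + norm y)\<^sup>2"
    by (intro power_mono norm_triangle_ineq) auto
  also have "\<dots> \<le> 2 * (norm x)\<^sup>2 + 2 * (norm y)\<^sup>2"
    using sum_squares_bound[of "norm x" "norm y"] by (simp add: power2_sum)
  finally show ?thesis .
qed

lemma L2_add:
  assumes "L2_fun M f" "L2_fun M g"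
  shows "L2_fun M (\<lambda>x. f x + g x)"
proof -
  have [measurable]: "f \<in> borel_measurable M" "g \<in> borel_measurable M"
    using assms by (auto simp: L2_fun_def)
  have "integrable M (\<lambda>x. (norm (f x + g x))\<^sup>2)"
  proof (rule Bochner_Integration.integrable_bound)
    show "integrable M (\<lambda>x. 2 * (norm (f x))\<^sup>2 + 2 * (norm (g x))\<^sup>2)"
      using assms by (auto simp: L2_fun_def)
    show "AE x in M. norm ((norm (f x + g x))\<^sup>2) \<le> norm (2 * (norm (f x))\<^sup>2 + 2 * (norm (g x))\<^sup>2)"
      using norm_add_squared_le[of "f _" "g _"] by (intro AE_I2) simp
  qed measurable
  then show ?thesis by (simp add: L2_fun_def)
qed

lemma L2_scale: "L2_fun M f \<Longrightarrow> L2_fun M (\<lambda>x. c * f x)"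
  by (auto simp: L2_fun_def norm_mult power_mult_distrib)

lemma L2_diff: "L2_fun M f \<Longrightarrow> L2_fun M g \<Longrightarrow> L2_fun M (\<lambda>x. f x - g x)"
  using L2_add[of M f "\<lambda>x. - 1 * g x"] L2_scale[of M g "- 1"] by simp

lemma L2_zero: "L2_fun M (\<lambda>x. 0)"
  by (simp add: L2_fun_def)

lemma L2_sum: "(\<And>i. i \<in> I \<Longrightarrow> L2_fun M (f i)) \<Longrightarrow> L2_fun M (\<lambda>x. \<Sum>i\<in>I. f i x)"
  by (induction I rule: infinite_finite_induct) (auto intro: L2_add L2_zero)

context folner_tds
begin

lemma mean_equicontinuous_eq: "mean_equicontinuous \<nu> F M T = small_cells M (d_b \<nu> F T)"
  unfolding mean_equicontinuous_def mu_equicontinuous_def[symmetric]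
  by (rule mu_equicontinuous_iff_small_cells[OF prob_space_axioms sets_M])

lemma fun_mean_equicontinuous_eq:
  "fun_mean_equicontinuous \<nu> F M T f = small_cells M (\<lambda>x y. ereal (rho \<nu> F T f x y))"
proof -
  have "fun_mean_equicontinuous \<nu> F M T f = mu_equicontinuous M (\<lambda>x y. ereal (rho \<nu> F T f x y))"
    unfolding fun_mean_equicontinuous_def mu_equicontinuous_def by simp
  then show ?thesis
    by (simp only: mu_equicontinuous_iff_small_cells[OF prob_space_axioms sets_M])
qed

lemma d_b_eq: "d_b \<nu> F T x y = limsup (\<lambda>n. ereal (\<integral>j. dist (T j x) (T j y) \<partial>P n))"
  unfolding d_b_def by (subst avg_real) simp_all

lemma upper_density_eq:
  "S \<in> sets borel \<Longrightarrow> upper_density \<nu> F S = limsup (\<lambda>n. ereal (measure (P n) S))"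
  unfolding upper_density_def using F_pos F_finite by (simp add: Int_commute)

lemma upper_density_le_1: "upper_density \<nu> F S \<le> 1"
proof -
  have "measure \<nu> (S \<inter> F n) \<le> measure \<nu> (F n)" for n
  proof (cases "S \<inter> F n \<in> sets \<nu>")
    case True
    then show ?thesis
      using F_finite by (intro measure_mono_fmeasurable) (auto simp: fmeasurable_def)
  qed (simp add: measure_notin_sets)
  then have "ereal (measure \<nu> (S \<inter> F n) / measure \<nu> (F n)) \<le> 1" for n
    using measure_F_pos[of n] by simp
  then show ?thesis
    unfolding upper_density_def by (intro Limsup_bounded always_eventually) auto
qed

lemma rho_le:
  assumes "e > 0" "upper_density \<nu> F {i. norm (f (T i x) - f (T i y)) > e} < ereal e"
  shows "rho \<nu> F T f x y \<le> e"
  unfolding rho_def by (rule cInf_lower) (use assms in \<open>auto intro!: bdd_belowI[of _ 0]\<close>)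

lemma rho_lessD:
  assumes "rho \<nu> F T f x y < e"
  obtains e' where "0 < e'" "e' < e" "upper_density \<nu> F {i. norm (f (T i x) - f (T i y)) > e'} < ereal e'"
proof -
  \<comment> \<open>Upper densities are at most 1, so 2 always qualifies and the infimum in
    \<open>rho\<close> is over a nonempty set.\<close>
  have "upper_density \<nu> F {i. norm (f (T i x) - f (T i y)) > 2} < ereal 2"
    by (rule le_less_trans[OF upper_density_le_1]) simp
  then have ne: "{\<epsilon>. \<epsilon> > 0 \<and> upper_density \<nu> F {i. norm (f (T i x) - f (T i y)) > \<epsilon>} < ereal \<epsilon>} \<noteq> {}"
    by (auto intro!: exI[of _ 2])
  show ?thesis
    using assms cInf_lessD[OF ne, of e] that unfolding rho_def by blast
qed

lemma dist_bounded: "\<exists>R>0. \<forall>x y :: 'x. dist x y \<le> R"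
proof -
  obtain R where R: "\<And>x y :: 'x. dist x y \<le> R"
    using compact_imp_bounded[OF compact_UNIV] unfolding bounded_two_points by auto
  have "dist x y \<le> \<bar>R\<bar> + 1" for x y :: 'x
    using R[of x y] by linarith
  then show ?thesis
    by (intro exI[of _ "\<bar>R\<bar> + 1"]) auto
qed

text \<open>Cover the space by finitely many balls of radius \<open>\<epsilon>/4\<close>. At a time
  when two orbits agree on membership in each ball they share a ball and are at most
  \<open>\<epsilon>/2\<close> apart; at the remaining times their distance is at most
  \<open>R\<close>, and smallness of \<open>rho\<close> for the indicators makes these times
  rare.\<close>

lemma indicator_mean_equicontinuous_imp_mean_equicontinuous:
  assumes "\<And>B. B \<in> sets borel \<Longrightarrow> fun_mean_equicontinuous \<nu> F M T (indicator B)"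
  shows "mean_equicontinuous \<nu> F M T"
  unfolding mean_equicontinuous_eq small_cells_def
proof (intro allI impI)
  fix \<epsilon> :: real assume \<epsilon>: "\<epsilon> > 0"
  obtain R where R: "R > 0" "\<And>x y :: 'x. dist x y \<le> R"
    using dist_bounded by blast
  have "x \<in> (\<Union>c\<in>UNIV. ball c (\<epsilon>/4))" for x :: 'x
    using \<epsilon> by (intro UN_I[of x]) auto
  then have cover: "UNIV \<subseteq> (\<Union>c\<in>UNIV. ball c (\<epsilon>/4) :: 'x set)"
    by blast
  obtain C :: "'x set" where C: "finite C" "UNIV \<subseteq> (\<Union>c\<in>C. ball c (\<epsilon>/4))"
    by (rule compactE_image[OF compact_UNIV _ cover]) auto
  \<comment> \<open>The bound \<open>1/4\<close> keeps thresholds below \<open>2 * \<eta>\<close>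
    under 1, the only nonzero value of a difference of indicators. The other bound lets the
    \<open>card C\<close> sets of bad times, each of density below \<open>2 * \<eta>\<close>,
    contribute at most \<open>\<epsilon>/2\<close> to the average distance.\<close>
  define \<eta> where "\<eta> = min (1/4) (\<epsilon> / (4 * R * (real (card C) + 1)))"
  have \<eta>: "\<eta> > 0" "\<eta> \<le> 1/4" "R * (real (card C) * (2 * \<eta>)) \<le> \<epsilon>/2"
  proof -
    show "\<eta> > 0"
      using \<epsilon> R by (auto simp: \<eta>_def)
    show "\<eta> \<le> 1/4"
      unfolding \<eta>_def by (rule min.cobounded1)
    have "R * (real (card C) * (2 * \<eta>)) \<le> R * ((real (card C) + 1) * (2 * (\<epsilon> / (4 * R * (real (card C) + 1)))))"
      using R \<epsilon> by (intro mult_left_mono mult_mono) (auto simp: \<eta>_def)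
    also have "\<dots> = \<epsilon>/2"
    proof -
      have *: "R * (X * (2 * (\<epsilon> / (4 * R * X)))) = \<epsilon>/2" if "X > 0" for X :: real
        using that R by (simp add: field_simps)
      show ?thesis by (rule *) simp
    qed
    finally show "R * (real (card C) * (2 * \<eta>)) \<le> \<epsilon>/2" .
  qed
  let ?I = "\<lambda>c :: 'x. indicator (ball c (\<epsilon>/4)) :: 'x \<Rightarrow> complex"
  have "small_cells M (\<lambda>x y. SUP c\<in>C. ereal (rho \<nu> F T (?I c) x y))"
    using assms C(1) unfolding fun_mean_equicontinuous_eq
    by (intro small_cells_SUP) auto
  then obtain A :: "nat \<Rightarrow> 'x set" where A: "range A \<subseteq> sets M" "AE x in M. x \<in> (\<Union>n. A n)"
    and rho: "\<And>n x y. x \<in> A n \<Longrightarrow> y \<in> A n \<Longrightarrow> (SUP c\<in>C. ereal (rho \<nu> F T (?I c) x y)) \<le> ereal \<eta>"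
    using \<eta>(1) by (rule small_cellsE) blast
  have "d_b \<nu> F T x y \<le> ereal \<epsilon>" if xy: "x \<in> A n" "y \<in> A n" for x y n
  proof -
    let ?S = "\<lambda>c. {i. (T i x \<in> ball c (\<epsilon>/4)) \<noteq> (T i y \<in> ball c (\<epsilon>/4))}"
    have [measurable]: "ball c (\<epsilon>/4) \<in> sets borel" for c :: 'x
      by simp
    have [measurable]: "?S c \<in> sets borel" for c
      by measurable
    have "\<forall>\<^sub>F n in sequentially. measure (P n) (?S c) < 2 * \<eta>" if "c \<in> C" for c
    proof -
      have "ereal (rho \<nu> F T (?I c) x y) \<le> ereal \<eta>"
        using order_trans[OF SUP_upper[of c C "\<lambda>c. ereal (rho \<nu> F T (?I c) x y)"] rho[OF xy]] that by simp
      then have "rho \<nu> F T (?I c) x y < 2 * \<eta>"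
        using \<eta> by simp
      then obtain e' where e': "0 < e'" "e' < 2 * \<eta>"
        "upper_density \<nu> F {i. norm (?I c (T i x) - ?I c (T i y)) > e'} < ereal e'"
        by (rule rho_lessD)
      \<comment> \<open>Since \<open>0 < e' < 1\<close>, exceeding \<open>e'\<close> means that
        exactly one of the two points lies in the ball.\<close>
      have "{i. norm (?I c (T i x) - ?I c (T i y)) > e'} = ?S c"
        using e' \<eta> by (auto split: split_indicator)
      then have "limsup (\<lambda>n. ereal (measure (P n) (?S c))) < ereal (2 * \<eta>)"
        using less_trans[OF e'(3), of "ereal (2 * \<eta>)"] e'(2) upper_density_eq[of "?S c"] by simp
      from Limsup_lessD[OF this] show ?thesis by simp
    qed
    then have "\<forall>\<^sub>F n in sequentially. \<forall>c\<in>C. measure (P n) (?S c) < 2 * \<eta>"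
      using C(1) by (intro eventually_ball_finite) auto
    then have "\<forall>\<^sub>F n in sequentially. ereal (\<integral>j. dist (T j x) (T j y) \<partial>P n) \<le> ereal \<epsilon>"
    proof eventually_elim
      case (elim n)
      have "(\<integral>j. dist (T j x) (T j y) \<partial>P n) \<le> (\<integral>j. \<epsilon>/2 + R * (\<Sum>c\<in>C. indicator (?S c) j) \<partial>P n)"
      proof (rule integral_mono)
        show "integrable (P n) (\<lambda>j. dist (T j x) (T j y))"
          using R by (intro P.integrable_const_bound[of _ R]) auto
        show "integrable (P n) (\<lambda>j. \<epsilon>/2 + R * (\<Sum>c\<in>C. indicator (?S c) j))"
          by (auto simp: P.emeasure_eq_measure)
        fix j
        show "dist (T j x) (T j y) \<le> \<epsilon>/2 + R * (\<Sum>c\<in>C. indicator (?S c) j)"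
        proof (cases "\<exists>c\<in>C. j \<in> ?S c")
          case True
          then obtain c where c: "c \<in> C" "j \<in> ?S c" by blast
          have "(1::real) = indicator (?S c) j" using c by simp
          also have "\<dots> \<le> (\<Sum>c\<in>C. indicator (?S c) j)"
            using c C(1) by (intro member_le_sum) auto
          finally have "R * 1 \<le> R * (\<Sum>c\<in>C. indicator (?S c) j)"
            using R by (intro mult_left_mono) auto
          then show ?thesis
            using R(2)[of "T j x" "T j y"] \<epsilon> by linarith
        next
          case False
          obtain c where c: "c \<in> C" "T j x \<in> ball c (\<epsilon>/4)" using C(2) by blast
          with False have "T j y \<in> ball c (\<epsilon>/4)" by blast
          then have "dist (T j x) (T j y) \<le> \<epsilon>/2"
            using c dist_triangle_half_r[of c "T j x" "\<epsilon>/2" "T j y"] by auto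
          moreover have "0 \<le> R * (\<Sum>c\<in>C. indicator (?S c) j)"
            using R by (intro mult_nonneg_nonneg sum_nonneg) auto
          ultimately show ?thesis by linarith
        qed
      qed
      also have "\<dots> = \<epsilon>/2 + R * (\<Sum>c\<in>C. measure (P n) (?S c))"
        using P.prob_space[of n] by (subst Bochner_Integration.integral_add) (auto simp: P.emeasure_eq_measure)
      also have "\<dots> \<le> \<epsilon>/2 + R * (\<Sum>c\<in>C. 2 * \<eta>)"
        using R elim by (intro add_left_mono mult_left_mono sum_mono) auto
      also have "\<dots> \<le> \<epsilon>"
        using \<eta> by simp
      finally show ?case by simp
    qed
    then show ?thesis
      unfolding d_b_eq by (rule Limsup_bounded)
  qed
  then show "\<exists>A :: nat \<Rightarrow> 'x set. range A \<subseteq> sets M \<and> (AE x in M. x \<in> \<Union> (range A)) \<and> (\<forall>n. \<forall>x\<in>A n. \<forall>y\<in>A n. d_b \<nu> F T x y \<le> ereal \<epsilon>)"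
    using A by blast
qed

lemma mean_equicontinuous_imp_not_mean_sensitive:
  assumes "mean_equicontinuous \<nu> F M T"
  shows "\<not> mean_sensitive \<nu> F M T"
proof
  assume "mean_sensitive \<nu> F M T"
  then obtain \<epsilon> where \<epsilon>: "\<epsilon> > 0"
    "\<And>A. A \<in> sets M \<Longrightarrow> measure M A > 0 \<Longrightarrow> \<exists>x\<in>A. \<exists>y\<in>A. d_b \<nu> F T x y > ereal \<epsilon>"
    unfolding mean_sensitive_def by blast
  obtain A where "A \<in> sets M" "measure M A > 0" "\<forall>x\<in>A. \<forall>y\<in>A. d_b \<nu> F T x y \<le> ereal \<epsilon>"
    using small_cells_positive[OF prob_space_axioms assms[unfolded mean_equicontinuous_eq] \<epsilon>(1)] by blast
  with \<epsilon>(2)[of A] show False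
    by force
qed

lemma L2_borel_measurable: "L2_fun M f \<Longrightarrow> f \<in> borel_measurable borel"
  using measurable_cong_sets[OF sets_M refl] by (auto simp: L2_fun_def)

lemma eigenfunction_orbit:
  assumes "L2_fun M b" and w: "continuous_on UNIV w" "\<And>j. AE x in M. b (T j x) = w j * b x"
  shows "AE x in M. \<forall>n. AE j in P n. b (T j x) = w j * b x"
proof -
  have [measurable]: "b \<in> borel_measurable borel" "w \<in> borel_measurable borel"
    using assms by (auto intro: L2_borel_measurable borel_measurable_continuous_onI)
  show ?thesis
    by (rule AE_orbit[OF _ w(2)]) measurable
qed

text \<open>For almost every time \<open>j\<close>, \<open>p (T j x) - p (T j y)\<close> is the sum
  of \<open>a b * w b j * (b x - b y)\<close>, whose modulus has a bound independent of
  \<open>j\<close> because \<open>w b j\<close> is unimodular. Points in a cell where all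
  \<open>b\<close> vary little thus keep \<open>p\<close> within \<open>\<epsilon>/2\<close> along
  the orbits, and outside visits to \<open>E\<close> the two replacements of \<open>f\<close> by
  \<open>p\<close> add at most \<open>\<epsilon>/4\<close> each.\<close>

lemma discrete_spectrum_imp_fun_mean_equicontinuous:
  assumes "discrete_spectrum M T" "L2_fun M f"
  shows "fun_mean_equicontinuous \<nu> F M T f"
  unfolding fun_mean_equicontinuous_eq small_cells_def
proof (intro allI impI)
  fix \<epsilon> :: real assume \<epsilon>: "\<epsilon> > 0"
  obtain B where B: "L2_orthonormal_basis M B" "\<And>b. b \<in> B \<Longrightarrow> eigenfunction M T b"
    using assms(1) unfolding discrete_spectrum_def by blast
  \<comment> \<open>Chosen so that Markov's inequality gives
    \<open>measure M E \<le> \<epsilon>/3\<close>: the visits of both orbits to \<open>E\<close>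
    then have joint density at most \<open>2 * \<epsilon> / 3\<close>, strictly below
    \<open>\<epsilon>\<close>.\<close>
  define \<delta> where "\<delta> = sqrt ((\<epsilon>/4)\<^sup>2 * (\<epsilon>/3))"
  have \<delta>: "\<delta> > 0" "\<delta>\<^sup>2 = (\<epsilon>/4)\<^sup>2 * (\<epsilon>/3)"
    using \<epsilon> by (auto simp: \<delta>_def)
  obtain S a where S: "finite S" "S \<subseteq> B"
    and less: "sqrt (\<integral>x. (norm (f x - (\<Sum>b\<in>S. a b * b x)))\<^sup>2 \<partial>M) < \<delta>"
    using B(1) assms(2) \<delta>(1) unfolding L2_orthonormal_basis_def by meson
  define p where "p x = (\<Sum>b\<in>S. a b * b x)" for x
  have L2b: "L2_fun M b" if "b \<in> S" for b
    using B(2) S(2) that by (auto simp: eigenfunction_def)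
  note [measurable] = L2_borel_measurable[OF assms(2)]
  have bm[measurable]: "b \<in> borel_measurable borel" if "b \<in> S" for b
    using L2_borel_measurable[OF L2b[OF that]] .
  have [measurable]: "p \<in> borel_measurable borel"
    unfolding p_def by (intro borel_measurable_sum borel_measurable_times borel_measurable_const bm)
  have "\<exists>w. continuous_on UNIV w \<and> (\<forall>j. norm (w j) = 1) \<and> (\<forall>j. AE x in M. b (T j x) = w j * b x)" if "b \<in> S" for b
    using B(2) S(2) that unfolding eigenfunction_def by blast
  then obtain w where w: "\<And>b. b \<in> S \<Longrightarrow> continuous_on UNIV (w b)" "\<And>b j. b \<in> S \<Longrightarrow> norm (w b j) = 1"
    "\<And>b j. b \<in> S \<Longrightarrow> AE x in M. b (T j x) = w b j * b x"
    by metis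
  define E where "E = {x. norm (f x - p x) > \<epsilon>/4}"
  have [measurable]: "E \<in> sets borel"
    unfolding E_def by measurable
  have intp: "integrable M (\<lambda>x. (norm (f x - p x))\<^sup>2)"
    using L2_diff[OF assms(2) L2_sum[OF L2_scale[OF L2b], of S "\<lambda>b. b" a]]
    by (simp add: L2_fun_def p_def)
  have E: "measure M E \<le> \<epsilon>/3"
  proof -
    have "measure M E \<le> measure M {x \<in> space M. (norm (f x - p x))\<^sup>2 \<ge> (\<epsilon>/4)\<^sup>2}"
      using \<epsilon> by (intro finite_measure_mono) (auto simp: E_def)
    also have "\<dots> \<le> (\<integral>x. (norm (f x - p x))\<^sup>2 \<partial>M) / (\<epsilon>/4)\<^sup>2"
      using \<epsilon> by (intro integral_Markov_inequality_measure[OF intp, where A="{}"]) auto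
    also have "\<dots> \<le> \<delta>\<^sup>2 / (\<epsilon>/4)\<^sup>2"
    proof (rule divide_right_mono)
      show "(\<integral>x. (norm (f x - p x))\<^sup>2 \<partial>M) \<le> \<delta>\<^sup>2"
        using less \<delta>(1) unfolding p_def[symmetric] by (metis less_imp_le real_sqrt_less_iff real_sqrt_abs abs_of_pos)
    qed simp
    also have "\<dots> = \<epsilon>/3"
      using \<epsilon> by (simp add: \<delta>)
    finally show ?thesis .
  qed
  have "AE x in M. (\<forall>b\<in>S. \<forall>n. AE j in P n. b (T j x) = w b j * b x) \<and>
     (\<lambda>n. \<integral>j. indicator E (T j x) \<partial>P n) \<longlonglongrightarrow> (\<integral>x. indicator E x \<partial>M :: real)"
  proof (rule AE_conjI)
    show "AE x in M. \<forall>b\<in>S. \<forall>n. AE j in P n. b (T j x) = w b j * b x"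
      using S(1) eigenfunction_orbit[OF L2b w(1) w(3)] by (intro AE_finite_allI) auto
    show "AE x in M. (\<lambda>n. \<integral>j. indicator E (T j x) \<partial>P n) \<longlonglongrightarrow> (\<integral>x. indicator E x \<partial>M :: real)"
      by (rule pointwise_ergodic_real) (auto simp: emeasure_eq_measure)
  qed
  from AE_imp_measurable_set[OF this] obtain X0 where X0: "X0 \<in> sets M" "AE x in M. x \<in> X0"
    "\<And>x b n. x \<in> X0 \<Longrightarrow> b \<in> S \<Longrightarrow> AE j in P n. b (T j x) = w b j * b x"
    "\<And>x. x \<in> X0 \<Longrightarrow> (\<lambda>n. \<integral>j. indicator E (T j x) \<partial>P n) \<longlonglongrightarrow> (\<integral>x. indicator E x \<partial>M :: real)"
    by blast
  define A0 where "A0 = (\<Sum>b\<in>S. norm (a b))"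
  have A0: "A0 \<ge> 0"
    unfolding A0_def by (intro sum_nonneg) auto
  \<comment> \<open>If each eigenfunction varies by at most \<open>\<eta>\<close>, the combination
    \<open>p\<close> varies by at most \<open>A0 * \<eta> \<le> \<epsilon>/2\<close>.\<close>
  define \<eta> where "\<eta> = \<epsilon> / (2 * (A0 + 1))"
  have \<eta>: "\<eta> > 0" "A0 * \<eta> \<le> \<epsilon>/2"
    using \<epsilon> A0 by (auto simp: \<eta>_def field_simps)
  have "small_cells M (\<lambda>x y. SUP b\<in>S. ereal (dist (b x) (b y)))"
    by (intro small_cells_SUP S small_cells_measurable) (auto intro: bm)
  then obtain A :: "nat \<Rightarrow> 'x set" where A: "range A \<subseteq> sets M" "AE x in M. x \<in> (\<Union>n. A n)"
    and cell: "\<And>n x y. x \<in> A n \<Longrightarrow> y \<in> A n \<Longrightarrow> (SUP b\<in>S. ereal (dist (b x) (b y))) \<le> ereal \<eta>"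
    using \<eta>(1) by (rule small_cellsE) blast
  have "rho \<nu> F T f x y \<le> \<epsilon>" if xy: "x \<in> X0" "y \<in> X0" "x \<in> A n" "y \<in> A n" for x y n
  proof (rule rho_le[OF \<epsilon>])
    let ?S = "{i. norm (f (T i x) - f (T i y)) > \<epsilon>}"
    have [measurable]: "?S \<in> sets borel" by measurable
    have prob_E: "measure (P n) {j. T j z \<in> E} = (\<integral>j. indicator E (T j z) \<partial>P n)" for n z
    proof -
      have "measure (P n) {j. T j z \<in> E} = (\<integral>j. indicator {j. T j z \<in> E} j \<partial>P n)"
        by simp
      also have "\<dots> = (\<integral>j. indicator E (T j z) \<partial>P n)"
        by (intro Bochner_Integration.integral_cong) (auto split: split_indicator)
      finally show ?thesis .
    qed
    have le: "measure (P n) ?S \<le> (\<integral>j. indicator E (T j x) \<partial>P n) + (\<integral>j. indicator E (T j y) \<partial>P n)" for n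
    proof -
      have "AE j in P n. \<forall>b\<in>S. b (T j x) = w b j * b x \<and> b (T j y) = w b j * b y"
        using S(1) X0(3) xy by (intro AE_finite_allI AE_conjI) auto
      then have "AE j in P n. j \<in> ?S \<longrightarrow> j \<in> {j. T j x \<in> E} \<union> {j. T j y \<in> E}"
      proof eventually_elim
        case (elim j)
        have "norm (p (T j x) - p (T j y)) \<le> (\<Sum>b\<in>S. norm (a b) * dist (b x) (b y))"
        proof -
          have "p (T j x) - p (T j y) = (\<Sum>b\<in>S. a b * (w b j * (b x - b y)))"
            unfolding p_def sum_subtractf[symmetric] using elim by (intro sum.cong) (auto simp: algebra_simps)
          also have "norm \<dots> \<le> (\<Sum>b\<in>S. norm (a b) * dist (b x) (b y))"
            by (rule order_trans[OF norm_sum]) (auto intro!: sum_mono simp: norm_mult w(2) dist_norm)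
          finally show ?thesis .
        qed
        also have "\<dots> \<le> (\<Sum>b\<in>S. norm (a b) * \<eta>)"
        proof (intro sum_mono mult_left_mono)
          fix b assume "b \<in> S"
          then have "ereal (dist (b x) (b y)) \<le> ereal \<eta>"
            using order_trans[OF SUP_upper[of b S "\<lambda>b. ereal (dist (b x) (b y))"] cell[OF xy(3,4)]] by simp
          then show "dist (b x) (b y) \<le> \<eta>" by simp
        qed auto
        also have "\<dots> \<le> \<epsilon>/2"
          using \<eta>(2) by (simp add: A0_def sum_distrib_right)
        finally have "norm (p (T j x) - p (T j y)) \<le> \<epsilon>/2" .
        then have "norm (f (T j x) - f (T j y)) \<le> norm (f (T j x) - p (T j x)) + \<epsilon>/2 + norm (f (T j y) - p (T j y))"
          using norm_triangle_ineq[of "f (T j x) - p (T j x)" "p (T j x) - p (T j y)"]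
            norm_triangle_ineq[of "f (T j x) - p (T j y)" "p (T j y) - f (T j y)"]
          by (simp add: norm_minus_commute)
        then show ?case
          by (auto simp: E_def)
      qed
      then have "measure (P n) ?S \<le> measure (P n) ({j. T j x \<in> E} \<union> {j. T j y \<in> E})"
        by (intro P.finite_measure_mono_AE) auto
      also have "\<dots> \<le> measure (P n) {j. T j x \<in> E} + measure (P n) {j. T j y \<in> E}"
        by (rule measure_Un_le) auto
      also have "\<dots> = (\<integral>j. indicator E (T j x) \<partial>P n) + (\<integral>j. indicator E (T j y) \<partial>P n)"
        by (simp add: prob_E)
      finally show ?thesis .
    qed
    have "(\<lambda>n. ereal ((\<integral>j. indicator E (T j x) \<partial>P n) + (\<integral>j. indicator E (T j y) \<partial>P n))) \<longlonglongrightarrow> ereal (measure M E + measure M E)"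
      using X0(4)[OF xy(1)] X0(4)[OF xy(2)] by (intro tendsto_intros) auto
    then have "limsup (\<lambda>n. ereal ((\<integral>j. indicator E (T j x) \<partial>P n) + (\<integral>j. indicator E (T j y) \<partial>P n))) = ereal (measure M E + measure M E)"
      by (intro lim_imp_Limsup) auto
    moreover have "upper_density \<nu> F ?S \<le> limsup (\<lambda>n. ereal ((\<integral>j. indicator E (T j x) \<partial>P n) + (\<integral>j. indicator E (T j y) \<partial>P n)))"
      by (subst upper_density_eq) (auto intro!: Limsup_mono always_eventually le)
    ultimately have "upper_density \<nu> F ?S \<le> ereal (measure M E + measure M E)"
      by simp
    also have "\<dots> < ereal \<epsilon>"
      using E \<epsilon> by simp
    finally show "upper_density \<nu> F ?S < ereal \<epsilon>" .
  qed
  moreover have "AE x in M. x \<in> (\<Union>n. X0 \<inter> A n)"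
    using X0(2) A(2) by eventually_elim auto
  moreover have "X0 \<inter> A n \<in> sets M" for n
    using X0(1) A(1) by auto
  ultimately show "\<exists>A :: nat \<Rightarrow> 'x set. range A \<subseteq> sets M \<and> (AE x in M. x \<in> \<Union> (range A)) \<and>
      (\<forall>n. \<forall>x\<in>A n. \<forall>y\<in>A n. ereal (rho \<nu> F T f x y) \<le> ereal \<epsilon>)"
    by (intro exI[of _ "\<lambda>n. X0 \<inter> A n"]) auto
qed

end

section \<open>Continuity of measurable characters\<close>

context folner_tds
begin

lemma haar_open_superset:
  assumes "A \<in> sets borel" "emeasure \<nu> A < e"
  shows "\<exists>U. open U \<and> A \<subseteq> U \<and> emeasure \<nu> U < e"
proof -
  have "emeasure \<nu> A = (INF U\<in>{U. open U \<and> A \<subseteq> U}. emeasure \<nu> U)"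
    using haar[unfolded haar_measure_def, THEN conjunct2, THEN conjunct2, THEN conjunct2, THEN conjunct2, THEN conjunct1] assms(1)
    by (rule bspec)
  then show ?thesis
    using assms(2) by (simp only: INF_less_iff) auto
qed

lemma haar_compact_subset:
  assumes "open U" "e < emeasure \<nu> U"
  shows "\<exists>K. compact K \<and> K \<subseteq> U \<and> e < emeasure \<nu> K"
proof -
  have "emeasure \<nu> U = (SUP K\<in>{K. compact K \<and> K \<subseteq> U}. emeasure \<nu> K)"
    using haar[unfolded haar_measure_def, THEN conjunct2, THEN conjunct2, THEN conjunct2, THEN conjunct2, THEN conjunct2] assms(1)
    by blast
  then show ?thesis
    using assms(2) by (simp only: less_SUP_iff) auto
qed

text \<open>Inner regularity is given for open sets only. So \<open>A\<close> is enclosed in an open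
  \<open>U\<close> of finite measure, \<open>U\<close> is approximated from inside by a compact
  \<open>K0\<close>, and an open \<open>V\<close> around \<open>U - A\<close> is removed from
  \<open>K0\<close>; what is left is compact and lies in \<open>A\<close>.\<close>

lemma haar_positive_compact:
  assumes A: "A \<in> sets borel" "emeasure \<nu> A \<noteq> 0" "emeasure \<nu> A < \<infinity>"
  shows "\<exists>K. compact K \<and> K \<subseteq> A \<and> emeasure \<nu> K \<noteq> 0 \<and> emeasure \<nu> K < \<infinity>"
proof -
  obtain U where U: "open U" "A \<subseteq> U" "emeasure \<nu> U < \<infinity>"
    using haar_open_superset[OF A(1,3)] by blast
  have fin: "S \<in> fmeasurable \<nu>" if "S \<in> sets borel" "S \<subseteq> U" for S
    using that U emeasure_mono[of S U \<nu>] by (intro fmeasurableI) (auto intro: le_less_trans)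
  have mA: "measure \<nu> A > 0"
    using A by (simp add: measure_def enn2real_positive_iff zero_less_iff_neq_zero)
  \<comment> \<open>Passing from \<open>U\<close> to \<open>K0\<close> loses less than
    \<open>e\<close>, and \<open>V\<close> exceeds \<open>U - A\<close> by at most \<open>e\<close>,
    so \<open>K0 - V\<close> retains more than \<open>measure \<nu> A - 2 * e > 0\<close>.\<close>
  define e where "e = measure \<nu> A / 3"
  have e: "e > 0" using mA by (simp add: e_def)
  have emU: "emeasure \<nu> S = ennreal (measure \<nu> S)" if "S \<in> sets borel" "S \<subseteq> U" for S
    using fin[OF that] by (intro emeasure_eq_ennreal_measure) (auto simp: fmeasurable_def)
  have "measure \<nu> A \<le> measure \<nu> U"
    using U A(1) by (intro measure_mono_fmeasurable fin) auto
  then have "ennreal (measure \<nu> U - e) < emeasure \<nu> U"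
    using e mA U by (subst emU) (auto simp: ennreal_less_iff e_def)
  then obtain K0 where K0: "compact K0" "K0 \<subseteq> U" "ennreal (measure \<nu> U - e) < emeasure \<nu> K0"
    using haar_compact_subset[OF U(1)] by blast
  have "emeasure \<nu> (U - A) < ennreal (measure \<nu> (U - A) + e)"
    using e U A(1) by (subst emU) (auto simp: ennreal_less_iff)
  then obtain V where V: "open V" "U - A \<subseteq> V" "emeasure \<nu> V < ennreal (measure \<nu> (U - A) + e)"
    using haar_open_superset[of "U - A" "ennreal (measure \<nu> (U - A) + e)"] U(1) A(1)
    by (metis borel_open sets.Diff)
  have sK0[measurable]: "K0 \<in> sets borel" using K0(1) by (simp add: borel_compact)
  have sV[measurable]: "V \<in> sets borel" "U \<in> sets borel" using V(1) U(1) by auto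
  have "measure \<nu> (K0 \<inter> V) \<le> measure \<nu> V"
    using V(3) by (intro measure_mono_fmeasurable fmeasurableI) (auto intro: less_trans)
  also have "\<dots> \<le> measure \<nu> (U - A) + e"
    using V(3) e by (simp add: measure_def enn2real_leI less_imp_le)
  also have "measure \<nu> (U - A) = measure \<nu> U - measure \<nu> A"
    using A U by (intro measure_Diff) (auto simp: less_top[symmetric])
  finally have 1: "measure \<nu> (K0 \<inter> V) \<le> measure \<nu> U - measure \<nu> A + e" .
  have "measure \<nu> (K0 - V) = measure \<nu> K0 - measure \<nu> (K0 \<inter> V)"
    using measure_Diff[of \<nu> K0 "K0 \<inter> V"] fin[of K0] K0 by (auto simp: fmeasurable_def Diff_Int)
  moreover have "measure \<nu> U - e < measure \<nu> K0"
    using K0(3) \<open>measure \<nu> A \<le> measure \<nu> U\<close> mA by (subst (asm) emU[OF sK0 K0(2)]) (simp add: ennreal_less_iff e_def)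
  ultimately have "measure \<nu> (K0 - V) > 0"
    using 1 mA by (simp add: e_def)
  then have "emeasure \<nu> (K0 - V) \<noteq> 0"
    by (auto simp: measure_def)
  moreover have "compact (K0 - V)"
    using K0(1) V(1) by (rule compact_diff)
  moreover have "K0 - V \<subseteq> A"
    using K0(2) V(2) by auto
  moreover have "emeasure \<nu> (K0 - V) < \<infinity>"
    using fin[of "K0 - V"] K0(2) by (auto simp: fmeasurable_def)
  ultimately show ?thesis by blast
qed


text \<open>Take a compact \<open>K\<close> inside \<open>A\<close> and an open \<open>U\<close>
  around \<open>K\<close> of measure less than twice that of \<open>K\<close>. For \<open>v\<close>
  near 0 the translate \<open>v + K\<close> stays in \<open>U\<close> by the tube lemma, so
  \<open>v + K\<close> and \<open>K\<close> do not both fit into \<open>U\<close> disjointly; a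
  common point writes \<open>v\<close> as a difference.\<close>

lemma steinhaus:
  assumes A: "A \<in> sets borel" "emeasure \<nu> A \<noteq> 0" "emeasure \<nu> A < \<infinity>"
  shows "\<forall>\<^sub>F v in nhds 0. \<exists>a\<in>A. \<exists>b\<in>A. v = a - b"
proof -
  obtain K where K: "compact K" "K \<subseteq> A" "emeasure \<nu> K \<noteq> 0" "emeasure \<nu> K < \<infinity>"
    using haar_positive_compact[OF A] by blast
  have sK: "K \<in> sets borel" using K(1) by (simp add: borel_compact)
  have "emeasure \<nu> K < emeasure \<nu> K + emeasure \<nu> K"
    using K(3,4) by (cases "emeasure \<nu> K") (auto simp: ennreal_plus[symmetric] ennreal_less_iff simp del: ennreal_plus)
  then obtain U where U: "open U" "K \<subseteq> U" "emeasure \<nu> U < emeasure \<nu> K + emeasure \<nu> K"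
    using haar_open_superset[OF sK] by blast
  have "continuous_on UNIV (\<lambda>p :: 'g \<times> 'g. fst p + snd p)"
    by (intro continuous_intros)
  then have "open ((\<lambda>p :: 'g \<times> 'g. fst p + snd p) -` U)"
    using U(1) by (rule open_vimage[rotated])
  moreover have "{0} \<times> K \<subseteq> (\<lambda>p :: 'g \<times> 'g. fst p + snd p) -` U"
    using U(2) by auto
  ultimately obtain X where X: "0 \<in> X" "open X" "X \<times> K \<subseteq> (\<lambda>p :: 'g \<times> 'g. fst p + snd p) -` U"
    using Elementary_Topology.tube_lemma[OF K(1), of _ 0] by blast
  then have "\<forall>\<^sub>F v in nhds 0. v \<in> X"
    by (intro eventually_nhds_in_open)
  then show ?thesis
  proof eventually_elim
    case (elim v)
    have "v + k \<in> U" if "k \<in> K" for k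
      using X(3) elim that by auto
    then have sub: "(+) v ` K \<union> K \<subseteq> U"
      using U(2) by auto
    have svK: "(+) v ` K \<in> sets borel"
      using K(1) by (intro borel_compact compact_continuous_image continuous_intros)
    have "(+) v ` K \<inter> K \<noteq> {}"
    proof
      assume "(+) v ` K \<inter> K = {}"
      then have "emeasure \<nu> ((+) v ` K) + emeasure \<nu> K = emeasure \<nu> ((+) v ` K \<union> K)"
        using svK sK by (intro plus_emeasure) auto
      also have "\<dots> \<le> emeasure \<nu> U"
        using sub U(1) by (intro emeasure_mono) auto
      finally show False
        using U(3) nu_shift[OF sK, of v] by simp
    qed
    then obtain a b where "a \<in> K" "b \<in> K" "v + b = a" by auto
    then show ?case using K(2) by (intro bexI[of _ a] bexI[of _ b]) (auto simp: algebra_simps)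
  qed
qed

text \<open>On some set of positive measure \<open>w\<close> is nearly constant. A small
  \<open>v\<close> is a difference \<open>a - b\<close> of points of this set, whence
  \<open>w v = w a / w b\<close> is near 1. Continuity at 0 spreads by multiplicativity. Working
  inside \<open>F 0\<close> keeps the measure finite.\<close>

lemma measurable_character_continuous:
  fixes w :: "'g \<Rightarrow> complex"
  assumes m[measurable]: "w \<in> borel_measurable borel"
    and w: "\<And>j. norm (w j) = 1" "\<And>i j. w (i + j) = w i * w j"
  shows "continuous_on UNIV w"
proof -
  have lim0: "(w \<longlongrightarrow> 1) (nhds 0)"
  proof (rule tendstoI)
    fix e :: real assume "e > 0"
    have "small_cells (P 0) (\<lambda>x y. ereal (dist (w x) (w y)))"
      by (rule small_cells_measurable) simp
    from small_cells_positive[OF P.prob_space_axioms this, of "e/2"] \<open>e > 0\<close>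
    obtain A where A: "A \<in> sets borel" "measure (P 0) A > 0" "\<And>x y. x \<in> A \<Longrightarrow> y \<in> A \<Longrightarrow> dist (w x) (w y) \<le> e/2"
      by auto
    have "measure \<nu> (A \<inter> F 0) > 0"
      using A(1,2) F_pos F_finite measure_F_pos[of 0] by (simp add: Int_commute zero_less_divide_iff)
    then have 1: "emeasure \<nu> (A \<inter> F 0) \<noteq> 0"
      by (auto simp: measure_def)
    have 2: "emeasure \<nu> (A \<inter> F 0) < \<infinity>"
      using F_finite(1)[of 0] emeasure_mono[of "A \<inter> F 0" "F 0" \<nu>] by (auto intro: le_less_trans)
    have "\<forall>\<^sub>F v in nhds 0. \<exists>a\<in>A \<inter> F 0. \<exists>b\<in>A \<inter> F 0. v = a - b"
      using A(1) 1 2 by (intro steinhaus) auto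
    then show "\<forall>\<^sub>F v in nhds 0. dist (w v) 1 < e"
    proof eventually_elim
      case (elim v)
      then obtain a b where ab: "a \<in> A" "b \<in> A" "v = a - b" by blast
      then have "w a = w v * w b"
        using w(2)[of v b] by simp
      then have "dist (w a) (w b) = norm ((w v - 1) * w b)"
        by (simp add: dist_norm algebra_simps)
      then have "dist (w v) 1 \<le> e/2"
        using A(3)[OF ab(1,2)] by (simp add: norm_mult w(1) dist_norm)
      then show ?case using \<open>e > 0\<close> by simp
    qed
  qed
  show ?thesis
  proof (rule continuous_at_imp_continuous_on, rule ballI)
    fix x :: 'g
    have "((\<lambda>y. y - x) \<longlongrightarrow> x - x) (at x)"
      by (intro tendsto_diff tendsto_ident_at tendsto_const)
    then have "((\<lambda>y. w x * w (y - x)) \<longlongrightarrow> w x * 1) (at x)"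
      by (intro tendsto_mult tendsto_const filterlim_compose[OF lim0]) simp
    then show "isCont w x"
      unfolding isCont_def by (simp flip: w(2))
  qed
qed

text \<open>Because the equation holds at every point, \<open>w\<close> can be read off from one
  orbit as \<open>f (T j x0) / f x0\<close>, which is Borel in \<open>j\<close> and multiplicative.
  Its modulus is 1 since translations preserve the norm of \<open>f\<close>. Continuity is then
  automatic.\<close>

lemma eigenfunctionI:
  assumes f: "L2_fun M f" and eq: "\<And>j x. f (T j x) = w j * f x" and nz: "\<not> (AE x in M. f x = 0)"
  shows "eigenfunction M T f"
proof -
  note [measurable] = L2_borel_measurable[OF f]
  obtain x0 where x0: "f x0 \<noteq> 0"
    using nz by (metis (mono_tags, lifting) AE_I2)
  have "w = (\<lambda>j. f (T j x0) / f x0)"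
    using eq x0 by auto
  moreover have "(\<lambda>j. f (T j x0) / f x0) \<in> borel_measurable borel"
    by measurable
  ultimately have m: "w \<in> borel_measurable borel"
    by simp
  have mult: "w (i + j) = w i * w j" for i j
    using eq[of "i + j" x0] eq[of i "T j x0"] eq[of j x0] x0 by (simp add: action(3))
  have int: "integrable M (\<lambda>x. (norm (f x))\<^sup>2)"
    using f by (simp add: L2_fun_def)
  have "(\<integral>x. (norm (f x))\<^sup>2 \<partial>M) \<noteq> 0"
    using nz integral_nonneg_eq_0_iff_AE[OF int] by auto
  moreover have "(\<integral>x. (norm (f x))\<^sup>2 \<partial>M) = (norm (w j))\<^sup>2 * (\<integral>x. (norm (f x))\<^sup>2 \<partial>M)" for j
    using integral_T[of "\<lambda>x. (norm (f x))\<^sup>2" j] by (simp add: eq norm_mult power_mult_distrib)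
  ultimately have "(norm (w j))\<^sup>2 = 1" for j
    by (metis mult_cancel_right1)
  then have "norm (w j) = 1" for j
    by (simp add: power2_eq_1_iff) (metis norm_ge_zero neg_0_le_iff_le not_one_le_zero)
  with f nz mult eq measurable_character_continuous[OF m] show ?thesis
    unfolding eigenfunction_def by blast
qed

end

section \<open>Orthogonality and weak compactness\<close>

definition L2_inner :: "'x measure \<Rightarrow> ('x \<Rightarrow> complex) \<Rightarrow> ('x \<Rightarrow> complex) \<Rightarrow> complex" where
  "L2_inner M f g = (\<integral>x. f x * cnj (g x) \<partial>M)"

definition L2_sq :: "'x measure \<Rightarrow> ('x \<Rightarrow> complex) \<Rightarrow> real" where
  "L2_sq M f = (\<integral>x. (norm (f x))\<^sup>2 \<partial>M)"

lemma measurable_cnj[measurable]: "cnj \<in> borel \<rightarrow>\<^sub>M borel"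
  by (intro borel_measurable_continuous_onI continuous_intros)

lemma L2_sq_nonneg[simp]: "0 \<le> L2_sq M f"
  by (simp add: L2_sq_def)

lemma L2_norm_mult_integrable:
  assumes "L2_fun M f" "L2_fun M g"
  shows "integrable M (\<lambda>x. norm (f x) * norm (g x))"
proof (rule Bochner_Integration.integrable_bound)
  have [measurable]: "f \<in> borel_measurable M" "g \<in> borel_measurable M"
    using assms by (auto simp: L2_fun_def)
  show "integrable M (\<lambda>x. (norm (f x))\<^sup>2 + (norm (g x))\<^sup>2)"
    using assms by (auto simp: L2_fun_def)
  show "(\<lambda>x. norm (f x) * norm (g x)) \<in> borel_measurable M"
    by measurable
  have "norm (f x) * norm (g x) \<le> (norm (f x))\<^sup>2 + (norm (g x))\<^sup>2" for x
    using sum_squares_bound[of "norm (f x)" "norm (g x)"] mult_nonneg_nonneg[of "norm (f x)" "norm (g x)"]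
    by (auto simp del: mult_nonneg_nonneg)
  then show "AE x in M. norm (norm (f x) * norm (g x)) \<le> norm ((norm (f x))\<^sup>2 + (norm (g x))\<^sup>2)"
    by (intro AE_I2) simp
qed

lemma L2_mult_integrable:
  assumes "L2_fun M f" "L2_fun M g"
  shows "integrable M (\<lambda>x. f x * cnj (g x))"
proof (rule Bochner_Integration.integrable_bound[OF L2_norm_mult_integrable[OF assms]])
  have [measurable]: "f \<in> borel_measurable M" "g \<in> borel_measurable M"
    using assms by (auto simp: L2_fun_def)
  show "(\<lambda>x. f x * cnj (g x)) \<in> borel_measurable M"
    by measurable
qed (simp add: norm_mult)

lemma L2_inner_add_left:
  "L2_fun M f \<Longrightarrow> L2_fun M g \<Longrightarrow> L2_fun M h \<Longrightarrow> L2_inner M (\<lambda>x. f x + g x) h = L2_inner M f h + L2_inner M g h"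
  unfolding L2_inner_def distrib_right
  by (intro Bochner_Integration.integral_add L2_mult_integrable)

lemma L2_inner_diff_left:
  "L2_fun M f \<Longrightarrow> L2_fun M g \<Longrightarrow> L2_fun M h \<Longrightarrow> L2_inner M (\<lambda>x. f x - g x) h = L2_inner M f h - L2_inner M g h"
  unfolding L2_inner_def left_diff_distrib
  by (intro Bochner_Integration.integral_diff L2_mult_integrable)

lemma L2_inner_scale_left: "L2_inner M (\<lambda>x. c * f x) g = c * L2_inner M f g"
  by (simp add: L2_inner_def mult.assoc)

lemma L2_inner_commute: "L2_inner M g f = cnj (L2_inner M f g)"
proof -
  have "L2_inner M g f = (\<integral>x. cnj (f x * cnj (g x)) \<partial>M)"
    by (simp add: L2_inner_def mult.commute)
  then show ?thesis
    by (simp only: Bochner_Integration.integral_cnj L2_inner_def)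
qed

lemma L2_inner_diff_right:
  "L2_fun M f \<Longrightarrow> L2_fun M g \<Longrightarrow> L2_fun M h \<Longrightarrow> L2_inner M h (\<lambda>x. f x - g x) = L2_inner M h f - L2_inner M h g"
  using L2_inner_diff_left[of M f g h] by (metis L2_inner_commute complex_cnj_diff)

lemma L2_inner_scale_right: "L2_inner M f (\<lambda>x. c * g x) = cnj c * L2_inner M f g"
  using L2_inner_scale_left[of M c g f] by (metis L2_inner_commute complex_cnj_mult complex_cnj_cnj)

lemma L2_inner_sum_left:
  "(\<And>i. i \<in> I \<Longrightarrow> L2_fun M (f i)) \<Longrightarrow> L2_fun M g \<Longrightarrow> L2_inner M (\<lambda>x. \<Sum>i\<in>I. f i x) g = (\<Sum>i\<in>I. L2_inner M (f i) g)"
  unfolding L2_inner_def sum_distrib_right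
  by (intro Bochner_Integration.integral_sum L2_mult_integrable)

lemma L2_inner_self: "L2_inner M f f = of_real (L2_sq M f)"
  by (simp add: L2_inner_def L2_sq_def complex_norm_square[symmetric] flip: integral_complex_of_real of_real_power)

lemma L2_sq_scale: "L2_sq M (\<lambda>x. c * f x) = (norm c)\<^sup>2 * L2_sq M f"
  by (simp add: L2_sq_def norm_mult power_mult_distrib)

lemma L2_normalize:
  assumes "L2_sq M f \<noteq> 0"
  shows "\<exists>c. (norm c)\<^sup>2 * L2_sq M f = 1 \<and> L2_sq M (\<lambda>x. c * f x) = 1"
proof -
  have "L2_sq M f > 0"
    using assms L2_sq_nonneg[of M f] by linarith
  then show ?thesis
    unfolding L2_sq_scale
    by (intro exI[of _ "complex_of_real (1 / sqrt (L2_sq M f))"]) (simp add: norm_divide power_divide)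
qed

lemma L2_sq_diff:
  assumes "L2_fun M f" "L2_fun M g"
  shows "L2_sq M (\<lambda>x. f x - g x) = L2_sq M f - 2 * Re (L2_inner M f g) + L2_sq M g"
proof -
  have "complex_of_real (L2_sq M (\<lambda>x. f x - g x)) = L2_inner M f f - L2_inner M f g - (L2_inner M g f - L2_inner M g g)"
    by (simp add: L2_inner_self[symmetric] assms L2_diff L2_inner_diff_left L2_inner_diff_right)
  also have "L2_inner M g f = cnj (L2_inner M f g)"
    by (rule L2_inner_commute)
  finally have "Re (complex_of_real (L2_sq M (\<lambda>x. f x - g x))) = Re (L2_inner M f f - L2_inner M f g - (cnj (L2_inner M f g) - L2_inner M g g))"
    by simp
  then show ?thesis
    by (simp add: L2_inner_self)
qed

lemma L2_sq_add_le:
  assumes "L2_fun M f" "L2_fun M g"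
  shows "L2_sq M (\<lambda>x. f x + g x) \<le> 2 * L2_sq M f + 2 * L2_sq M g"
proof -
  have "L2_sq M (\<lambda>x. f x + g x) \<le> (\<integral>x. 2 * (norm (f x))\<^sup>2 + 2 * (norm (g x))\<^sup>2 \<partial>M)"
    unfolding L2_sq_def using L2_add[OF assms] assms
    by (intro integral_mono norm_add_squared_le) (auto simp: L2_fun_def)
  also have "\<dots> = 2 * L2_sq M f + 2 * L2_sq M g"
    using assms by (simp add: L2_sq_def L2_fun_def)
  finally show ?thesis .
qed

lemma discriminant_le:
  fixes a b c :: real
  assumes "\<And>t. 0 \<le> a - 2 * t * c + t\<^sup>2 * b" "0 \<le> a" "0 \<le> b"
  shows "c\<^sup>2 \<le> a * b"
proof (cases "b = 0")
  case True
  have "c = 0"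
  proof (rule ccontr)
    assume "c \<noteq> 0"
    \<comment> \<open>At this \<open>t\<close> the expression \<open>a - 2 * t * c\<close> equals
      \<open>-1\<close>.\<close>
    then show False
      using assms(1)[of "(a + 1) / (2 * c)"] True by simp
  qed
  then show ?thesis using True by simp
next
  case False
  then have "b > 0" using assms by simp
  then show ?thesis
    using assms(1)[of "c / b"] by (simp add: field_simps power2_eq_square)
qed

text \<open>Working with moduli makes the quadratic polynomial in \<open>t\<close> real; the version
  for complex inner products follows by taking the norm inside the integral.\<close>

lemma L2_Cauchy_Schwarz_norm:
  assumes "L2_fun M f" "L2_fun M g"
  shows "(\<integral>x. norm (f x) * norm (g x) \<partial>M)\<^sup>2 \<le> L2_sq M f * L2_sq M g"
proof (rule discriminant_le)
  fix t :: real
  have int: "integrable M (\<lambda>x. (norm (f x))\<^sup>2)" "integrable M (\<lambda>x. (norm (g x))\<^sup>2)"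
    using assms by (auto simp: L2_fun_def)
  have "0 \<le> (\<integral>x. (norm (f x) - t * norm (g x))\<^sup>2 \<partial>M)"
    by simp
  also have "\<dots> = (\<integral>x. (norm (f x))\<^sup>2 - 2 * t * (norm (f x) * norm (g x)) + t\<^sup>2 * (norm (g x))\<^sup>2 \<partial>M)"
    by (intro Bochner_Integration.integral_cong) (auto simp: power2_eq_square algebra_simps)
  also have "\<dots> = L2_sq M f - 2 * t * (\<integral>x. norm (f x) * norm (g x) \<partial>M) + t\<^sup>2 * L2_sq M g"
    using int L2_norm_mult_integrable[OF assms] unfolding L2_sq_def
    by (subst Bochner_Integration.integral_add Bochner_Integration.integral_diff; simp)+
  finally show "0 \<le> \<dots>" .
qed auto

lemma L2_Cauchy_Schwarz:
  assumes "L2_fun M f" "L2_fun M g"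
  shows "(norm (L2_inner M f g))\<^sup>2 \<le> L2_sq M f * L2_sq M g"
proof -
  have "norm (L2_inner M f g) \<le> (\<integral>x. norm (f x) * norm (g x) \<partial>M)"
    unfolding L2_inner_def
    by (rule norm_integral_le[OF L2_mult_integrable L2_norm_mult_integrable]) (use assms in \<open>auto simp: norm_mult\<close>)
  then have "(norm (L2_inner M f g))\<^sup>2 \<le> (\<integral>x. norm (f x) * norm (g x) \<partial>M)\<^sup>2"
    by (rule power_mono) simp
  also have "\<dots> \<le> L2_sq M f * L2_sq M g"
    by (rule L2_Cauchy_Schwarz_norm[OF assms])
  finally show ?thesis .
qed

lemma L2_sq_eq_0_iff: "L2_fun M f \<Longrightarrow> L2_sq M f = 0 \<longleftrightarrow> (AE x in M. f x = 0)"
  unfolding L2_sq_def L2_fun_def by (subst integral_nonneg_eq_0_iff_AE) auto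

lemma L2_inner_eq_0: "AE x in M. f x = 0 \<Longrightarrow> L2_inner M f g = 0"
  unfolding L2_inner_def by (rule integral_eq_zero_AE) auto

section \<open>Finite orthonormal systems and Bessel's inequality\<close>

definition orthonormal :: "'x measure \<Rightarrow> ('x \<Rightarrow> complex) set \<Rightarrow> bool" where
  "orthonormal M E \<longleftrightarrow> (\<forall>e\<in>E. L2_fun M e) \<and> (\<forall>d\<in>E. \<forall>e\<in>E. L2_inner M d e = (if d = e then 1 else 0))"

definition L2_proj :: "'x measure \<Rightarrow> ('x \<Rightarrow> complex) set \<Rightarrow> ('x \<Rightarrow> complex) \<Rightarrow> 'x \<Rightarrow> complex" where
  "L2_proj M E f = (\<lambda>x. \<Sum>e\<in>E. L2_inner M f e * e x)"

lemma L2_proj_L2: "orthonormal M E \<Longrightarrow> L2_fun M (L2_proj M E f)"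
  unfolding L2_proj_def orthonormal_def by (intro L2_sum L2_scale) auto

lemma L2_proj_inner:
  assumes "orthonormal M E" "finite E" "d \<in> E"
  shows "L2_inner M (L2_proj M E f) d = L2_inner M f d"
proof -
  have "L2_inner M (L2_proj M E f) d = (\<Sum>e\<in>E. L2_inner M f e * L2_inner M e d)"
    unfolding L2_proj_def using assms
    by (subst L2_inner_sum_left) (auto simp: orthonormal_def L2_inner_scale_left intro!: L2_scale)
  also have "\<dots> = (\<Sum>e\<in>E. if e = d then L2_inner M f e else 0)"
    using assms by (intro sum.cong) (auto simp: orthonormal_def)
  finally show ?thesis
    using assms by simp
qed

lemma L2_inner_proj:
  assumes "orthonormal M E" "finite E" "L2_fun M g"
  shows "L2_inner M (L2_proj M E f) g = (\<Sum>e\<in>E. L2_inner M f e * cnj (L2_inner M g e))"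
  unfolding L2_proj_def using assms
  by (subst L2_inner_sum_left) (auto simp: orthonormal_def L2_inner_scale_left L2_inner_commute[of M _ g, symmetric] intro!: L2_scale)

lemma L2_sq_diff_proj:
  assumes "orthonormal M E" "finite E" "L2_fun M f"
  shows "L2_sq M (\<lambda>x. f x - L2_proj M E f x) = L2_sq M f - (\<Sum>e\<in>E. (norm (L2_inner M f e))\<^sup>2)"
proof -
  have 1: "L2_inner M f (L2_proj M E f) = of_real (\<Sum>e\<in>E. (norm (L2_inner M f e))\<^sup>2)"
    by (subst L2_inner_commute, subst L2_inner_proj[OF assms])
      (simp add: complex_norm_square[symmetric] cnj_sum flip: of_real_power)
  have 2: "L2_inner M (L2_proj M E f) (L2_proj M E f) = of_real (\<Sum>e\<in>E. (norm (L2_inner M f e))\<^sup>2)"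
    by (subst L2_inner_proj[OF assms(1,2) L2_proj_L2[OF assms(1)]])
      (simp add: L2_proj_inner[OF assms(1,2)] complex_norm_square[symmetric] flip: of_real_power)
  have "L2_sq M (L2_proj M E f) = (\<Sum>e\<in>E. (norm (L2_inner M f e))\<^sup>2)"
    using 2 unfolding L2_inner_self of_real_eq_iff .
  then show ?thesis
    using 1 by (subst L2_sq_diff[OF assms(3) L2_proj_L2[OF assms(1)]]) simp
qed

lemma bessel:
  assumes "orthonormal M E" "finite E" "L2_fun M f"
  shows "(\<Sum>e\<in>E. (norm (L2_inner M f e))\<^sup>2) \<le> L2_sq M f"
  using L2_sq_diff_proj[OF assms] L2_sq_nonneg[of M "\<lambda>x. f x - L2_proj M E f x"] by linarith

context prob_space
begin

lemma L2_bounded: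
  assumes "f \<in> borel_measurable M" "\<And>x. norm (f x) \<le> C"
  shows "L2_fun M f"
proof -
  have "norm ((norm (f x))\<^sup>2) \<le> C\<^sup>2" for x
    using assms(2)[of x] by (simp add: power_mono)
  then have "integrable M (\<lambda>x. (norm (f x))\<^sup>2)"
    using assms(1) by (intro integrable_const_bound[of _ "C\<^sup>2"]) auto
  then show ?thesis using assms(1) by (simp add: L2_fun_def)
qed

lemma L2_sq_le:
  assumes "L2_fun M f" "\<And>x. (norm (f x))\<^sup>2 \<le> C"
  shows "L2_sq M f \<le> C"
proof -
  have "L2_sq M f \<le> (\<integral>x. C \<partial>M)"
    unfolding L2_sq_def using assms by (intro integral_mono) (auto simp: L2_fun_def)
  then show ?thesis by (simp add: prob_space)
qed

lemma L2_integrable: "L2_fun M f \<Longrightarrow> integrable M f"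
  using L2_mult_integrable[of M f "\<lambda>_. 1"] L2_bounded[of "\<lambda>_. 1" 1] by simp

lemma L2_indicator: "A \<in> sets M \<Longrightarrow> L2_fun M (indicator A)"
  by (intro L2_bounded[of _ 1]) (auto split: split_indicator)

lemma L2_sq_indicator: "A \<in> sets M \<Longrightarrow> L2_sq M (indicator A) = measure M A"
proof -
  assume A: "A \<in> sets M"
  have "L2_sq M (indicator A) = (\<integral>x. indicator A x \<partial>M)"
    unfolding L2_sq_def by (intro Bochner_Integration.integral_cong) (auto split: split_indicator)
  then show ?thesis using A by simp
qed

end

text \<open>Separability of the measure algebra, needed for the diagonal argument below. The family
  consists of finite unions of basic open sets: a Borel set is nearly an open superset, which is an
  increasing union of such finite unions.\<close>

lemma approx_by_countable_family:
  fixes M :: "'x::polish_space measure"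
  assumes "prob_space M" "sets M = sets borel"
  shows "\<exists>A :: nat \<Rightarrow> 'x set. (\<forall>i. A i \<in> sets borel) \<and>
    (\<forall>B\<in>sets borel. \<forall>e>0. \<exists>i. measure M (sym_diff (A i) B) < e)"
proof -
  interpret prob_space M by fact
  obtain \<B> :: "'x set set" where \<B>: "countable \<B>" "topological_basis \<B>"
    using ex_countable_basis by blast
  define \<F> where "\<F> = {S. finite S \<and> S \<subseteq> \<B>}"
  have "countable \<F>" "\<F> \<noteq> {}"
    unfolding \<F>_def using countable_Collect_finite_subset[OF \<B>(1)] by (auto simp: conj_commute)
  define A where "A i = \<Union>(from_nat_into \<F> i)" for i
  have openb: "open b" if "b \<in> \<B>" for b
    using \<B>(2) that by (rule topological_basis_open)
  have "from_nat_into \<F> i \<in> \<F>" for i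
    using \<open>\<F> \<noteq> {}\<close> by (rule from_nat_into)
  then have sA: "open (A i)" for i
    unfolding A_def by (intro open_Union ballI openb) (auto simp: \<F>_def)
  have "\<exists>i. measure M (sym_diff (A i) B) < e" if B: "B \<in> sets borel" and e: "e > 0" for B e
  proof -
    have "emeasure M B < ennreal (measure M B + e/2)"
      using e by (simp add: emeasure_eq_measure ennreal_less_iff)
    then obtain U where U: "open U" "B \<subseteq> U" "emeasure M U < ennreal (measure M B + e/2)"
      using outer_regular[OF assms(2) _ B] by (auto simp: INF_less_iff)
    then have mU: "measure M U < measure M B + e/2"
      using e by (simp add: emeasure_eq_measure ennreal_less_iff del: ennreal_plus)
    obtain \<B>' where \<B>': "\<B>' \<subseteq> \<B>" "U = \<Union>\<B>'"
      using topological_basisE \<B>(2) U(1) by (metis topological_basis_def)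
    have "countable \<B>'"
      using \<B>'(1) \<B>(1) countable_subset by blast
    obtain b :: "nat \<Rightarrow> 'x set" where b: "range b \<subseteq> insert {} \<B>'" "(\<Union>n. b n) = U"
    proof (cases "\<B>' = {}")
      case True
      then show ?thesis using that[of "\<lambda>_. {}"] \<B>'(2) by auto
    next
      case False
      then show ?thesis
        using that[of "from_nat_into \<B>'"] range_from_nat_into[OF False \<open>countable \<B>'\<close>] \<B>'(2) by auto
    qed
    have sb: "b n \<in> sets M" for n
    proof -
      have "b n \<in> insert {} \<B>'" using b(1) by auto
      then have "open (b n)" using openb \<B>'(1) by auto
      then show ?thesis using assms(2) by simp
    qed
    have "(\<lambda>n. measure M (\<Union>i<n. b i)) \<longlonglongrightarrow> measure M (\<Union>n. \<Union>i<n. b i)"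
    proof (rule finite_Lim_measure_incseq)
      show "range (\<lambda>i. \<Union> (b ` {..<i})) \<subseteq> sets M"
        using sb by auto
      show "incseq (\<lambda>i. \<Union> (b ` {..<i}))"
        by (intro monoI UN_mono) auto
    qed
    also have "(\<Union>n. \<Union>i<n. b i) = U"
      using b(2) by auto
    finally have "\<forall>\<^sub>F n in sequentially. measure M U - e/2 < measure M (\<Union>i<n. b i)"
      using e by (intro order_tendstoD) auto
    then obtain n where n: "measure M U - e/2 < measure M (\<Union>i<n. b i)"
      using eventually_happens by fastforce
    \<comment> \<open>The empty set may occur in the enumeration without being a basis element;
      removing it does not change the union.\<close>
    have "b ` {..<n} - {{}} \<in> \<F>"
      using b(1) \<B>'(1) by (auto simp: \<F>_def)
    then obtain i where "from_nat_into \<F> i = b ` {..<n} - {{}}"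
      using from_nat_into_surj[OF \<open>countable \<F>\<close>] by blast
    then have Ai: "A i = (\<Union>i<n. b i)"
      unfolding A_def by auto
    then have "A i \<subseteq> U" using b(2) by auto
    have "measure M (sym_diff (A i) B) \<le> measure M ((U - A i) \<union> (U - B))"
      using \<open>A i \<subseteq> U\<close> U(1,2) sA[of i] B assms(2) by (intro finite_measure_mono) auto
    also have "\<dots> \<le> measure M (U - A i) + measure M (U - B)"
      using U(1) sA[of i] B assms(2) by (intro measure_Un_le) auto
    also have "\<dots> = (measure M U - measure M (A i)) + (measure M U - measure M B)"
      using U(1,2) sA[of i] B assms(2) \<open>A i \<subseteq> U\<close> by (simp add: finite_measure_Diff)
    also have "\<dots> < e"
      using n mU unfolding Ai by simp
    finally show ?thesis by blast
  qed
  then show ?thesis using sA by (intro exI[of _ A]) auto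
qed


text \<open>Weak sequential compactness of balls, tested against indicators only, since
  \<open>K f x\<close> is an inner product with the indicator of a section. A diagonal sequence
  converges against the countable family, and Cauchy-Schwarz makes the approximation of other Borel
  sets uniform along the sequence. No weak limit has to be produced.\<close>

lemma weak_subsequence:
  fixes M :: "'x::polish_space measure" and f :: "nat \<Rightarrow> 'x \<Rightarrow> complex"
  assumes "prob_space M" "sets M = sets borel"
    and f: "\<And>n. L2_fun M (f n)" "\<And>n. L2_sq M (f n) \<le> C"
  shows "\<exists>r. strict_mono (r :: nat \<Rightarrow> nat) \<and> (\<forall>B\<in>sets borel. convergent (\<lambda>n. L2_inner M (f (r n)) (indicator B)))"
proof -
  interpret prob_space M by fact
  obtain A :: "nat \<Rightarrow> 'x set" where A: "\<And>i. A i \<in> sets borel"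
    "\<And>B e. B \<in> sets borel \<Longrightarrow> e > 0 \<Longrightarrow> \<exists>i. measure M (sym_diff (A i) B) < e"
    using approx_by_countable_family[OF assms(1,2)] by blast
  have C0: "C \<ge> 0"
    using f(2)[of 0] L2_sq_nonneg[of M "f 0"] by linarith
  have bd: "(norm (L2_inner M (f n) g))\<^sup>2 \<le> C * L2_sq M g" if "L2_fun M g" for n g
    by (rule order_trans[OF L2_Cauchy_Schwarz[OF f(1) that]]) (intro mult_right_mono f(2) L2_sq_nonneg)
  interpret subseqs "\<lambda>i s. convergent (\<lambda>n. L2_inner M (f (s n)) (indicator (A i)))"
  proof
    fix i and s :: "nat \<Rightarrow> nat"
    have "bounded (range (\<lambda>n. L2_inner M (f (s n)) (indicator (A i))))"
      using real_le_rsqrt[OF bd[OF L2_indicator]] A(1)[of i] assms(2) unfolding bounded_iff by blast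
    from bounded_imp_convergent_subsequence[OF this]
    show "\<exists>r'. strict_mono r' \<and> convergent (\<lambda>n. L2_inner M (f ((s \<circ> r') n)) (indicator (A i)))"
      unfolding convergent_def o_def by blast
  qed
  have conv: "convergent (\<lambda>n. L2_inner M (f (diagseq n)) (indicator (A i)))" for i
  proof -
    \<comment> \<open>From index \<open>Suc i\<close> on, the diagonal sequence is a subsequence of
      the one selected for \<open>A i\<close>.\<close>
    have "convergent (\<lambda>n. L2_inner M (f ((diagseq \<circ> (+) (Suc i)) n)) (indicator (A i)))"
    proof (rule diagseq_holds)
      fix r s n assume "strict_mono (r :: nat \<Rightarrow> nat)" "convergent (\<lambda>na. L2_inner M (f (s na)) (indicator (A n)))"
      then show "convergent (\<lambda>na. L2_inner M (f ((s \<circ> r) na)) (indicator (A n)))"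
        using convergent_subseq_convergent[of "\<lambda>na. L2_inner M (f (s na)) (indicator (A n))" r]
        by (simp add: o_def)
    qed
    then show ?thesis
      by (subst convergent_ignore_initial_segment[of _ "Suc i", symmetric]) (simp add: o_def add.commute)
  qed
  have "convergent (\<lambda>n. L2_inner M (f (diagseq n)) (indicator B))" if B: "B \<in> sets borel" for B
  proof -
    have "Cauchy (\<lambda>n. L2_inner M (f (diagseq n)) (indicator B))"
    proof (rule metric_CauchyI)
      fix e :: real assume e: "e > 0"
      \<comment> \<open>Cauchy-Schwarz bounds the squared error by \<open>C\<close> times the
        measure of the symmetric difference; \<open>C + 1\<close> avoids division by zero.\<close>
      have "(e/3)\<^sup>2 / (C + 1) > 0"
        using e C0 by simp
      then obtain i where i: "measure M (sym_diff (A i) B) < (e/3)\<^sup>2 / (C + 1)"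
        using A(2)[OF B] by blast
      let ?a = "\<lambda>n. L2_inner M (f (diagseq n)) (indicator (A i))"
      let ?b = "\<lambda>n. L2_inner M (f (diagseq n)) (indicator B)"
      have L2A: "L2_fun M (indicator (A i))" "L2_fun M (indicator B)"
        using A(1)[of i] B assms(2) by (auto intro!: L2_indicator)
      have near: "norm (?b n - ?a n) < e/3" for n
      proof (rule power2_less_imp_less)
        let ?g = "\<lambda>x. indicator B x - indicator (A i) x :: complex"
        have "?b n - ?a n = L2_inner M (f (diagseq n)) ?g"
          using L2_inner_diff_right[OF L2A(2,1) f(1)] by simp
        then have "(norm (?b n - ?a n))\<^sup>2 \<le> C * L2_sq M ?g"
          using bd[OF L2_diff[OF L2A(2,1)], of "diagseq n"] by simp
        also have "L2_sq M ?g = L2_sq M (indicator (sym_diff (A i) B))"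
          unfolding L2_sq_def by (intro Bochner_Integration.integral_cong) (auto split: split_indicator)
        also have "\<dots> = measure M (sym_diff (A i) B)"
          using A(1)[of i] B assms(2) by (intro L2_sq_indicator) auto
        also have "C * \<dots> \<le> (C + 1) * measure M (sym_diff (A i) B)"
          by (intro mult_right_mono) auto
        also have "\<dots> < (e/3)\<^sup>2"
          using i C0 by (simp add: pos_less_divide_eq mult.commute)
        finally show "(norm (?b n - ?a n))\<^sup>2 < (e/3)\<^sup>2" .
      qed (use e in simp)
      have "Cauchy ?a"
        using conv by (rule convergent_Cauchy)
      then obtain N where N: "\<And>m n. m \<ge> N \<Longrightarrow> n \<ge> N \<Longrightarrow> dist (?a m) (?a n) < e/3"
        using e metric_CauchyD[of ?a "e/3"] by auto
      have "dist (?b m) (?b n) < e" if "m \<ge> N" "n \<ge> N" for m n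
      proof -
        have "dist (?b m) (?b n) \<le> dist (?b m) (?a m) + (dist (?a m) (?a n) + dist (?a n) (?b n))"
          using dist_triangle[of "?b m" "?b n" "?a m"] dist_triangle[of "?a m" "?b n" "?a n"] by linarith
        then show ?thesis
          using near[of m] near[of n] N[OF that] by (simp add: dist_norm norm_minus_commute)
      qed
      then show "\<exists>N. \<forall>m\<ge>N. \<forall>n\<ge>N. dist (?b m) (?b n) < e" by blast
    qed
    then show ?thesis by (simp add: Cauchy_convergent_iff)
  qed
  then show ?thesis
    using subseq_diagseq by blast
qed

section \<open>Common eigenvectors of commuting translations\<close>

text \<open>Gaussian elimination: solve equation \<open>e0\<close> for an unknown \<open>i0\<close>
  with nonzero coefficient and substitute into the others. This leaves one equation and one unknown
  fewer, with coefficients \<open>c i e - c i e0 / c i0 e0 * c i0 e\<close>.\<close>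

lemma underdetermined_system:
  fixes c :: "'i \<Rightarrow> 'e \<Rightarrow> 'a::field"
  assumes "finite E" "finite I" "card E < card I"
  shows "\<exists>d. (\<exists>i\<in>I. d i \<noteq> 0) \<and> (\<forall>e\<in>E. (\<Sum>i\<in>I. d i * c i e) = 0)"
  using assms
proof (induction E arbitrary: I c rule: finite_induct)
  case empty
  then have "I \<noteq> {}" by auto
  then show ?case by (intro exI[of _ "\<lambda>_. 1"]) auto
next
  case (insert e0 E)
  show ?case
  proof (cases "\<forall>i\<in>I. c i e0 = 0")
    case True
    have "card E < card I" using insert by simp
    from insert.IH[OF insert.prems(1) this] True show ?thesis by fastforce
  next
    case False
    then obtain i0 where i0: "i0 \<in> I" "c i0 e0 \<noteq> 0" by blast
    define I' where "I' = I - {i0}"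
    have I: "I = insert i0 I'" "i0 \<notin> I'" "finite I'"
      using i0 insert.prems by (auto simp: I'_def)
    have "card E < card I'"
      using insert I by simp
    from insert.IH[OF I(3) this, of "\<lambda>i e. c i e - c i e0 / c i0 e0 * c i0 e"]
    obtain d where d: "\<exists>i\<in>I'. d i \<noteq> 0" "\<And>e. e \<in> E \<Longrightarrow> (\<Sum>i\<in>I'. d i * (c i e - c i e0 / c i0 e0 * c i0 e)) = 0"
      by blast
    define s where "s = (\<Sum>i\<in>I'. d i * c i e0) / c i0 e0"
    define d' where "d' = d(i0 := - s)"
    have sum: "(\<Sum>i\<in>I. d' i * c i e) = (\<Sum>i\<in>I'. d i * c i e) - s * c i0 e" for e
    proof -
      have "(\<Sum>i\<in>I'. d' i * c i e) = (\<Sum>i\<in>I'. d i * c i e)"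
        using I(2) by (intro sum.cong) (auto simp: d'_def)
      then show ?thesis
        using I by (simp add: d'_def)
    qed
    have "(\<Sum>i\<in>I. d' i * c i e) = 0" if "e \<in> insert e0 E" for e
    proof (cases "e = e0")
      case True
      then show ?thesis using i0 by (simp add: sum s_def)
    next
      case False
      then have "(\<Sum>i\<in>I'. d i * (c i e - c i e0 / c i0 e0 * c i0 e)) = 0"
        using that d(2) by auto
      then show ?thesis
        unfolding sum s_def by (simp add: right_diff_distrib sum_subtractf sum_distrib_left sum_divide_distrib sum_distrib_right mult.assoc)
    qed
    moreover have "\<exists>i\<in>I. d' i \<noteq> 0"
      using d(1) I by (auto simp: d'_def)
    ultimately show ?thesis by blast
  qed
qed

section \<open>Spaces of functions and eigenvectors of a single map\<close>

definition function_subspace :: "('x \<Rightarrow> complex) set \<Rightarrow> bool" where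
  "function_subspace W \<longleftrightarrow> (\<lambda>x. 0) \<in> W \<and> (\<forall>f\<in>W. \<forall>g\<in>W. (\<lambda>x. f x + g x) \<in> W) \<and> (\<forall>c. \<forall>f\<in>W. (\<lambda>x. c * f x) \<in> W)"

lemma function_subspace_sum:
  "function_subspace W \<Longrightarrow> (\<And>i. i \<in> I \<Longrightarrow> f i \<in> W) \<Longrightarrow> (\<lambda>x. \<Sum>i\<in>I. c i * f i x) \<in> W"
  by (induction I rule: infinite_finite_induct) (auto simp: function_subspace_def)

lemma function_subspace_diff:
  assumes "function_subspace W" "f \<in> W" "g \<in> W"
  shows "(\<lambda>x. f x - g x) \<in> W"
proof -
  have add: "\<And>f g. f \<in> W \<Longrightarrow> g \<in> W \<Longrightarrow> (\<lambda>x. f x + g x) \<in> W" and scale: "\<And>c f. f \<in> W \<Longrightarrow> (\<lambda>x. c * f x) \<in> W"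
    using assms(1) by (auto simp: function_subspace_def)
  show ?thesis
    using add[OF assms(2) scale[OF assms(3), of "- 1"]] by simp
qed

text \<open>The relation says that \<open>p\<close>, evaluated at composition with \<open>S\<close>,
  annihilates \<open>v\<close>. Split off a root, \<open>p = (X - a) * q\<close>. Either composition
  with \<open>S\<close> multiplies \<open>v\<close> by \<open>a\<close>, or
  \<open>v (S x) - a * v x\<close> is a nonzero element annihilated by \<open>q\<close>, and
  induction applies.\<close>

lemma eigenvector_of_polynomial_relation:
  fixes S :: "'x \<Rightarrow> 'x"
  assumes W: "function_subspace W" "\<And>f. f \<in> W \<Longrightarrow> (\<lambda>x. f (S x)) \<in> W"
    and "v \<in> W" "v \<noteq> (\<lambda>x. 0)" "p \<noteq> 0" "degree p \<le> n" "\<And>x. (\<Sum>i\<le>n. coeff p i * v ((S ^^ i) x)) = 0"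
  shows "\<exists>h\<in>W. h \<noteq> (\<lambda>x. 0) \<and> (\<exists>a. \<forall>x. h (S x) = a * h x)"
  using assms(3-)
proof (induction n arbitrary: p v)
  case 0
  then have "coeff p 0 \<noteq> 0"
    using leading_coeff_0_iff[of p] by simp
  then have "v = (\<lambda>x. 0)"
    using 0 by auto
  then show ?case using 0 by simp
next
  case (Suc n)
  show ?case
  proof (cases "degree p = 0")
    case True
    then have "coeff p 0 \<noteq> 0"
      using leading_coeff_0_iff[of p] Suc.prems(3) by simp
    have "(\<Sum>i\<le>Suc n. coeff p i * v ((S ^^ i) x)) = (\<Sum>i\<in>{0}. coeff p i * v ((S ^^ i) x))" for x
      using True by (intro sum.mono_neutral_right) (auto simp: coeff_eq_0)
    then have "v = (\<lambda>x. 0)"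
      using Suc.prems(5) \<open>coeff p 0 \<noteq> 0\<close> by auto
    then show ?thesis using Suc.prems by simp
  next
    case False
    then obtain a where "poly p a = 0"
      using fundamental_theorem_of_algebra[of p] by (auto simp: constant_degree)
    then obtain q where q: "p = [:- a, 1:] * q"
      by (auto simp: poly_eq_0_iff_dvd elim: dvdE)
    then have "q \<noteq> 0" using Suc.prems(3) by auto
    then have deg: "degree q \<le> n"
      using Suc.prems(4) unfolding q by (subst (asm) degree_mult_eq) auto
    \<comment> \<open>Multiplication by \<open>X - a\<close>, read as an identity for an arbitrary
      sequence \<open>u\<close> in place of the powers of \<open>X\<close>; below,
      \<open>u i\<close> is \<open>v ((S ^^ i) x)\<close>.\<close>
    have sum_eq: "(\<Sum>i\<le>Suc n. coeff p i * u i) = (\<Sum>i\<le>n. coeff q i * (u (Suc i) - a * u i))" for u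
    proof -
      have "coeff p i = (case i of 0 \<Rightarrow> 0 | Suc k \<Rightarrow> coeff q k) - a * coeff q i" for i
        unfolding q by (cases i) (auto simp: algebra_simps)
      then have "(\<Sum>i\<le>Suc n. coeff p i * u i) =
          (\<Sum>i\<le>Suc n. (case i of 0 \<Rightarrow> 0 | Suc k \<Rightarrow> coeff q k) * u i) - (\<Sum>i\<le>Suc n. a * coeff q i * u i)"
        by (simp add: left_diff_distrib sum_subtractf del: sum.atMost_Suc)
      also have "(\<Sum>i\<le>Suc n. (case i of 0 \<Rightarrow> 0 | Suc k \<Rightarrow> coeff q k) * u i) = (\<Sum>i\<le>n. coeff q i * u (Suc i))"
        by (subst sum.atMost_Suc_shift) simp
      also have "(\<Sum>i\<le>Suc n. a * coeff q i * u i) = (\<Sum>i\<le>n. a * coeff q i * u i)"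
        using deg by (simp add: coeff_eq_0)
      finally show ?thesis
        by (simp add: sum_subtractf[symmetric] algebra_simps)
    qed
    define v' where "v' = (\<lambda>x. v (S x) - a * v x)"
    have v': "v' \<in> W"
      unfolding v'_def using W Suc.prems(1)
      by (intro function_subspace_diff) (auto simp: function_subspace_def)
    show ?thesis
    proof (cases "v' = (\<lambda>x. 0)")
      case True
      then have "\<forall>x. v (S x) = a * v x"
        by (simp add: v'_def fun_eq_iff)
      then show ?thesis using Suc.prems by blast
    next
      case False
      have "(\<Sum>i\<le>n. coeff q i * v' ((S ^^ i) x)) = 0" for x
        using Suc.prems(5)[of x] unfolding sum_eq by (simp add: v'_def)
      from Suc.IH[OF v' False \<open>q \<noteq> 0\<close> deg this] show ?thesis .
    qed
  qed
qed

text \<open>The last clause makes \<open>L2_sq\<close> positive definite on \<open>W\<close>, so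
  \<open>W\<close> embeds into the Hilbert space of classes and equalities found by inner products
  are equalities of functions.\<close>

definition L2_subspace :: "'x measure \<Rightarrow> ('x \<Rightarrow> complex) set \<Rightarrow> bool" where
  "L2_subspace M W \<longleftrightarrow> function_subspace W \<and> (\<forall>f\<in>W. L2_fun M f) \<and>
     (\<forall>f\<in>W. (AE x in M. f x = 0) \<longrightarrow> f = (\<lambda>x. 0))"

lemma L2_proj_in_subspace:
  "function_subspace W \<Longrightarrow> E \<subseteq> W \<Longrightarrow> L2_proj M E f \<in> W"
  unfolding L2_proj_def by (intro function_subspace_sum) auto

text \<open>One Gram-Schmidt step. The residual of \<open>v\<close> can be normalized because a
  nonzero element of \<open>W\<close> has positive norm.\<close>

lemma orthonormal_extend:
  assumes W: "L2_subspace M W" and E: "orthonormal M E" "finite E" "E \<subseteq> W"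
    and v: "v \<in> W" "v \<noteq> L2_proj M E v"
  shows "\<exists>e. e \<notin> E \<and> e \<in> W \<and> orthonormal M (insert e E)"
proof -
  define r where "r = (\<lambda>x. v x - L2_proj M E v x)"
  have fW: "function_subspace W" and L2W: "\<And>f. f \<in> W \<Longrightarrow> L2_fun M f"
    using W by (auto simp: L2_subspace_def)
  have r: "r \<in> W"
    unfolding r_def using fW v(1) L2_proj_in_subspace[OF fW E(3)] by (rule function_subspace_diff)
  have "r \<noteq> (\<lambda>x. 0)"
    using v(2) by (auto simp: r_def fun_eq_iff)
  then have "L2_sq M r \<noteq> 0"
    using r W L2_sq_eq_0_iff[OF L2W[OF r]] by (auto simp: L2_subspace_def)
  then obtain s where s: "L2_sq M (\<lambda>x. s * r x) = 1"
    using L2_normalize by blast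
  define e where "e = (\<lambda>x. s * r x)"
  have e: "e \<in> W"
    unfolding e_def using fW r by (auto simp: function_subspace_def)
  have ed: "L2_inner M e d = 0" if "d \<in> E" for d
  proof -
    have "L2_inner M r d = L2_inner M v d - L2_inner M (L2_proj M E v) d"
      unfolding r_def using that E v L2W by (intro L2_inner_diff_left L2_proj_L2) auto
    then show ?thesis
      using L2_proj_inner[OF E(1,2) that] by (simp add: e_def L2_inner_scale_left)
  qed
  have de: "L2_inner M d e = 0" if "d \<in> E" for d
    using ed[OF that] L2_inner_commute[of M d e] by simp
  have ee: "L2_inner M e e = 1"
    using s by (simp add: L2_inner_self e_def)
  have "e \<notin> E"
    using ee ed by fastforce
  moreover have "orthonormal M (insert e E)"
    using E(1) ee ed de L2W[OF e] \<open>e \<notin> E\<close> by (auto simp: orthonormal_def)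
  ultimately show ?thesis using e by blast
qed

text \<open>The second assumption on \<open>E\<close> says that \<open>E\<close> spans
  \<open>W\<close>. Hence \<open>card E + 1\<close> iterates of \<open>v\<close> are linearly
  dependent, and the coefficients of the dependence form a polynomial that annihilates
  \<open>v\<close>.\<close>

lemma eigenvector_exists:
  fixes S :: "'x \<Rightarrow> 'x"
  assumes W: "function_subspace W" "\<And>f. f \<in> W \<Longrightarrow> (\<lambda>x. f (S x)) \<in> W"
    and E: "finite E" "\<And>f. f \<in> W \<Longrightarrow> f = L2_proj M E f"
    and v: "v \<in> W" "v \<noteq> (\<lambda>x. 0)"
  shows "\<exists>h\<in>W. h \<noteq> (\<lambda>x. 0) \<and> (\<exists>a. \<forall>x. h (S x) = a * h x)"
proof -
  define n where "n = card E"
  define u where "u i = (\<lambda>x. v ((S ^^ i) x))" for i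
  have u: "u i \<in> W" for i
  proof (induction i)
    case 0
    then show ?case using v by (simp add: u_def)
  next
    case (Suc i)
    from W(2)[OF this] show ?case by (simp add: u_def funpow_swap1)
  qed
  obtain d where d: "\<exists>i\<in>{..n}. d i \<noteq> 0" "\<And>e. e \<in> E \<Longrightarrow> (\<Sum>i\<le>n. d i * L2_inner M (u i) e) = 0"
    using underdetermined_system[OF E(1), of "{..n}" "\<lambda>i e. L2_inner M (u i) e"] by (auto simp: n_def)
  define p where "p = (\<Sum>i\<le>n. monom (d i) i)"
  have p: "coeff p i = (if i \<le> n then d i else 0)" for i
    by (simp add: p_def coeff_sum)
  have "p \<noteq> 0"
    using d(1) p by (metis atMost_iff coeff_0)
  moreover have "degree p \<le> n"
    using p by (intro degree_le) auto
  moreover have "(\<Sum>i\<le>n. coeff p i * v ((S ^^ i) x)) = 0" for x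
  proof -
    have "(\<Sum>i\<le>n. coeff p i * v ((S ^^ i) x)) = (\<Sum>i\<le>n. d i * u i x)"
      by (intro sum.cong) (auto simp: p u_def)
    also have "\<dots> = (\<Sum>i\<le>n. d i * (\<Sum>e\<in>E. L2_inner M (u i) e * e x))"
      by (intro sum.cong refl arg_cong2[where f="(*)"] fun_cong[OF E(2)[OF u], unfolded L2_proj_def])
    also have "\<dots> = (\<Sum>e\<in>E. (\<Sum>i\<le>n. d i * L2_inner M (u i) e) * e x)"
      by (simp add: sum_distrib_left sum_distrib_right mult.assoc) (rule sum.swap)
    finally show ?thesis
      by (simp add: d(2))
  qed
  ultimately show ?thesis
    using eigenvector_of_polynomial_relation[of W S v p n] W v by blast
qed

context folner_tds
begin

text \<open>An invariant subspace of minimal dimension (measured by orthonormal systems) consists of common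
  eigenvectors, since the eigenspaces of one translation are invariant under all others.\<close>

lemma common_eigenvector:
  assumes W: "L2_subspace M W" "\<And>j f. f \<in> W \<Longrightarrow> (\<lambda>x. f (T j x)) \<in> W"
    and bound: "\<And>E. orthonormal M E \<Longrightarrow> finite E \<Longrightarrow> E \<subseteq> W \<Longrightarrow> card E \<le> N"
    and v: "v \<in> W" "v \<noteq> (\<lambda>x. 0)"
  shows "\<exists>h\<in>W. h \<noteq> (\<lambda>x. 0) \<and> (\<exists>w. \<forall>j x. h (T j x) = w j * h x)"
proof -
  define Q where "Q W' n \<longleftrightarrow> (\<exists>E. orthonormal M E \<and> finite E \<and> E \<subseteq> W' \<and> card E = n)" for W' n
  \<comment> \<open>The dimension, as the largest size of an orthonormal system; it exists by the
    bound \<open>N\<close>.\<close>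
  define m where "m W' = (GREATEST n. Q W' n)" for W'
  have Q0: "Q W' 0" for W'
    unfolding Q_def by (intro exI[of _ "{}"]) (auto simp: orthonormal_def)
  have Qb: "n \<le> N" if "Q W' n" "W' \<subseteq> W" for W' n
    using that bound unfolding Q_def by blast
  have Qm: "Q W' (m W')" if "W' \<subseteq> W" for W'
    unfolding m_def by (rule GreatestI_nat[where P="Q W'", OF Q0 Qb[OF _ that]])
  have mge: "n \<le> m W'" if "Q W' n" "W' \<subseteq> W" for W' n
    unfolding m_def by (rule Greatest_le_nat[where P="Q W'", OF that(1) Qb[OF _ that(2)]])
  have sub: "L2_subspace M W'" if "function_subspace W'" "W' \<subseteq> W" for W'
    using that W(1) by (auto simp: L2_subspace_def)
  have ex: "\<exists>E. orthonormal M E \<and> finite E \<and> E \<subseteq> W' \<and> card E = m W' \<and> (\<forall>f\<in>W'. f = L2_proj M E f)"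
    if W': "function_subspace W'" "W' \<subseteq> W" for W'
  proof -
    obtain E where E: "orthonormal M E" "finite E" "E \<subseteq> W'" "card E = m W'"
      using Qm[OF W'(2)] unfolding Q_def by blast
    have "f = L2_proj M E f" if f: "f \<in> W'" for f
    proof (rule ccontr)
      assume "f \<noteq> L2_proj M E f"
      then obtain e where e: "e \<notin> E" "e \<in> W'" "orthonormal M (insert e E)"
        using orthonormal_extend[OF sub[OF W'] E(1-3) f] by blast
      then have "Q W' (Suc (m W'))"
        unfolding Q_def using E by (intro exI[of _ "insert e E"]) auto
      from mge[OF this W'(2)] show False by simp
    qed
    with E show ?thesis by blast
  qed
  define C where "C W' \<longleftrightarrow> function_subspace W' \<and> W' \<subseteq> W \<and> (\<forall>j. \<forall>f\<in>W'. (\<lambda>x. f (T j x)) \<in> W') \<and> (\<exists>f\<in>W'. f \<noteq> (\<lambda>x. 0))" for W'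
  have "C W"
    using W v by (auto simp: C_def L2_subspace_def)
  then obtain W' where W': "C W'" and least: "\<And>W''. C W'' \<Longrightarrow> m W' \<le> m W''"
    using ex_has_least_nat[of C W m] by blast
  have fs: "function_subspace W'" "W' \<subseteq> W" "\<And>j f. f \<in> W' \<Longrightarrow> (\<lambda>x. f (T j x)) \<in> W'"
    using W' by (auto simp: C_def)
  obtain h where h: "h \<in> W'" "h \<noteq> (\<lambda>x. 0)"
    using W' by (auto simp: C_def)
  obtain E where E: "finite E" "\<And>f. f \<in> W' \<Longrightarrow> f = L2_proj M E f"
    using ex[OF fs(1,2)] by blast
  have "\<exists>a. \<forall>x. h (T j x) = a * h x" for j
  proof -
    obtain g a where g: "g \<in> W'" "g \<noteq> (\<lambda>x. 0)" "\<And>x. g (T j x) = a * g x"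
      using eigenvector_exists[of W' "T j" E M h] fs(1,3) E h by blast
    define W'' where "W'' = {f \<in> W'. \<forall>x. f (T j x) = a * f x}"
    have fs'': "function_subspace W''"
      using fs(1) unfolding function_subspace_def W''_def by (auto simp: algebra_simps)
    have W'': "W'' \<subseteq> W" "W'' \<subseteq> W'"
      using fs(2) by (auto simp: W''_def)
    have "(\<lambda>x. f (T i x)) \<in> W''" if "f \<in> W''" for i f
      using that fs(3) unfolding W''_def by (auto simp: T_commute[of i j])
    then have "C W''"
      using fs'' W'' g by (auto simp: C_def W''_def)
    \<comment> \<open>If \<open>h\<close> were missing from the eigenspace \<open>W''\<close>, a
      maximal orthonormal system of \<open>W''\<close> could be enlarged inside \<open>W'\<close>.
      Then \<open>W''\<close> would have smaller dimension than the minimal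
      \<open>W'\<close>.\<close>
    have "h \<in> W''"
    proof (rule ccontr)
      assume nh: "h \<notin> W''"
      obtain E'' where E'': "orthonormal M E''" "finite E''" "E'' \<subseteq> W''" "card E'' = m W''"
        using ex[OF fs'' W''(1)] by blast
      have "L2_proj M E'' h \<in> W''"
        by (rule L2_proj_in_subspace[OF fs'' E''(3)])
      with nh have "h \<noteq> L2_proj M E'' h" by auto
      then obtain e where e: "e \<notin> E''" "e \<in> W'" "orthonormal M (insert e E'')"
        using orthonormal_extend[OF sub[OF fs(1,2)] E''(1,2) _ h(1)] E''(3) W''(2) by blast
      then have "Q W' (Suc (m W''))"
        unfolding Q_def using E'' W''(2) by (intro exI[of _ "insert e E''"]) auto
      from mge[OF this fs(2)] least[OF \<open>C W''\<close>] show False by simp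
    qed
    then show ?thesis by (auto simp: W''_def)
  qed
  then obtain w where "\<forall>j x. h (T j x) = w j * h x" by metis
  then show ?thesis using h fs(2) by blast
qed

end

section \<open>Integral operators of invariant relations\<close>

context folner_tds
begin

definition orth :: "('x \<Rightarrow> complex) \<Rightarrow> bool" where
  "orth f \<longleftrightarrow> L2_fun M f \<and> (\<forall>e. eigenfunction M T e \<longrightarrow> L2_inner M f e = 0)"

lemma L2_T:
  assumes "L2_fun M f"
  shows "L2_fun M (\<lambda>x. f (T j x))"
proof -
  note [measurable] = L2_borel_measurable[OF assms]
  have "(\<lambda>x. f (T j x)) \<in> borel_measurable M"
    by measurable
  then show ?thesis
    using assms integrable_T[of "\<lambda>x. (norm (f x))\<^sup>2" j] unfolding L2_fun_def by simp
qed

lemma eigenfunction_L2: "eigenfunction M T e \<Longrightarrow> L2_fun M e"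
  by (simp add: eigenfunction_def)

lemma orth_zero: "orth (\<lambda>x. 0)"
  by (simp add: orth_def L2_zero L2_inner_eq_0)

lemma orth_add: "orth f \<Longrightarrow> orth g \<Longrightarrow> orth (\<lambda>x. f x + g x)"
  by (auto simp: orth_def L2_add L2_inner_add_left eigenfunction_L2)

lemma orth_scale: "orth f \<Longrightarrow> orth (\<lambda>x. c * f x)"
  by (auto simp: orth_def L2_scale L2_inner_scale_left)

text \<open>Moving the translation to the other side of the inner product only multiplies an
  eigenfunction by a scalar.\<close>

lemma orth_T:
  assumes "orth f"
  shows "orth (\<lambda>x. f (T j x))"
  unfolding orth_def
proof (intro conjI allI impI)
  show "L2_fun M (\<lambda>x. f (T j x))"
    using assms by (intro L2_T) (simp add: orth_def)
  fix e assume e: "eigenfunction M T e"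
  then obtain w where w: "AE x in M. e (T (- j) x) = w * e x"
    unfolding eigenfunction_def by blast
  have [measurable]: "f \<in> borel_measurable borel" "e \<in> borel_measurable borel"
    using assms e by (auto intro: L2_borel_measurable simp: orth_def eigenfunction_L2)
  have "L2_inner M (\<lambda>x. f (T j x)) e = (\<integral>x. f (T j x) * cnj (e (T (- j) (T j x))) \<partial>M)"
    by (simp add: L2_inner_def)
  also have "\<dots> = (\<integral>x. f x * cnj (e (T (- j) x)) \<partial>M)"
    by (rule integral_T) measurable
  also have "\<dots> = (\<integral>x. f x * cnj (w * e x) \<partial>M)"
    using w by (intro integral_cong_AE) auto
  also have "\<dots> = cnj w * L2_inner M f e"
    using L2_inner_scale_right[of M f w e] by (simp only: L2_inner_def)
  finally show "L2_inner M (\<lambda>x. f (T j x)) e = 0"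
    using assms e by (simp add: orth_def)
qed

end

locale invariant_relation = folner_tds \<nu> F M T
  for \<nu> :: "'g::{topological_ab_group_add, t2_space} measure"
    and F :: "nat \<Rightarrow> 'g set"
    and M :: "'x::polish_space measure"
    and T :: "'g \<Rightarrow> 'x \<Rightarrow> 'x" +
  fixes R :: "'x \<Rightarrow> 'x \<Rightarrow> bool"
  assumes R_pred: "Measurable.pred (borel \<Otimes>\<^sub>M borel) (\<lambda>p. R (fst p) (snd p))"
    and R_sym: "R x y \<longleftrightarrow> R y x"
    and R_T: "R (T j x) (T j y) \<longleftrightarrow> R x y"
begin

lemma R_measurable[measurable (raw)]:
  assumes [measurable]: "f \<in> N \<rightarrow>\<^sub>M borel" "g \<in> N \<rightarrow>\<^sub>M borel"
  shows "Measurable.pred N (\<lambda>z. R (f z) (g z))"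
proof -
  have "Measurable.pred N (\<lambda>z. (\<lambda>p. R (fst p) (snd p)) (f z, g z))"
    by (rule measurable_compose[OF _ R_pred]) measurable
  then show ?thesis by simp
qed

text \<open>The integral operator with kernel \<open>R\<close>. Writing its values as inner products
  with sections makes Cauchy-Schwarz, Bessel and weak convergence available at each single point
  \<open>x\<close>.\<close>

definition K :: "('x \<Rightarrow> complex) \<Rightarrow> 'x \<Rightarrow> complex" where
  "K f x = L2_inner M f (indicator {y. R x y})"

lemma R_set[measurable]: "{y. R x y} \<in> sets borel"
  by measurable

lemma K_eq: "K f x = (\<integral>y. (if R x y then f y else 0) \<partial>M)"
  unfolding K_def L2_inner_def by (intro Bochner_Integration.integral_cong) auto

lemma L2_R: "L2_fun M (indicator {y. R x y})"
  by (intro L2_indicator) simp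

lemma L2_sq_R: "L2_sq M (indicator {y. R x y}) \<le> 1"
  by (subst L2_sq_indicator) auto

text \<open>\<open>K\<close> maps mean-square bounds to uniform bounds. This supplies the domination
  for limits and, applied to differences, turns mean-square convergence into pointwise
  convergence.\<close>

lemma K_bound:
  assumes "L2_fun M f"
  shows "(norm (K f x))\<^sup>2 \<le> L2_sq M f"
proof -
  have "(norm (K f x))\<^sup>2 \<le> L2_sq M f * L2_sq M (indicator {y. R x y})"
    unfolding K_def by (rule L2_Cauchy_Schwarz[OF assms L2_R])
  also have "\<dots> \<le> L2_sq M f * 1"
    by (intro mult_left_mono L2_sq_R) simp
  finally show ?thesis by simp
qed

lemma K_borel:
  assumes [measurable]: "f \<in> borel_measurable borel"
  shows "K f \<in> borel_measurable borel"
proof -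
  have "(\<lambda>x. \<integral>y. (if R x y then f y else 0) \<partial>M) \<in> borel_measurable borel"
    by measurable
  then show ?thesis by (simp add: K_eq[abs_def])
qed

lemma K_L2:
  assumes "L2_fun M f"
  shows "L2_fun M (K f)"
proof (rule L2_bounded)
  show "K f \<in> borel_measurable M"
    using K_borel[OF L2_borel_measurable[OF assms]] by simp
  show "norm (K f x) \<le> sqrt (L2_sq M f)" for x
    using K_bound[OF assms] by (rule real_le_rsqrt)
qed

lemma K_sq_le: "L2_fun M f \<Longrightarrow> L2_sq M (K f) \<le> L2_sq M f"
  by (intro L2_sq_le K_L2 K_bound)

lemma K_add: "L2_fun M f \<Longrightarrow> L2_fun M g \<Longrightarrow> K (\<lambda>x. f x + g x) x = K f x + K g x"
  unfolding K_def by (intro L2_inner_add_left L2_R)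

lemma K_diff: "L2_fun M f \<Longrightarrow> L2_fun M g \<Longrightarrow> K (\<lambda>x. f x - g x) x = K f x - K g x"
  unfolding K_def by (intro L2_inner_diff_left L2_R)

lemma K_scale: "K (\<lambda>x. c * f x) x = c * K f x"
  unfolding K_def by (rule L2_inner_scale_left)

lemma K_sum: "(\<And>i. i \<in> I \<Longrightarrow> L2_fun M (f i)) \<Longrightarrow> K (\<lambda>x. \<Sum>i\<in>I. f i x) x = (\<Sum>i\<in>I. K (f i) x)"
  unfolding K_def by (intro L2_inner_sum_left L2_R)

lemma K_AE_0: "AE x in M. f x = 0 \<Longrightarrow> K f x = 0"
  unfolding K_def by (rule L2_inner_eq_0)

lemma K_T:
  assumes [measurable]: "f \<in> borel_measurable borel"
  shows "K (\<lambda>y. f (T j y)) x = K f (T j x)"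
proof -
  have "K (\<lambda>y. f (T j y)) x = (\<integral>y. (if R (T j x) (T j y) then f (T j y) else 0) \<partial>M)"
    by (simp add: K_eq R_T)
  also have "\<dots> = K f (T j x)"
    unfolding K_eq by (rule integral_T) measurable
  finally show ?thesis .
qed

lemma K_adjoint:
  assumes f: "L2_fun M f" and g: "L2_fun M g"
  shows "L2_inner M (K f) g = L2_inner M f (K g)"
proof -
  interpret pair_sigma_finite M M ..
  note [measurable] = L2_borel_measurable[OF f] L2_borel_measurable[OF g]
  have int: "integrable (M \<Otimes>\<^sub>M M) (\<lambda>(x, y). if R x y then f y * cnj (g x) else 0)"
  proof (rule Bochner_Integration.integrable_bound)
    show "integrable (M \<Otimes>\<^sub>M M) (\<lambda>(x, y). f y * cnj (g x))"
    proof (rule Fubini_integrable)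
      show "AE x in M. integrable M (\<lambda>y. case (x, y) of (x, y) \<Rightarrow> f y * cnj (g x))"
        using L2_integrable[OF f] by auto
      have "integrable M (\<lambda>x. (\<integral>y. norm (f y) \<partial>M) * norm (g x))"
        using L2_integrable[OF g] by auto
      then show "integrable M (\<lambda>x. \<integral>y. norm (case (x, y) of (x, y) \<Rightarrow> f y * cnj (g x)) \<partial>M)"
        using L2_integrable[OF f] by (simp add: norm_mult)
    qed measurable
  qed (measurable, auto)
  have "L2_inner M (K f) g = (\<integral>x. (\<integral>y. (if R x y then f y * cnj (g x) else 0) \<partial>M) \<partial>M)"
    unfolding L2_inner_def
  proof (intro Bochner_Integration.integral_cong refl)
    fix x
    have "K f x * cnj (g x) = (\<integral>y. (if R x y then f y else 0) * cnj (g x) \<partial>M)"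
      unfolding K_eq by simp
    also have "\<dots> = (\<integral>y. (if R x y then f y * cnj (g x) else 0) \<partial>M)"
      by (intro Bochner_Integration.integral_cong) auto
    finally show "K f x * cnj (g x) = (\<integral>y. (if R x y then f y * cnj (g x) else 0) \<partial>M)" .
  qed
  also have "\<dots> = (\<integral>y. (\<integral>x. (if R x y then f y * cnj (g x) else 0) \<partial>M) \<partial>M)"
    using Fubini_integral[OF int] by simp
  also have "\<dots> = L2_inner M f (K g)"
    unfolding L2_inner_def
  proof (intro Bochner_Integration.integral_cong refl)
    fix y
    have "f y * cnj (K g y) = (\<integral>x. f y * cnj (if R y x then g x else 0) \<partial>M)"
      unfolding K_eq by (simp flip: Bochner_Integration.integral_cnj del: Bochner_Integration.integral_cnj)
    also have "\<dots> = (\<integral>x. (if R x y then f y * cnj (g x) else 0) \<partial>M)"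
      by (intro Bochner_Integration.integral_cong) (auto simp: R_sym[of y])
    finally show "(\<integral>x. (if R x y then f y * cnj (g x) else 0) \<partial>M) = f y * cnj (K g y)" ..
  qed
  finally show ?thesis .
qed

lemma K_sq_eq: "L2_fun M f \<Longrightarrow> complex_of_real (L2_sq M (K f)) = L2_inner M (K (K f)) f"
  by (subst K_adjoint) (auto simp: K_L2 L2_inner_self)

lemma K_dominated:
  assumes h[measurable]: "\<And>n. h n \<in> borel_measurable borel" and H[measurable]: "H \<in> borel_measurable borel"
    and "\<And>x. (\<lambda>n. h n x) \<longlonglongrightarrow> H x" "\<And>n x. norm (h n x) \<le> C"
  shows "(\<lambda>n. K (h n) x) \<longlonglongrightarrow> K H x"
  unfolding K_def L2_inner_def
proof (rule integral_dominated_convergence[where w="\<lambda>_. C"])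
  show "AE y in M. (\<lambda>n. h n y * cnj (indicator {y. R x y} y)) \<longlonglongrightarrow> H y * cnj (indicator {y. R x y} y)"
    by (intro AE_I2 tendsto_intros assms(3))
  have "0 \<le> C" using assms(4) norm_ge_zero order_trans by blast
  then show "AE y in M. norm (h n y * cnj (indicator {y. R x y} y)) \<le> C" for n
    using assms(4) by (intro AE_I2) (auto split: split_indicator)
qed (auto)

text \<open>The equation for \<open>e\<close> may fail on a null set depending on \<open>j\<close>,
  but integration does not see it: for \<open>K e\<close> the equation holds at every point, as
  \<open>eigenfunctionI\<close> demands.\<close>

lemma K_T_eigen:
  assumes L2e: "L2_fun M e" and w: "\<And>j. AE x in M. e (T j x) = w j * e x"
  shows "K e (T j x) = w j * K e x"
proof -
  note [measurable] = L2_borel_measurable[OF L2e]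
  have "K e (T j x) = K (\<lambda>y. e (T j y)) x"
    by (simp add: K_T)
  also have "\<dots> = K (\<lambda>y. w j * e y) x"
    unfolding K_eq using w[of j] by (intro integral_cong_AE) auto
  finally show ?thesis by (simp add: K_scale)
qed

lemma K_eigenfunction:
  assumes e: "eigenfunction M T e"
  shows "(AE x in M. K e x = 0) \<or> eigenfunction M T (K e)"
proof -
  obtain w where w: "\<And>j. AE x in M. e (T j x) = w j * e x"
    using e unfolding eigenfunction_def by blast
  show ?thesis
    using eigenfunctionI[OF K_L2 K_T_eigen[OF _ w]] eigenfunction_L2[OF e] by blast
qed

lemma orth_K:
  assumes "orth f"
  shows "orth (K f)"
  unfolding orth_def
proof (intro conjI allI impI)
  have f: "L2_fun M f" using assms by (simp add: orth_def)
  then show "L2_fun M (K f)" by (rule K_L2)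
  fix e assume e: "eigenfunction M T e"
  have "L2_inner M (K f) e = L2_inner M f (K e)"
    by (rule K_adjoint[OF f eigenfunction_L2[OF e]])
  also have "\<dots> = 0"
    using K_eigenfunction[OF e]
  proof
    assume "AE x in M. K e x = 0"
    from L2_inner_eq_0[OF this] show ?thesis
      by (subst L2_inner_commute) simp
  qed (use assms in \<open>simp add: orth_def\<close>)
  finally show "L2_inner M (K f) e = 0" .
qed

text \<open>Weak convergence against the indicators of all sections is pointwise convergence of the
  images under \<open>K\<close>. Together with the uniform bound \<open>sqrt C\<close>, dominated
  convergence upgrades it to convergence of inner products and norms.\<close>

lemma K_compact:
  fixes f :: "nat \<Rightarrow> 'x \<Rightarrow> complex"
  assumes f: "\<And>n. L2_fun M (f n)" "\<And>n. L2_sq M (f n) \<le> C"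
  obtains r G where "strict_mono (r :: nat \<Rightarrow> nat)" "\<And>x. (\<lambda>n. K (f (r n)) x) \<longlonglongrightarrow> G x" "L2_fun M G"
    "\<And>g. L2_fun M g \<Longrightarrow> (\<lambda>n. L2_inner M (K (f (r n))) g) \<longlonglongrightarrow> L2_inner M G g"
    "(\<lambda>n. L2_sq M (K (f (r n)))) \<longlonglongrightarrow> L2_sq M G"
proof -
  obtain r where r: "strict_mono r"
    "\<And>B. B \<in> sets borel \<Longrightarrow> convergent (\<lambda>n. L2_inner M (f (r n)) (indicator B))"
    using weak_subsequence[OF prob_space_axioms sets_M, of f C] f by blast
  have "\<exists>z. (\<lambda>n. K (f (r n)) x) \<longlonglongrightarrow> z" for x
    using r(2)[OF R_set, of x] by (simp add: K_def convergent_def)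
  then obtain G where G: "\<And>x. (\<lambda>n. K (f (r n)) x) \<longlonglongrightarrow> G x"
    by metis
  define D where "D = sqrt C"
  have Kf: "norm (K (f n) x) \<le> D" for n x
    unfolding D_def by (intro real_le_rsqrt order_trans[OF K_bound[OF f(1)] f(2)])
  have Kfm[measurable]: "K (f n) \<in> borel_measurable borel" for n
    by (intro K_borel L2_borel_measurable f)
  have Gm[measurable]: "G \<in> borel_measurable borel"
    by (rule borel_measurable_LIMSEQ_metric[OF Kfm G])
  have "norm (G x) \<le> D" for x
    using Kf by (intro LIMSEQ_le_const2[OF tendsto_norm[OF G]]) auto
  then have L2G: "L2_fun M G"
    by (intro L2_bounded[of _ D]) auto
  have inner: "(\<lambda>n. L2_inner M (K (f (r n))) g) \<longlonglongrightarrow> L2_inner M G g" if g: "L2_fun M g" for g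
    unfolding L2_inner_def
  proof (rule integral_dominated_convergence[where w="\<lambda>x. D * norm (g x)"])
    have [measurable]: "g \<in> borel_measurable borel" using g by (rule L2_borel_measurable)
    show "(\<lambda>x. G x * cnj (g x)) \<in> borel_measurable M" "(\<lambda>x. K (f (r n)) x * cnj (g x)) \<in> borel_measurable M" for n
      by measurable
    show "integrable M (\<lambda>x. D * norm (g x))"
      using L2_integrable[OF g] by simp
    show "AE x in M. (\<lambda>n. K (f (r n)) x * cnj (g x)) \<longlonglongrightarrow> G x * cnj (g x)"
      by (intro AE_I2 tendsto_intros G)
    show "AE x in M. norm (K (f (r n)) x * cnj (g x)) \<le> D * norm (g x)" for n
      using Kf by (intro AE_I2) (simp add: norm_mult mult_right_mono)
  qed
  have "(\<lambda>n. L2_sq M (K (f (r n)))) \<longlonglongrightarrow> L2_sq M G"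
    unfolding L2_sq_def
  proof (rule integral_dominated_convergence[where w="\<lambda>_. D\<^sup>2"])
    show "AE x in M. (\<lambda>n. (norm (K (f (r n)) x))\<^sup>2) \<longlonglongrightarrow> (norm (G x))\<^sup>2"
      by (intro AE_I2 tendsto_intros G)
    show "AE x in M. norm ((norm (K (f (r n)) x))\<^sup>2) \<le> D\<^sup>2" for n
      using Kf by (intro AE_I2) (simp add: power_mono)
  qed auto
  then show ?thesis
    using that[OF r(1) G L2G inner] by blast
qed

text \<open>The operator is compact and self-adjoint, so if it were nonzero on the orthogonal complement of the
  eigenfunctions then a maximizing sequence for the norm would yield an eigenspace of its square there.
  All limits are taken pointwise, which keeps the eigenspace a space of honest functions on which the
  eigenvalue equations hold everywhere.\<close>

lemma K_eigenspace:
  assumes f0: "orth f0" "L2_sq M (K f0) \<noteq> 0"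
  shows "\<exists>\<rho>>0. \<exists>G. orth G \<and> G \<noteq> (\<lambda>x. 0) \<and> (\<forall>x. K (K G) x = of_real \<rho> * G x)"
proof -
  define S where "S = {L2_sq M (K f) | f. orth f \<and> L2_sq M f \<le> 1}"
  \<comment> \<open>The squared operator norm of \<open>K\<close> on the complement of the
    eigenfunctions.\<close>
  define \<rho> where "\<rho> = Sup S"
  have L2: "L2_fun M f" if "orth f" for f
    using that by (simp add: orth_def)
  have bdd: "bdd_above S"
    unfolding S_def by (intro bdd_aboveI[of _ 1]) (auto intro: order_trans[OF K_sq_le] L2)
  have up: "L2_sq M (K f) \<le> \<rho>" if "orth f" "L2_sq M f \<le> 1" for f
    unfolding \<rho>_def using that by (intro cSup_upper bdd) (auto simp: S_def)
  have S_ne: "S \<noteq> {}"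
    unfolding S_def using orth_zero by (auto intro!: exI[of _ "\<lambda>x. 0"] simp: L2_sq_def)
  have le: "L2_sq M (K f) \<le> \<rho> * L2_sq M f" if f: "orth f" for f
  proof (cases "L2_sq M f = 0")
    case True
    then show ?thesis using K_sq_le[OF L2[OF f]] by simp
  next
    case False
    then obtain s where s: "(norm s)\<^sup>2 * L2_sq M f = 1" "L2_sq M (\<lambda>x. s * f x) = 1"
      using L2_normalize by blast
    then have "L2_sq M (K (\<lambda>x. s * f x)) \<le> \<rho>"
      by (intro up[OF orth_scale[OF f]]) simp
    then have "(norm s)\<^sup>2 * L2_sq M (K f) \<le> \<rho>"
      by (simp add: K_scale[abs_def] L2_sq_scale)
    then have "L2_sq M f * ((norm s)\<^sup>2 * L2_sq M (K f)) \<le> L2_sq M f * \<rho>"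
      by (rule mult_left_mono) simp
    also have "L2_sq M f * ((norm s)\<^sup>2 * L2_sq M (K f)) = L2_sq M (K f)"
      using s(1) by (simp only: mult.assoc[symmetric] mult.commute[of "L2_sq M f" "(norm s)\<^sup>2"] mult_1)
    finally show ?thesis by (simp add: mult.commute)
  qed
  have "\<rho> \<noteq> 0"
    using le[OF f0(1)] f0(2) order.antisym[OF _ L2_sq_nonneg[of M "K f0"]] by auto
  moreover have "\<rho> \<ge> 0"
    by (rule order_trans[OF L2_sq_nonneg up[OF orth_zero]]) (simp add: L2_sq_def)
  ultimately have \<rho>: "\<rho> > 0" by simp
  have "\<exists>f. orth f \<and> L2_sq M f \<le> 1 \<and> \<rho> - inverse (real (Suc n)) < L2_sq M (K f)" for n
  proof -
    have "\<rho> - inverse (real (Suc n)) < Sup S"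
      by (simp add: \<rho>_def)
    from less_cSupD[OF S_ne this] show ?thesis by (auto simp: S_def)
  qed
  then obtain f where f: "\<And>n. orth (f n)" "\<And>n. L2_sq M (f n) \<le> 1"
    "\<And>n. \<rho> - inverse (real (Suc n)) < L2_sq M (K (f n))"
    by metis
  have "(\<lambda>n. L2_sq M (K (f n))) \<longlonglongrightarrow> \<rho>"
  proof (rule tendsto_sandwich)
    show "(\<lambda>n. \<rho> - inverse (real (Suc n))) \<longlonglongrightarrow> \<rho>"
      using tendsto_diff[OF tendsto_const LIMSEQ_inverse_real_of_nat, of \<rho>] by simp
    show "\<forall>\<^sub>F n in sequentially. \<rho> - inverse (real (Suc n)) \<le> L2_sq M (K (f n))"
      using f(3) by (intro always_eventually allI less_imp_le)
    show "\<forall>\<^sub>F n in sequentially. L2_sq M (K (f n)) \<le> \<rho>"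
      using up f(1,2) by (intro always_eventually) blast
  qed simp
  moreover obtain r G where r: "strict_mono r" and G: "\<And>x. (\<lambda>n. K (f (r n)) x) \<longlonglongrightarrow> G x" and L2G: "L2_fun M G"
    and inner: "\<And>g. L2_fun M g \<Longrightarrow> (\<lambda>n. L2_inner M (K (f (r n))) g) \<longlonglongrightarrow> L2_inner M G g"
    and sq: "(\<lambda>n. L2_sq M (K (f (r n)))) \<longlonglongrightarrow> L2_sq M G"
    using K_compact[of f 1] L2[OF f(1)] f(2) by blast
  ultimately have lim\<rho>: "(\<lambda>n. L2_sq M (K (f (r n)))) \<longlonglongrightarrow> \<rho>"
    using LIMSEQ_subseq_LIMSEQ[of "\<lambda>n. L2_sq M (K (f n))" \<rho> r] by (simp add: o_def)
  define h where "h n = f (r n)" for n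
  have h: "orth (h n)" "L2_sq M (h n) \<le> 1" "L2_fun M (h n)" for n
    using f L2 by (auto simp: h_def)
  have Gh: "(\<lambda>n. K (h n) x) \<longlonglongrightarrow> G x" for x
    using G by (simp add: h_def)
  have le1: "norm (K u x) \<le> 1" if "L2_fun M u" "L2_sq M u \<le> 1" for u x
  proof -
    have "(norm (K u x))\<^sup>2 \<le> 1\<^sup>2"
      using K_bound[OF that(1), of x] that(2) by simp
    then show ?thesis by (rule power2_le_imp_le) simp
  qed
  have [measurable]: "h n \<in> borel_measurable borel" "G \<in> borel_measurable borel" for n
    using L2_borel_measurable[OF h(3)] L2_borel_measurable[OF L2G] .
  note [measurable] = K_borel
  have sq_Kh: "L2_sq M (K (h n)) \<le> 1" for n
    using K_sq_le[OF h(3)] h(2) order_trans by blast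
  have KG: "(\<lambda>n. K (K (h n)) x) \<longlonglongrightarrow> K G x" for x
    using Gh le1[OF h(3,2)] by (intro K_dominated[where C=1]) auto
  have KKG: "(\<lambda>n. K (K (K (h n))) x) \<longlonglongrightarrow> K (K G) x" for x
    using KG le1[OF K_L2[OF h(3)] sq_Kh] by (intro K_dominated[of "\<lambda>n. K (K (h n))" "K G" 1]) auto
  have "L2_sq M G = \<rho>"
    using sq lim\<rho> by (rule LIMSEQ_unique)
  then have G_ne: "G \<noteq> (\<lambda>x. 0)"
    using \<rho> by (auto simp: L2_sq_def)
  have "orth G"
    unfolding orth_def
  proof (intro conjI allI impI L2G)
    fix e assume e: "eigenfunction M T e"
    have "L2_inner M (K (f (r n))) e = 0" for n
      using orth_K[OF f(1)] e by (simp add: orth_def)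
    then show "L2_inner M G e = 0"
      using inner[OF eigenfunction_L2[OF e]] by (simp add: LIMSEQ_const_iff)
  qed
  moreover have "K (K G) x = of_real \<rho> * G x" for x
  proof -
    \<comment> \<open>Expanding the square bounds the squared norm of
      \<open>K (K (h n)) - \<rho> * h n\<close> by
      \<open>2 * \<rho>^2 - 2 * \<rho> * L2_sq M (K (h n))\<close>, which tends to 0 along the
      maximizing sequence. One further application of \<open>K\<close> makes the convergence
      pointwise by \<open>K_bound\<close>.\<close>
    have "(\<lambda>n. K (K (K (h n))) x - of_real \<rho> * K (h n) x) \<longlonglongrightarrow> 0"
    proof (rule Lim_null_comparison)
      have "(norm (K (K (K (h n))) x - of_real \<rho> * K (h n) x))\<^sup>2 \<le> 2 * \<rho>\<^sup>2 - 2 * \<rho> * L2_sq M (K (h n))" for n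
      proof -
        let ?d = "\<lambda>x. K (K (h n)) x - of_real \<rho> * h n x"
        have LL: "L2_fun M (K (K (h n)))" "L2_fun M (\<lambda>x. of_real \<rho> * h n x)"
          using h(3)[of n] by (auto intro: K_L2 L2_scale)
        have "K (K (K (h n))) x - of_real \<rho> * K (h n) x = K ?d x"
          by (simp add: K_diff[OF LL] K_scale)
        moreover have "(norm (K ?d x))\<^sup>2 \<le> L2_sq M ?d"
          by (intro K_bound L2_diff LL)
        moreover have "L2_sq M ?d = L2_sq M (K (K (h n))) - 2 * \<rho> * L2_sq M (K (h n)) + \<rho>\<^sup>2 * L2_sq M (h n)"
          unfolding L2_sq_diff[OF LL] L2_inner_scale_right K_sq_eq[OF h(3), symmetric]
          by (simp add: L2_sq_scale)
        moreover have "L2_sq M (K (K (h n))) \<le> \<rho>\<^sup>2"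
        proof -
          have "L2_sq M (K (K (h n))) \<le> \<rho> * L2_sq M (K (h n))"
            by (rule le[OF orth_K[OF h(1)]])
          also have "\<dots> \<le> \<rho> * \<rho>"
            using \<rho> up[OF h(1,2)] by (intro mult_left_mono) auto
          finally show ?thesis by (simp add: power2_eq_square)
        qed
        moreover have "\<rho>\<^sup>2 * L2_sq M (h n) \<le> \<rho>\<^sup>2 * 1"
          by (intro mult_left_mono h(2)) simp
        ultimately show ?thesis by simp
      qed
      then show "\<forall>\<^sub>F n in sequentially. norm (K (K (K (h n))) x - of_real \<rho> * K (h n) x) \<le> sqrt (2 * \<rho>\<^sup>2 - 2 * \<rho> * L2_sq M (K (h n)))"
        by (intro always_eventually allI real_le_rsqrt)
      have "(\<lambda>n. sqrt (2 * \<rho>\<^sup>2 - 2 * \<rho> * L2_sq M (K (h n)))) \<longlonglongrightarrow> sqrt (2 * \<rho>\<^sup>2 - 2 * \<rho> * \<rho>)"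
        using lim\<rho> unfolding h_def by (intro tendsto_intros)
      then show "(\<lambda>n. sqrt (2 * \<rho>\<^sup>2 - 2 * \<rho> * L2_sq M (K (h n)))) \<longlonglongrightarrow> 0"
        by (simp add: power2_eq_square)
    qed
    moreover have "(\<lambda>n. K (K (K (h n))) x - of_real \<rho> * K (h n) x) \<longlonglongrightarrow> K (K G) x - of_real \<rho> * G x"
      by (intro tendsto_intros KKG Gh)
    ultimately have "K (K G) x - of_real \<rho> * G x = 0"
      using LIMSEQ_unique by blast
    then show ?thesis by simp
  qed
  ultimately show ?thesis
    using \<rho> G_ne by blast
qed

text \<open>Otherwise the eigenspace \<open>W\<close> of the square of \<open>K\<close> inside the
  complement is nonzero, finite-dimensional and translation invariant. The common eigenvector of all
  translations in it is an eigenfunction orthogonal to all eigenfunctions, hence to itself.\<close>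

lemma K_orth_eq_0:
  assumes "orth f0"
  shows "L2_sq M (K f0) = 0"
proof (rule ccontr)
  assume "L2_sq M (K f0) \<noteq> 0"
  then obtain \<rho> G where \<rho>: "\<rho> > 0" and G: "orth G" "G \<noteq> (\<lambda>x. 0)" "\<And>x. K (K G) x = of_real \<rho> * G x"
    using K_eigenspace[OF assms] by blast
  define W where "W = {h. orth h \<and> (\<forall>x. K (K h) x = of_real \<rho> * h x)}"
  have L2W: "L2_fun M h" if "h \<in> W" for h
    using that by (simp add: W_def orth_def)
  \<comment> \<open>A null function has image 0 under \<open>K\<close> at every point, and the
    eigenvalue equation, which also holds at every point, carries this back to
    \<open>h\<close>.\<close>
  have W0: "h = (\<lambda>x. 0)" if "h \<in> W" "AE x in M. h x = 0" for h
  proof -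
    have "K h = (\<lambda>x. 0)"
      using K_AE_0[OF that(2)] by auto
    then have "of_real \<rho> * h x = 0" for x
      using that(1) K_AE_0[of "\<lambda>x. 0"] by (auto simp: W_def)
    then show ?thesis using \<rho> by auto
  qed
  have "function_subspace W"
    unfolding function_subspace_def
  proof (intro conjI ballI allI)
    show "(\<lambda>x. 0) \<in> W"
      using orth_zero K_AE_0[of "\<lambda>x. 0"] K_AE_0[of "K (\<lambda>x. 0)"] by (simp add: W_def)
    show "(\<lambda>x. f x + g x) \<in> W" if "f \<in> W" "g \<in> W" for f g
    proof -
      have "K (\<lambda>x. f x + g x) = (\<lambda>x. K f x + K g x)"
        using K_add[OF L2W[OF that(1)] L2W[OF that(2)]] by auto
      then show ?thesis
        using that L2W[OF that(1)] L2W[OF that(2)]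
        by (simp add: W_def orth_add K_add K_L2 distrib_left)
    qed
    show "(\<lambda>x. c * f x) \<in> W" if "f \<in> W" for f c
      using that by (simp add: W_def orth_scale K_scale[abs_def])
  qed
  then have sub: "L2_subspace M W"
    using L2W W0 by (auto simp: L2_subspace_def)
  have inv: "(\<lambda>x. f (T j x)) \<in> W" if "f \<in> W" for f j
  proof -
    have m: "f \<in> borel_measurable borel"
      using L2_borel_measurable[OF L2W[OF that]] .
    have "K (\<lambda>x. f (T j x)) = (\<lambda>x. K f (T j x))"
      using K_T[OF m] by auto
    then have "K (K (\<lambda>x. f (T j x))) x = K (K f) (T j x)" for x
      using K_T[OF K_borel[OF m]] by simp
    then show ?thesis
      using that orth_T[of f j] by (simp add: W_def)
  qed
  \<comment> \<open>The Hilbert-Schmidt bound: each \<open>e\<close> contributes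
    \<open>L2_sq M (K e) = \<rho>\<close>, while at each \<open>x\<close> Bessel's inequality for
    the section gives total at most 1.\<close>
  have card: "card E \<le> nat \<lceil>1 / \<rho>\<rceil>" if E: "orthonormal M E" "finite E" "E \<subseteq> W" for E
  proof -
    have "L2_sq M (K e) = \<rho>" if "e \<in> E" for e
    proof -
      have "K (K e) = (\<lambda>x. of_real \<rho> * e x)"
        using that E(3) by (auto simp: W_def)
      then have "complex_of_real (L2_sq M (K e)) = of_real \<rho> * L2_inner M e e"
        using that E(3) L2W by (subst K_sq_eq) (auto simp: L2_inner_scale_left)
      also have "L2_inner M e e = 1"
        using that E(1) by (simp add: orthonormal_def)
      finally show ?thesis by simp
    qed
    then have "real (card E) * \<rho> = (\<Sum>e\<in>E. L2_sq M (K e))"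
      by simp
    also have "\<dots> = (\<integral>x. (\<Sum>e\<in>E. (norm (K e x))\<^sup>2) \<partial>M)"
      unfolding L2_sq_def using E(3) L2W K_L2
      by (intro Bochner_Integration.integral_sum[symmetric]) (auto simp: L2_fun_def)
    also have "\<dots> \<le> (\<integral>x. 1 \<partial>M)"
    proof (rule integral_mono)
      show "integrable M (\<lambda>x. \<Sum>e\<in>E. (norm (K e x))\<^sup>2)"
        using E(3) L2W K_L2 by (intro Bochner_Integration.integrable_sum) (auto simp: L2_fun_def)
      fix x
      have "(\<Sum>e\<in>E. (norm (K e x))\<^sup>2) = (\<Sum>e\<in>E. (norm (L2_inner M (indicator {y. R x y}) e))\<^sup>2)"
        unfolding K_def by (intro sum.cong refl) (subst L2_inner_commute, simp)
      also have "\<dots> \<le> L2_sq M (indicator {y. R x y})"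
        by (rule bessel[OF E(1,2) L2_R])
      finally show "(\<Sum>e\<in>E. (norm (K e x))\<^sup>2) \<le> 1"
        using L2_sq_R order_trans by blast
    qed simp
    finally have "real (card E) * \<rho> \<le> 1"
      using prob_space by simp
    then have "real (card E) \<le> 1 / \<rho>"
      using \<rho> by (simp add: field_simps)
    then show ?thesis
      by linarith
  qed
  have "G \<in> W"
    using G by (simp add: W_def)
  from common_eigenvector[OF sub inv card this G(2)]
  obtain e w where e: "e \<in> W" "e \<noteq> (\<lambda>x. 0)" "\<And>j x. e (T j x) = w j * e x"
    by blast
  have "\<not> (AE x in M. e x = 0)"
    using W0[OF e(1)] e(2) by blast
  then have "eigenfunction M T e"
    using eigenfunctionI[OF L2W[OF e(1)] e(3)] by blast
  then have "L2_inner M e e = 0"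
    using e(1) by (simp add: W_def orth_def)
  then have "AE x in M. e x = 0"
    using L2_sq_eq_0_iff[OF L2W[OF e(1)]] by (simp add: L2_inner_self)
  then show False
    using W0[OF e(1)] e(2) by blast
qed

end

section \<open>Approximation of Lipschitz functions\<close>

lemma bounded_Fubini:
  fixes h :: "'a \<Rightarrow> 'b \<Rightarrow> real"
  assumes "prob_space A" "prob_space B"
    and m: "(\<lambda>p. h (fst p) (snd p)) \<in> borel_measurable (A \<Otimes>\<^sub>M B)" and C: "\<And>x y. \<bar>h x y\<bar> \<le> C"
  shows "(\<integral>x. \<integral>y. h x y \<partial>B \<partial>A) = (\<integral>y. \<integral>x. h x y \<partial>A \<partial>B)"
proof -
  interpret A: prob_space A by fact
  interpret B: prob_space B by fact
  interpret pair_prob_space A B ..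
  have "integrable (A \<Otimes>\<^sub>M B) (\<lambda>p. h (fst p) (snd p))"
    using m C by (intro P.integrable_const_bound[of _ C]) auto
  then show ?thesis
    using Fubini_integral[of h] by (simp add: case_prod_beta')
qed

context folner_tds
begin

text \<open>By commutativity, moving both starting points by \<open>g\<close> shifts the averaging
  window by \<open>g\<close>, which changes the averages by a null sequence.\<close>

lemma d_b_T: "d_b \<nu> F T (T g x) (T g y) = d_b \<nu> F T x y"
proof -
  obtain C where C: "\<And>x y :: 'x. dist x y \<le> C"
    using dist_bounded by blast
  let ?a = "\<lambda>n. \<integral>j. dist (T j x) (T j y) \<partial>P n"
  let ?b = "\<lambda>n. \<integral>j. dist (T (g + j) x) (T (g + j) y) \<partial>P n"
  have "(\<lambda>n. ?b n - ?a n) \<longlonglongrightarrow> 0"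
    using C by (intro folner_shift[of "\<lambda>j. dist (T j x) (T j y)" C]) auto
  then have "(\<lambda>n. ereal (?b n - ?a n)) \<longlonglongrightarrow> 0"
    by (simp add: zero_ereal_def)
  from ereal_limsup_lim_add[OF this, of "\<lambda>n. ereal (?a n)"]
  have "limsup (\<lambda>n. ereal (?b n)) = limsup (\<lambda>n. ereal (?a n))"
    by simp
  then show ?thesis
    by (simp add: d_b_eq add.commute[of g] action(3))
qed

lemma d_b_invariant_relation: "invariant_relation \<nu> F M T (\<lambda>x y. d_b \<nu> F T x y \<le> ereal \<epsilon>)"
proof
  show "Measurable.pred (borel \<Otimes>\<^sub>M borel) (\<lambda>p. d_b \<nu> F T (fst p) (snd p) \<le> ereal \<epsilon>)"
    unfolding d_b_eq by measurable
  show "d_b \<nu> F T x y \<le> ereal \<epsilon> \<longleftrightarrow> d_b \<nu> F T y x \<le> ereal \<epsilon>" for x y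
    by (simp add: d_b_eq dist_commute)
qed (simp add: d_b_T)

end

context invariant_relation
begin

definition deg :: "'x \<Rightarrow> real" where
  "deg x = measure M {y. R x y}"

text \<open>The product measure of the relation, which ergodicity makes the measure of almost every
  section (\<open>AE_deg\<close>).\<close>

definition mass :: real where
  "mass = (\<integral>x. deg x \<partial>M)"

lemma deg_eq: "deg x = (\<integral>y. indicator {y. R x y} y \<partial>M)"
  by (simp add: deg_def)

lemma deg_of_real: "complex_of_real (deg x) = K (\<lambda>_. 1) x"
proof -
  have "K (\<lambda>_. 1) x = (\<integral>y. complex_of_real (indicator {y. R x y} y) \<partial>M)"
    unfolding K_eq by (intro Bochner_Integration.integral_cong) auto
  then show ?thesis
    by (simp add: deg_def)
qed

lemma deg_measurable[measurable]: "deg \<in> borel_measurable borel"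
proof -
  have "(\<lambda>x. norm (K (\<lambda>_. 1) x)) \<in> borel_measurable borel"
    using K_borel[of "\<lambda>_. 1"] by measurable
  then show ?thesis
    by (simp add: deg_of_real[symmetric] deg_def[abs_def])
qed

lemma deg_bounds: "0 \<le> deg x" "deg x \<le> 1"
  by (auto simp: deg_def)

lemma deg_integrable: "integrable M deg"
  using deg_bounds by (intro integrable_const_bound[of _ 1]) auto

lemma AE_deg: "AE x in M. deg x = mass"
  unfolding mass_def
proof (rule invariant_imp_const_real[OF deg_integrable])
  fix j
  have "complex_of_real (deg (T j x)) = complex_of_real (deg x)" for x
    using K_T[of "\<lambda>_. 1" j x] by (simp add: deg_of_real)
  then show "AE x in M. deg (T j x) = deg x" by simp
qed

text \<open>The relation contains the square of \<open>A\<close>.\<close>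

lemma mass_pos:
  assumes "A \<in> sets M" "measure M A > 0" "\<And>x y. x \<in> A \<Longrightarrow> y \<in> A \<Longrightarrow> R x y"
  shows "mass > 0"
proof -
  have "0 < measure M A * measure M A"
    using assms(2) by simp
  also have "\<dots> = (\<integral>x. indicator A x * measure M A \<partial>M)"
    using assms(1) by simp
  also have "\<dots> \<le> mass"
    unfolding mass_def
  proof (rule integral_mono[OF _ deg_integrable])
    show "integrable M (\<lambda>x. indicator A x * measure M A)"
      using assms(1) by (auto simp: emeasure_eq_measure)
    show "indicator A x * measure M A \<le> deg x" for x
    proof (cases "x \<in> A")
      case True
      then show ?thesis
        unfolding deg_def using assms(3) by (auto intro!: finite_measure_mono)
    qed (simp add: deg_bounds)
  qed
  finally show ?thesis .
qed

text \<open>Invariance of the relation lets us replace the metric by its averages along the orbit before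
  integrating over the relation, and there these averages are asymptotically at most \<open>\<epsilon>\<close>.\<close>

lemma dist_integral_le:
  assumes R: "\<And>x y. R x y \<Longrightarrow> d_b \<nu> F T x y \<le> ereal \<epsilon>" and \<epsilon>: "\<epsilon> > 0"
  shows "(\<integral>x. \<integral>y. of_bool (R x y) * dist x y \<partial>M \<partial>M) \<le> \<epsilon> * mass"
proof -
  obtain D where D: "D > 0" "\<And>x y :: 'x. dist x y \<le> D"
    using dist_bounded by blast
  define a where "a n x y = (\<integral>j. dist (T j x) (T j y) \<partial>P n)" for n x y
  have [measurable (raw)]: "(\<lambda>z. a n (f z) (g z)) \<in> borel_measurable N"
    if [measurable]: "f \<in> N \<rightarrow>\<^sub>M borel" "g \<in> N \<rightarrow>\<^sub>M borel" for n f g and N :: "'z measure"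
    unfolding a_def by measurable
  have a_bd: "0 \<le> a n x y" "a n x y \<le> D" for n x y
  proof -
    show "0 \<le> a n x y"
      unfolding a_def by (intro integral_nonneg_AE) auto
    have "a n x y \<le> (\<integral>j. D \<partial>P n)"
      unfolding a_def using D by (intro integral_mono P.integrable_const_bound[of _ D]) auto
    then show "a n x y \<le> D"
      using P.prob_space[of n] by simp
  qed
  let ?I = "\<integral>x. \<integral>y. of_bool (R x y) * dist x y \<partial>M \<partial>M"
  have inner_bd: "\<bar>\<integral>y. of_bool (R x y) * dist (T j x) (T j y) \<partial>M\<bar> \<le> D" for x j
  proof -
    have "norm (\<integral>y. of_bool (R x y) * dist (T j x) (T j y) \<partial>M) \<le> (\<integral>y. D \<partial>M)"
      using D by (intro norm_integral_le integrable_const_bound[of _ D]) auto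
    then show ?thesis using prob_space by simp
  qed
  \<comment> \<open>Substitute \<open>T j\<close> in both variables; the relation stays the same by
    \<open>R_T\<close> and only the metric is moved along the orbits.\<close>
  have shift: "?I = (\<integral>x. \<integral>y. of_bool (R x y) * dist (T j x) (T j y) \<partial>M \<partial>M)" for j
  proof -
    have "?I = (\<integral>x. \<integral>y. of_bool (R (T j x) y) * dist (T j x) y \<partial>M \<partial>M)"
      by (rule integral_T[symmetric]) measurable
    also have "\<dots> = (\<integral>x. \<integral>y. of_bool (R (T j x) (T j y)) * dist (T j x) (T j y) \<partial>M \<partial>M)"
      by (intro Bochner_Integration.integral_cong refl integral_T[symmetric]) measurable
    finally show ?thesis by (simp add: R_T)
  qed
  have avg: "?I = (\<integral>x. \<integral>y. of_bool (R x y) * a n x y \<partial>M \<partial>M)" for n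
  proof -
    have "?I = (\<integral>j. ?I \<partial>P n)"
      using P.prob_space[of n] by simp
    also have "\<dots> = (\<integral>j. \<integral>x. \<integral>y. of_bool (R x y) * dist (T j x) (T j y) \<partial>M \<partial>M \<partial>P n)"
      using shift by simp
    also have "\<dots> = (\<integral>x. \<integral>j. \<integral>y. of_bool (R x y) * dist (T j x) (T j y) \<partial>M \<partial>P n \<partial>M)"
      using inner_bd by (intro bounded_Fubini P.prob_space_axioms prob_space_axioms) measurable
    also have "\<dots> = (\<integral>x. \<integral>y. \<integral>j. of_bool (R x y) * dist (T j x) (T j y) \<partial>P n \<partial>M \<partial>M)"
    proof (rule Bochner_Integration.integral_cong[OF refl])
      fix x
      show "(\<integral>j. \<integral>y. of_bool (R x y) * dist (T j x) (T j y) \<partial>M \<partial>P n) = (\<integral>y. \<integral>j. of_bool (R x y) * dist (T j x) (T j y) \<partial>P n \<partial>M)"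
        using D by (intro bounded_Fubini[where C=D] P.prob_space_axioms prob_space_axioms) auto
    qed
    finally show ?thesis by (simp add: a_def)
  qed
  \<comment> \<open>On the relation only the upper limit of \<open>a n x y\<close> is controlled.
    Taking the maximum with \<open>\<epsilon>\<close> produces a sequence that converges to
    \<open>\<epsilon>\<close> there, so dominated convergence applies.\<close>
  define b where "b n x y = of_bool (R x y) * max (a n x y) \<epsilon>" for n x y
  have b_bd: "0 \<le> b n x y" "b n x y \<le> D + \<epsilon>" for n x y
    using a_bd[of n x y] \<epsilon> D(1) by (auto simp: b_def)
  have [measurable]: "(\<lambda>y. b n x y) \<in> borel_measurable borel" for n x
    unfolding b_def by measurable
  have [measurable]: "(\<lambda>x. \<integral>y. b n x y \<partial>M) \<in> borel_measurable borel" for n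
    unfolding b_def by measurable
  have int_b: "integrable M (\<lambda>y. b n x y)" for n x
    using b_bd by (intro integrable_const_bound[of _ "D + \<epsilon>"]) auto
  have b_lim: "(\<lambda>n. b n x y) \<longlonglongrightarrow> of_bool (R x y) * \<epsilon>" for x y
  proof (cases "R x y")
    case True
    have "(\<lambda>n. max (a n x y) \<epsilon>) \<longlonglongrightarrow> \<epsilon>"
    proof (rule order_tendstoI)
      fix l assume "l < \<epsilon>"
      then show "\<forall>\<^sub>F n in sequentially. l < max (a n x y) \<epsilon>"
        by (auto intro!: always_eventually)
    next
      fix u assume "\<epsilon> < u"
      then have "d_b \<nu> F T x y < ereal u"
        using R[OF True] by (meson less_ereal.simps(1) order_le_less_trans)
      then have "\<forall>\<^sub>F n in sequentially. ereal (a n x y) < ereal u"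
        unfolding d_b_eq a_def by (rule Limsup_lessD)
      then show "\<forall>\<^sub>F n in sequentially. max (a n x y) \<epsilon> < u"
        by eventually_elim (use \<open>\<epsilon> < u\<close> in auto)
    qed
    then show ?thesis using True by (simp add: b_def)
  qed (simp add: b_def)
  have inner_lim: "(\<lambda>n. \<integral>y. b n x y \<partial>M) \<longlonglongrightarrow> \<epsilon> * deg x" for x
  proof -
    have "(\<lambda>n. \<integral>y. b n x y \<partial>M) \<longlonglongrightarrow> (\<integral>y. of_bool (R x y) * \<epsilon> \<partial>M)"
      using b_bd by (intro integral_dominated_convergence[where w="\<lambda>_. D + \<epsilon>"] AE_I2 b_lim) auto
    also have "(\<integral>y. of_bool (R x y) * \<epsilon> \<partial>M) = (\<integral>y. \<epsilon> * indicator {y. R x y} y \<partial>M)"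
      by (intro Bochner_Integration.integral_cong) auto
    also have "\<dots> = \<epsilon> * deg x"
      unfolding deg_eq by simp
    finally show ?thesis .
  qed
  have b_int_bd: "norm (\<integral>y. b n x y \<partial>M) \<le> D + \<epsilon>" for n x
  proof -
    have "norm (\<integral>y. b n x y \<partial>M) \<le> (\<integral>y. D + \<epsilon> \<partial>M)"
      using b_bd by (intro norm_integral_le int_b) auto
    then show ?thesis using prob_space by simp
  qed
  have "(\<lambda>n. \<integral>x. \<integral>y. b n x y \<partial>M \<partial>M) \<longlonglongrightarrow> (\<integral>x. \<epsilon> * deg x \<partial>M)"
    using b_int_bd by (intro integral_dominated_convergence[where w="\<lambda>_. D + \<epsilon>"] AE_I2 inner_lim) auto
  moreover have "?I \<le> (\<integral>x. \<integral>y. b n x y \<partial>M \<partial>M)" for n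
  proof -
    have 1: "integrable M (\<lambda>y. of_bool (R x y) * a n x y)" for x
      using a_bd D(1) by (intro integrable_const_bound[of _ D]) auto
    have 2: "norm (\<integral>y. of_bool (R x y) * a n x y \<partial>M) \<le> D" for x
    proof -
      have "norm (\<integral>y. of_bool (R x y) * a n x y \<partial>M) \<le> (\<integral>y. D \<partial>M)"
        using a_bd D(1) by (intro norm_integral_le 1) auto
      then show ?thesis using prob_space by simp
    qed
    show ?thesis
      unfolding avg[of n]
    proof (rule integral_mono)
      show "integrable M (\<lambda>x. \<integral>y. of_bool (R x y) * a n x y \<partial>M)"
        using 2 by (intro integrable_const_bound[of _ D]) auto
      show "integrable M (\<lambda>x. \<integral>y. b n x y \<partial>M)"
        using b_int_bd by (intro integrable_const_bound[of _ "D + \<epsilon>"]) auto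
      show "(\<integral>y. of_bool (R x y) * a n x y \<partial>M) \<le> (\<integral>y. b n x y \<partial>M)" for x
        by (intro integral_mono 1 int_b) (auto simp: b_def)
    qed
  qed
  ultimately have "?I \<le> (\<integral>x. \<epsilon> * deg x \<partial>M)"
    by (intro LIMSEQ_le_const) auto
  then show ?thesis by (simp add: mass_def)
qed

text \<open>For almost every \<open>x\<close>, \<open>mass\<close> times the error at
  \<open>x\<close> is the integral of \<open>f x - f y\<close> over the section, at most
  \<open>L\<close> times the integral of the distance. One factor of the squared error is bounded by
  \<open>2 * C\<close>, so only the first moment of the distance enters. By
  \<open>dist_integral_le\<close> that moment is at most \<open>\<epsilon> * mass\<close>, which
  cancels the normalization.\<close>

lemma K_approximates_Lipschitz:
  fixes f :: "'x \<Rightarrow> complex"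
  assumes R: "\<And>x y. R x y \<Longrightarrow> d_b \<nu> F T x y \<le> ereal \<epsilon>" and \<epsilon>: "\<epsilon> > 0" and mass: "mass > 0"
    and f[measurable]: "f \<in> borel_measurable borel" and C: "\<And>x. norm (f x) \<le> C"
    and L: "\<And>x y. norm (f x - f y) \<le> L * dist x y" "L \<ge> 0"
  shows "L2_sq M (\<lambda>x. f x - K f x / of_real mass) \<le> 2 * C * L * \<epsilon>"
proof -
  obtain D where D: "D > 0" "\<And>x y :: 'x. dist x y \<le> D"
    using dist_bounded by blast
  let ?h = "\<lambda>x. \<integral>y. of_bool (R x y) * dist x y \<partial>M"
  let ?u = "\<lambda>x. f x - K f x / of_real mass"
  note [measurable] = K_borel[OF f]
  have C0: "C \<ge> 0" using C norm_ge_zero order_trans by blast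
  have int_f: "integrable M (\<lambda>y. if R x y then f y else 0)" for x
    using C C0 by (intro integrable_const_bound[of _ C]) auto
  have int_d: "integrable M (\<lambda>y. of_bool (R x y) * dist x y)" for x
    using D by (intro integrable_const_bound[of _ D]) auto
  have h0: "?h x \<ge> 0" for x
    by (intro integral_nonneg_AE) auto
  have h_le: "?h x \<le> D" for x
  proof -
    have "?h x \<le> (\<integral>y. D \<partial>M)"
      using D by (intro integral_mono int_d) auto
    then show ?thesis using prob_space by simp
  qed
  have int_h: "integrable M ?h"
    using h0 h_le by (intro integrable_const_bound[of _ D]) auto
  have Kn: "norm (K f x) \<le> C * deg x" for x
  proof -
    have "norm (K f x) \<le> (\<integral>y. C * indicator {y. R x y} y \<partial>M)"
      unfolding K_eq using C C0 by (intro norm_integral_le int_f) (auto simp: emeasure_eq_measure)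
    then show ?thesis by (simp add: deg_def)
  qed
  have bound: "AE x in M. (norm (?u x))\<^sup>2 \<le> 2 * C * (L / mass) * ?h x"
    using AE_deg
  proof eventually_elim
    case (elim x)
    have "norm (?u x) \<le> norm (f x) + norm (K f x / of_real mass)"
      by (rule norm_triangle_ineq4)
    also have "\<dots> \<le> C + C"
    proof (rule add_mono[OF C])
      show "norm (K f x / of_real mass) \<le> C"
        using Kn[of x] mass elim by (simp add: norm_divide divide_le_eq)
    qed
    finally have 1: "norm (?u x) \<le> 2 * C" by simp
    have "of_real mass * ?u x = of_real (deg x) * f x - K f x"
      using mass elim by (simp add: field_simps)
    also have "of_real (deg x) * f x = (\<integral>y. (if R x y then f x else 0) \<partial>M)"
    proof -
      have "(\<integral>y. (if R x y then f x else 0) \<partial>M) = (\<integral>y. indicator {y. R x y} y *\<^sub>R f x \<partial>M)"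
        by (intro Bochner_Integration.integral_cong) auto
      then show ?thesis by (simp add: deg_def scaleR_conv_of_real emeasure_eq_measure)
    qed
    also have "\<dots> - K f x = (\<integral>y. (if R x y then f x else 0) - (if R x y then f y else 0) \<partial>M)"
      unfolding K_eq using C C0
      by (intro Bochner_Integration.integral_diff[symmetric] int_f integrable_const_bound[of _ C]) auto
    finally have "norm (of_real mass * ?u x) \<le> (\<integral>y. L * (of_bool (R x y) * dist x y) \<partial>M)"
    proof (simp only:, intro norm_integral_le)
      show "integrable M (\<lambda>y. (if R x y then f x else 0) - (if R x y then f y else 0))"
        using C C0 by (intro Bochner_Integration.integrable_diff int_f integrable_const_bound[of _ C]) auto
      show "integrable M (\<lambda>y. L * (of_bool (R x y) * dist x y))"
        using int_d by simp
      show "norm ((if R x y then f x else 0) - (if R x y then f y else 0)) \<le> L * (of_bool (R x y) * dist x y)" for y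
        using L by simp
    qed
    then have "norm (?u x) * mass \<le> L * ?h x"
      by (simp only: norm_mult norm_of_real abs_of_pos[OF mass] integral_mult_right_zero mult.commute)
    then have 2: "norm (?u x) \<le> (L / mass) * ?h x"
      by (simp only: pos_le_divide_eq[OF mass] times_divide_eq_left)
    have "(norm (?u x))\<^sup>2 \<le> (2 * C) * ((L / mass) * ?h x)"
      unfolding power2_eq_square using 1 2 by (intro mult_mono) (use C0 in auto)
    then show ?case by (simp add: mult.assoc)
  qed
  have int_u: "integrable M (\<lambda>x. (norm (?u x))\<^sup>2)"
  proof (rule Bochner_Integration.integrable_bound)
    show "integrable M (\<lambda>x. 2 * C * (L / mass) * ?h x)"
      using int_h by simp
    show "AE x in M. norm ((norm (?u x))\<^sup>2) \<le> norm (2 * C * (L / mass) * ?h x)"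
      using bound
    proof eventually_elim
      case (elim x)
      then show ?case
        unfolding real_norm_def abs_of_nonneg[OF zero_le_power2] by (rule order_trans[OF _ abs_ge_self])
    qed
  qed measurable
  have "L2_sq M ?u \<le> (\<integral>x. 2 * C * (L / mass) * ?h x \<partial>M)"
    unfolding L2_sq_def using int_u int_h bound by (intro integral_mono_AE) auto
  also have "\<dots> = 2 * C * (L / mass) * (\<integral>x. ?h x \<partial>M)"
    by simp
  also have "\<dots> \<le> 2 * C * (L / mass) * (\<epsilon> * mass)"
    using C0 L(2) mass by (intro mult_left_mono dist_integral_le[OF R \<epsilon>]) auto
  also have "\<dots> = 2 * C * L * \<epsilon>"
    using mass by simp
  finally show ?thesis .
qed

end

section \<open>Bases of eigenfunctions\<close>

context folner_tds
begin

definition is_character :: "('g \<Rightarrow> complex) \<Rightarrow> bool" where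
  "is_character w \<longleftrightarrow> continuous_on UNIV w \<and> (\<forall>j. norm (w j) = 1) \<and> (\<forall>i j. w (i + j) = w i * w j)"

definition unit_eigenfunction :: "('g \<Rightarrow> complex) \<Rightarrow> ('x \<Rightarrow> complex) \<Rightarrow> bool" where
  "unit_eigenfunction w e \<longleftrightarrow> is_character w \<and> L2_fun M e \<and> L2_sq M e = 1 \<and> (\<forall>j. AE x in M. e (T j x) = w j * e x)"

text \<open>One normalized eigenfunction per character that has any. Different characters give
  orthogonal functions, and ergodicity makes each eigenspace one-dimensional up to null sets, so
  nothing is lost by choosing one.\<close>

definition eigenbasis :: "('x \<Rightarrow> complex) set" where
  "eigenbasis = {SOME e. unit_eigenfunction w e | w. \<exists>e. unit_eigenfunction w e}"

lemma eigenbasisE: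
  assumes "b \<in> eigenbasis"
  obtains w where "unit_eigenfunction w b" "b = (SOME e. unit_eigenfunction w e)"
proof -
  from assms obtain w where w: "b = (SOME e. unit_eigenfunction w e)" "\<exists>e. unit_eigenfunction w e"
    by (auto simp: eigenbasis_def)
  show ?thesis
    using that[of w] someI_ex[OF w(2)] w(1) by simp
qed

lemma eigenbasis_L2:
  assumes "b \<in> eigenbasis"
  shows "L2_fun M b"
proof -
  obtain w where "unit_eigenfunction w b"
    using eigenbasisE[OF assms] .
  then show ?thesis by (simp add: unit_eigenfunction_def)
qed

lemma unit_eigenfunction_eigenfunction:
  assumes "unit_eigenfunction w e"
  shows "eigenfunction M T e"
proof -
  have "\<not> (AE x in M. e x = 0)"
    using assms L2_sq_eq_0_iff[of M e] by (auto simp: unit_eigenfunction_def)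
  then show ?thesis
    using assms unfolding eigenfunction_def unit_eigenfunction_def is_character_def by blast
qed

lemma eigenbasis_eigenfunction: "b \<in> eigenbasis \<Longrightarrow> eigenfunction M T b"
  by (erule eigenbasisE) (rule unit_eigenfunction_eigenfunction)

lemma eigenfunction_unit:
  assumes "eigenfunction M T e"
  obtains w c where "unit_eigenfunction w (\<lambda>x. c * e x)" "\<And>j. AE x in M. e (T j x) = w j * e x"
proof -
  have L2e: "L2_fun M e" and nz: "\<not> (AE x in M. e x = 0)"
    using assms by (auto simp: eigenfunction_def)
  obtain w where w: "is_character w" "\<And>j. AE x in M. e (T j x) = w j * e x"
    using assms unfolding eigenfunction_def is_character_def by blast
  obtain c where c: "L2_sq M (\<lambda>x. c * e x) = 1"
    using L2_normalize[of M e] nz L2_sq_eq_0_iff[OF L2e] by blast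
  have "AE x in M. c * e (T j x) = w j * (c * e x)" for j
    using w(2)[of j] by eventually_elim simp
  then have "unit_eigenfunction w (\<lambda>x. c * e x)"
    using c w(1) L2_scale[OF L2e] by (simp add: unit_eigenfunction_def)
  then show ?thesis
    using w(2) by (intro that)
qed

text \<open>Translating both arguments preserves the inner product but multiplies it by
  \<open>w j * cnj (v j)\<close>, which differs from 1 for some \<open>j\<close>.\<close>

lemma unit_eigenfunction_orthogonal:
  assumes e: "unit_eigenfunction w e" and d: "unit_eigenfunction v d" and "w \<noteq> v"
  shows "L2_inner M e d = 0"
proof -
  obtain j where j: "w j \<noteq> v j" using \<open>w \<noteq> v\<close> by auto
  have [measurable]: "e \<in> borel_measurable borel" "d \<in> borel_measurable borel"
    using e d by (auto intro: L2_borel_measurable simp: unit_eigenfunction_def)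
  have "L2_inner M e d = (\<integral>x. e (T j x) * cnj (d (T j x)) \<partial>M)"
    unfolding L2_inner_def by (rule integral_T[symmetric]) measurable
  also have "\<dots> = (\<integral>x. (w j * cnj (v j)) * (e x * cnj (d x)) \<partial>M)"
  proof (rule integral_cong_AE)
    have "AE x in M. e (T j x) = w j * e x" "AE x in M. d (T j x) = v j * d x"
      using e d by (auto simp: unit_eigenfunction_def)
    then show "AE x in M. e (T j x) * cnj (d (T j x)) = (w j * cnj (v j)) * (e x * cnj (d x))"
      by eventually_elim simp
  qed measurable
  also have "\<dots> = w j * cnj (v j) * L2_inner M e d"
    by (simp add: L2_inner_def)
  finally have "(1 - w j * cnj (v j)) * L2_inner M e d = 0"
    by (simp add: left_diff_distrib)
  moreover have "w j * cnj (v j) \<noteq> 1"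
  proof
    assume 1: "w j * cnj (v j) = 1"
    have "cnj (v j) * v j = 1"
      using d complex_norm_square[of "v j"] by (simp add: unit_eigenfunction_def is_character_def mult.commute)
    then have "w j = (w j * cnj (v j)) * v j"
      by (simp add: mult.assoc)
    with 1 j show False by simp
  qed
  ultimately show ?thesis by simp
qed

text \<open>The product of an eigenfunction for \<open>w\<close> with \<open>cnj b\<close> is
  invariant, hence constant by ergodicity. Applied to \<open>b\<close> itself this gives modulus 1
  almost everywhere, so multiplying the constant by \<open>b\<close> recovers
  \<open>e\<close>.\<close>

lemma unit_eigenfunction_unique:
  assumes e: "L2_fun M e" "\<And>j. AE x in M. e (T j x) = w j * e x" and b: "unit_eigenfunction w b"
  shows "\<exists>c. AE x in M. e x = c * b x"
proof -
  have b': "L2_fun M b" "\<And>j. AE x in M. b (T j x) = w j * b x"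
    using b by (auto simp: unit_eigenfunction_def)
  have w1: "w j * cnj (w j) = 1" for j
    using b complex_norm_square[of "w j"] by (simp add: unit_eigenfunction_def is_character_def)
  have const: "AE x in M. f x * cnj (b x) = L2_inner M f b"
    if f: "L2_fun M f" "\<And>j. AE x in M. f (T j x) = w j * f x" for f
    unfolding L2_inner_def
  proof (rule invariant_imp_const)
    show "integrable M (\<lambda>x. f x * cnj (b x))"
      using f(1) b'(1) by (rule L2_mult_integrable)
    fix j
    show "AE x in M. f (T j x) * cnj (b (T j x)) = f x * cnj (b x)"
      using f(2)[of j] b'(2)[of j]
    proof eventually_elim
      case (elim x)
      have "f (T j x) * cnj (b (T j x)) = (w j * cnj (w j)) * (f x * cnj (b x))"
        using elim by simp
      then show ?case by (simp add: w1)
    qed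
  qed
  have "AE x in M. b x * cnj (b x) = 1"
    using const[OF b'] b by (simp add: L2_inner_self unit_eigenfunction_def)
  with const[OF e] have "AE x in M. e x = L2_inner M e b * b x"
  proof eventually_elim
    case (elim x)
    have "e x = e x * (b x * cnj (b x))" using elim by simp
    also have "\<dots> = (e x * cnj (b x)) * b x" by (simp add: ac_simps)
    finally show ?case using elim by simp
  qed
  then show ?thesis by blast
qed

lemma eigenbasis_orthonormal: "orthonormal M eigenbasis"
  unfolding orthonormal_def
proof (intro conjI ballI)
  fix b c assume bc: "b \<in> eigenbasis" "c \<in> eigenbasis"
  obtain w where w: "unit_eigenfunction w b" "b = (SOME e. unit_eigenfunction w e)"
    using eigenbasisE[OF bc(1)] .
  obtain v where v: "unit_eigenfunction v c" "c = (SOME e. unit_eigenfunction v e)"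
    using eigenbasisE[OF bc(2)] .
  have bb: "L2_inner M b b = 1"
    using w(1) by (simp add: L2_inner_self unit_eigenfunction_def)
  show "L2_inner M b c = (if b = c then 1 else 0)"
  proof (cases "w = v")
    case True
    then show ?thesis using w v bb by simp
  next
    case False
    from unit_eigenfunction_orthogonal[OF w(1) v(1) False] show ?thesis
      using bb by auto
  qed
qed (rule eigenbasis_L2)

lemma eigenfunction_eigenbasis:
  assumes "eigenfunction M T e"
  shows "\<exists>b\<in>eigenbasis. \<exists>c. AE x in M. e x = c * b x"
proof -
  obtain w s where w: "unit_eigenfunction w (\<lambda>x. s * e x)" "\<And>j. AE x in M. e (T j x) = w j * e x"
    using eigenfunction_unit[OF assms] by blast
  define b where "b = (SOME e. unit_eigenfunction w e)"
  have "unit_eigenfunction w b"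
    unfolding b_def by (rule someI[of "unit_eigenfunction w", OF w(1)])
  moreover have "b \<in> eigenbasis"
    unfolding eigenbasis_def b_def using w(1) by blast
  ultimately show ?thesis
    using unit_eigenfunction_unique[OF eigenfunction_L2[OF assms] w(2)] by blast
qed

lemma orth_eigenbasisI:
  assumes f: "L2_fun M f" and "\<And>b. b \<in> eigenbasis \<Longrightarrow> L2_inner M f b = 0"
  shows "orth f"
  unfolding orth_def
proof (intro conjI allI impI f)
  fix e assume e: "eigenfunction M T e"
  then obtain b c where b: "b \<in> eigenbasis" "AE x in M. e x = c * b x"
    using eigenfunction_eigenbasis by blast
  have [measurable]: "f \<in> borel_measurable borel" "b \<in> borel_measurable borel" "e \<in> borel_measurable borel"
    using f e eigenbasis_L2[OF b(1)] by (auto intro: L2_borel_measurable eigenfunction_L2)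
  have "L2_inner M f e = L2_inner M f (\<lambda>x. c * b x)"
    unfolding L2_inner_def
  proof (rule integral_cong_AE)
    show "AE x in M. f x * cnj (e x) = f x * cnj (c * b x)"
      using b(2) by eventually_elim (simp only:)
  qed measurable
  then show "L2_inner M f e = 0"
    using assms(2)[OF b(1)] by (simp add: L2_inner_scale_right)
qed

text \<open>Membership in the closed linear span of the eigenbasis.\<close>

definition approximable :: "('x \<Rightarrow> complex) \<Rightarrow> bool" where
  "approximable f \<longleftrightarrow> L2_fun M f \<and>
     (\<forall>\<delta>>0. \<exists>S a. finite S \<and> S \<subseteq> eigenbasis \<and> L2_sq M (\<lambda>x. f x - (\<Sum>b\<in>S. a b * b x)) < \<delta>)"

lemma approximable_limit:
  assumes f: "L2_fun M f" and g: "\<And>\<delta>. \<delta> > 0 \<Longrightarrow> \<exists>g. approximable g \<and> L2_sq M (\<lambda>x. f x - g x) < \<delta>"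
  shows "approximable f"
  unfolding approximable_def
proof (intro conjI allI impI f)
  fix \<delta> :: real assume "\<delta> > 0"
  \<comment> \<open>Splitting a square costs a factor 2 on each part, hence two errors below
    \<open>\<delta>/4\<close>.\<close>
  then obtain g where g: "approximable g" "L2_sq M (\<lambda>x. f x - g x) < \<delta>/4"
    using g[of "\<delta>/4"] by auto
  then obtain S a where S: "finite S" "S \<subseteq> eigenbasis" "L2_sq M (\<lambda>x. g x - (\<Sum>b\<in>S. a b * b x)) < \<delta>/4"
    using \<open>\<delta> > 0\<close> unfolding approximable_def by (meson divide_pos_pos zero_less_numeral)
  have "L2_fun M (\<lambda>x. \<Sum>b\<in>S. a b * b x)"
    using S(2) by (intro L2_sum L2_scale eigenbasis_L2) auto
  then have "L2_sq M (\<lambda>x. (f x - g x) + (g x - (\<Sum>b\<in>S. a b * b x))) \<le>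
     2 * L2_sq M (\<lambda>x. f x - g x) + 2 * L2_sq M (\<lambda>x. g x - (\<Sum>b\<in>S. a b * b x))"
    using g(1) f by (intro L2_sq_add_le L2_diff) (auto simp: approximable_def)
  also have "\<dots> < \<delta>"
    using g(2) S(3) by simp
  finally have "L2_sq M (\<lambda>x. f x - (\<Sum>b\<in>S. a b * b x)) < \<delta>"
    by simp
  then show "\<exists>S a. finite S \<and> S \<subseteq> eigenbasis \<and> L2_sq M (\<lambda>x. f x - (\<Sum>b\<in>S. a b * b x)) < \<delta>"
    using S by blast
qed

lemma approximable_zero: "approximable (\<lambda>x. 0)"
  unfolding approximable_def by (auto intro!: exI[of _ "{}"] simp: L2_zero) (simp add: L2_sq_def)

lemma approximable_scale:
  assumes "approximable f"
  shows "approximable (\<lambda>x. c * f x)"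
  unfolding approximable_def
proof (intro conjI allI impI)
  show "L2_fun M (\<lambda>x. c * f x)"
    using assms by (auto simp: approximable_def intro: L2_scale)
  fix \<delta> :: real assume "\<delta> > 0"
  have "\<delta> / ((norm c)\<^sup>2 + 1) > 0"
    using \<open>\<delta> > 0\<close> by (intro divide_pos_pos add_nonneg_pos) auto
  then obtain S a where S: "finite S" "S \<subseteq> eigenbasis" "L2_sq M (\<lambda>x. f x - (\<Sum>b\<in>S. a b * b x)) < \<delta> / ((norm c)\<^sup>2 + 1)"
    using assms unfolding approximable_def by meson
  have "(\<lambda>x. c * f x - (\<Sum>b\<in>S. c * a b * b x)) = (\<lambda>x. c * (f x - (\<Sum>b\<in>S. a b * b x)))"
    by (simp add: right_diff_distrib sum_distrib_left mult.assoc)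
  then have "L2_sq M (\<lambda>x. c * f x - (\<Sum>b\<in>S. c * a b * b x)) = (norm c)\<^sup>2 * L2_sq M (\<lambda>x. f x - (\<Sum>b\<in>S. a b * b x))"
    by (simp only: L2_sq_scale)
  also have "\<dots> \<le> ((norm c)\<^sup>2 + 1) * L2_sq M (\<lambda>x. f x - (\<Sum>b\<in>S. a b * b x))"
    by (intro mult_right_mono) auto
  also have "\<dots> < \<delta>"
    using S(3) by (subst mult.commute, subst pos_less_divide_eq[symmetric]) (auto intro: add_nonneg_pos)
  finally show "\<exists>S a. finite S \<and> S \<subseteq> eigenbasis \<and> L2_sq M (\<lambda>x. c * f x - (\<Sum>b\<in>S. a b * b x)) < \<delta>"
    using S by (intro exI[of _ S] exI[of _ "\<lambda>b. c * a b"]) auto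
qed

lemma approximable_add:
  assumes "approximable f" "approximable g"
  shows "approximable (\<lambda>x. f x + g x)"
  unfolding approximable_def
proof (intro conjI allI impI)
  have L2: "L2_fun M f" "L2_fun M g" using assms by (auto simp: approximable_def)
  then show "L2_fun M (\<lambda>x. f x + g x)" by (rule L2_add)
  fix \<delta> :: real assume "\<delta> > 0"
  then have "\<delta>/4 > 0" by simp
  obtain S a where S: "finite S" "S \<subseteq> eigenbasis" "L2_sq M (\<lambda>x. f x - (\<Sum>b\<in>S. a b * b x)) < \<delta>/4"
    using assms(1) \<open>\<delta>/4 > 0\<close> unfolding approximable_def by meson
  obtain S' a' where S': "finite S'" "S' \<subseteq> eigenbasis" "L2_sq M (\<lambda>x. g x - (\<Sum>b\<in>S'. a' b * b x)) < \<delta>/4"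
    using assms(2) \<open>\<delta>/4 > 0\<close> unfolding approximable_def by meson
  define c where "c b = (if b \<in> S then a b else 0) + (if b \<in> S' then a' b else 0)" for b
  have "(\<Sum>b\<in>S \<union> S'. c b * b x) = (\<Sum>b\<in>S. a b * b x) + (\<Sum>b\<in>S'. a' b * b x)" for x
  proof -
    have "(\<Sum>b\<in>S \<union> S'. c b * b x) = (\<Sum>b\<in>S \<union> S'. (if b \<in> S then a b * b x else 0)) + (\<Sum>b\<in>S \<union> S'. (if b \<in> S' then a' b * b x else 0))"
      unfolding sum.distrib[symmetric] by (intro sum.cong) (auto simp: c_def distrib_right)
    moreover have "(\<Sum>b\<in>S \<union> S'. (if b \<in> S then a b * b x else 0)) = (\<Sum>b\<in>S. a b * b x)"
      using S(1) S'(1) by (intro sum.mono_neutral_cong_right) auto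
    moreover have "(\<Sum>b\<in>S \<union> S'. (if b \<in> S' then a' b * b x else 0)) = (\<Sum>b\<in>S'. a' b * b x)"
      using S(1) S'(1) by (intro sum.mono_neutral_cong_right) auto
    ultimately show ?thesis by simp
  qed
  then have "L2_sq M (\<lambda>x. f x + g x - (\<Sum>b\<in>S \<union> S'. c b * b x)) =
    L2_sq M (\<lambda>x. (f x - (\<Sum>b\<in>S. a b * b x)) + (g x - (\<Sum>b\<in>S'. a' b * b x)))"
    by (simp add: algebra_simps)
  also have "\<dots> \<le> 2 * L2_sq M (\<lambda>x. f x - (\<Sum>b\<in>S. a b * b x)) + 2 * L2_sq M (\<lambda>x. g x - (\<Sum>b\<in>S'. a' b * b x))"
  proof -
    have "L2_fun M (\<lambda>x. \<Sum>b\<in>S. a b * b x)"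
      using S(2) by (intro L2_sum L2_scale eigenbasis_L2) auto
    moreover have "L2_fun M (\<lambda>x. \<Sum>b\<in>S'. a' b * b x)"
      using S'(2) by (intro L2_sum L2_scale eigenbasis_L2) auto
    ultimately show ?thesis
      using L2 by (intro L2_sq_add_le L2_diff)
  qed
  also have "\<dots> < \<delta>"
    using S(3) S'(3) by simp
  finally show "\<exists>S a. finite S \<and> S \<subseteq> eigenbasis \<and> L2_sq M (\<lambda>x. f x + g x - (\<Sum>b\<in>S. a b * b x)) < \<delta>"
    using S S' by (intro exI[of _ "S \<union> S'"] exI[of _ c]) auto
qed

lemma approximable_sum:
  "(\<And>i. i \<in> I \<Longrightarrow> approximable (f i)) \<Longrightarrow> approximable (\<lambda>x. \<Sum>i\<in>I. f i x)"
  by (induction I rule: infinite_finite_induct) (auto intro: approximable_add approximable_zero)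

lemma approximable_dominated:
  assumes f: "L2_fun M f" and g: "L2_fun M g" and h: "\<And>n. approximable (h n)"
    and lim: "\<And>x. (\<lambda>n. h n x) \<longlonglongrightarrow> f x" and bound: "\<And>n x. norm (h n x) \<le> norm (g x)"
  shows "approximable f"
proof (rule approximable_limit[OF f])
  fix \<delta> :: real assume "\<delta> > 0"
  have L2h: "L2_fun M (h n)" for n using h by (simp add: approximable_def)
  have [measurable]: "f \<in> borel_measurable M" "h n \<in> borel_measurable M" for n
    using f L2h by (auto simp: L2_fun_def)
  have "(\<lambda>n. L2_sq M (\<lambda>x. f x - h n x)) \<longlonglongrightarrow> (\<integral>x. 0 \<partial>M)"
    unfolding L2_sq_def
  proof (rule integral_dominated_convergence[where w="\<lambda>x. 2 * (norm (f x))\<^sup>2 + 2 * (norm (g x))\<^sup>2"])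
    show "integrable M (\<lambda>x. 2 * (norm (f x))\<^sup>2 + 2 * (norm (g x))\<^sup>2)"
      using f g by (auto simp: L2_fun_def)
    have "(\<lambda>n. (norm (f x - h n x))\<^sup>2) \<longlonglongrightarrow> (norm (f x - f x))\<^sup>2" for x
      by (intro tendsto_intros lim)
    then show "AE x in M. (\<lambda>n. (norm (f x - h n x))\<^sup>2) \<longlonglongrightarrow> 0"
      by simp
    have "(norm (f x - h n x))\<^sup>2 \<le> 2 * (norm (f x))\<^sup>2 + 2 * (norm (g x))\<^sup>2" for n x
    proof -
      have "(norm (f x - h n x))\<^sup>2 \<le> 2 * (norm (f x))\<^sup>2 + 2 * (norm (h n x))\<^sup>2"
        using norm_add_squared_le[of "f x" "- h n x"] by simp
      moreover have "(norm (h n x))\<^sup>2 \<le> (norm (g x))\<^sup>2"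
        by (intro power_mono bound) simp
      ultimately show ?thesis by linarith
    qed
    then show "AE x in M. norm ((norm (f x - h n x))\<^sup>2) \<le> 2 * (norm (f x))\<^sup>2 + 2 * (norm (g x))\<^sup>2" for n
      by simp
  qed auto
  then have "\<forall>\<^sub>F n in sequentially. L2_sq M (\<lambda>x. f x - h n x) < \<delta>"
    using \<open>\<delta> > 0\<close> by (intro order_tendstoD(2)) auto
  then show "\<exists>g. approximable g \<and> L2_sq M (\<lambda>x. f x - g x) < \<delta>"
    using h eventually_happens by fastforce
qed

text \<open>It suffices to approximate Lipschitz functions: distance functions give indicators of closed sets,
  inner regularity gives Borel sets, and simple functions give everything.\<close>

lemma approximable_all:
  assumes Lip: "\<And>f C L. f \<in> borel_measurable borel \<Longrightarrow> (\<And>x. norm (f x) \<le> C) \<Longrightarrow>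
      (\<And>x y. norm (f x - f y) \<le> L * dist x y) \<Longrightarrow> L \<ge> 0 \<Longrightarrow> approximable f"
    and f: "L2_fun M f"
  shows "approximable f"
proof -
  have one: "L2_fun M (\<lambda>_. 1)"
    by (rule L2_bounded[of _ 1]) auto
  have closed: "approximable (indicator C)" if C: "closed C" "C \<noteq> {}" for C
  proof (rule approximable_dominated[OF _ one])
    show "L2_fun M (indicator C)"
      using C by (intro L2_indicator) simp
    \<comment> \<open>Equal to 1 on \<open>C\<close>, with Lipschitz constant \<open>n\<close>, and
      for \<open>n > 0\<close> zero at distance \<open>1/n\<close> or more; these functions decrease
      to the indicator because \<open>C\<close> is closed.\<close>
    define h where "h n x = complex_of_real (max 0 (1 - real n * infdist x C))" for n x
    have m: "(\<lambda>x. infdist x C) \<in> borel_measurable borel"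
      by (intro borel_measurable_continuous_onI continuous_intros)
    have h1: "norm (h n x) \<le> 1" for n x
      using infdist_nonneg[of x C] by (auto simp: h_def max_def)
    show "approximable (h n)" for n
    proof (rule Lip[of _ 1 "real n"])
      show "h n \<in> borel_measurable borel"
        unfolding h_def using m by measurable
      show "norm (h n x - h n y) \<le> real n * dist x y" for x y
      proof -
        have "norm (h n x - h n y) = \<bar>max 0 (1 - real n * infdist x C) - max 0 (1 - real n * infdist y C)\<bar>"
          unfolding h_def of_real_diff[symmetric] norm_of_real ..
        also have "\<dots> \<le> \<bar>real n * infdist x C - real n * infdist y C\<bar>"
          by linarith
        also have "\<dots> = real n * \<bar>infdist x C - infdist y C\<bar>"
          by (simp add: abs_mult flip: right_diff_distrib)
        also have "\<dots> \<le> real n * dist x y"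
          by (intro mult_left_mono infdist_triangle_abs) simp
        finally show ?thesis .
      qed
    qed (use h1 in auto)
    show "norm (h n x) \<le> norm (1::complex)" for n x
      using h1 by simp
    show "(\<lambda>n. h n x) \<longlonglongrightarrow> indicator C x" for x
    proof (cases "x \<in> C")
      case True
      then show ?thesis by (simp add: h_def)
    next
      case False
      then have "infdist x C > 0"
        using C in_closed_iff_infdist_zero[of C x] infdist_nonneg[of x C] by auto
      then obtain N :: nat where N: "1 < real N * infdist x C"
        using reals_Archimedean3 by blast
      have "h n x = 0" if "n \<ge> N" for n
      proof -
        have "real N * infdist x C \<le> real n * infdist x C"
          using that infdist_nonneg by (intro mult_right_mono) auto
        then show ?thesis using N by (simp add: h_def)
      qed
      then have "(\<lambda>n. h n x) \<longlonglongrightarrow> 0"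
        by (intro tendsto_eventually) (auto simp: eventually_sequentially)
      then show ?thesis using False by simp
    qed
  qed
  have borel: "approximable (indicator B)" if B: "B \<in> sets borel" for B
  proof (rule approximable_limit)
    show "L2_fun M (indicator B)"
      using B by (intro L2_indicator) simp
    fix \<delta> :: real assume "\<delta> > 0"
    then obtain K where K: "compact K" "K \<subseteq> B" "measure M K > measure M B - \<delta>"
      using inner_regular_measure[OF prob_space_axioms sets_M B] by blast
    have sK: "K \<in> sets borel" using K(1) by (simp add: borel_compact)
    have "L2_sq M (\<lambda>x. indicator B x - indicator K x) = L2_sq M (indicator (B - K))"
      unfolding L2_sq_def using K(2) by (intro Bochner_Integration.integral_cong) (auto split: split_indicator)
    also have "\<dots> = measure M B - measure M K"
      using B sK K(2) by (simp add: L2_sq_indicator finite_measure_Diff)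
    also have "\<dots> < \<delta>" using K(3) by simp
    finally have "L2_sq M (\<lambda>x. indicator B x - indicator K x) < \<delta>" .
    moreover have "approximable (indicator K)"
    proof (cases "K = {}")
      case True
      then have "indicator K = (\<lambda>x. 0 :: complex)" by auto
      then show ?thesis using approximable_zero by simp
    next
      case False
      then show ?thesis using closed K(1) compact_imp_closed by blast
    qed
    ultimately show "\<exists>g. approximable g \<and> L2_sq M (\<lambda>x. indicator B x - g x) < \<delta>"
      by blast
  qed
  have simp_fun: "approximable s" if s: "simple_function M s" for s
  proof -
    have eq: "s = (\<lambda>x. \<Sum>y\<in>range s. y * indicator (s -` {y}) x)"
    proof
      fix x
      have "s x = (\<Sum>y\<in>range s. indicator (s -` {y}) x *\<^sub>R y)"
        by (rule simple_function_indicator_representation_banach[OF s, of x, unfolded space_M Int_UNIV_right, OF UNIV_I])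
      also have "\<dots> = (\<Sum>y\<in>range s. y * indicator (s -` {y}) x)"
        by (intro sum.cong) (auto split: split_indicator)
      finally show "s x = (\<Sum>y\<in>range s. y * indicator (s -` {y}) x)" .
    qed
    have "s -` {y} \<in> sets borel" for y
      using simple_functionD(2)[OF s, of "{y}"] by simp
    then have "approximable (\<lambda>x. \<Sum>y\<in>range s. y * indicator (s -` {y}) x)"
      by (intro approximable_sum approximable_scale borel)
    then show ?thesis using eq by simp
  qed
  obtain s where s: "\<And>i. simple_function M (s i)" "\<And>x. (\<lambda>i. s i x) \<longlonglongrightarrow> f x"
    "\<And>i x. dist (s i x) 0 \<le> 2 * dist (f x) 0"
    using borel_measurable_implies_sequence_metric[OF L2_measurable[OF f], of 0] by auto
  show ?thesis
  proof (rule approximable_dominated[OF f L2_scale[OF f, of 2] simp_fun[OF s(1)] s(2)])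
    show "norm (s n x) \<le> norm (2 * f x)" for n x
      using s(3)[of n x] by (simp add: norm_mult)
  qed
qed

lemma approximable_imp_discrete_spectrum:
  assumes "\<And>f. L2_fun M f \<Longrightarrow> approximable f"
  shows "discrete_spectrum M T"
proof -
  have "L2_orthonormal_basis M eigenbasis"
    unfolding L2_orthonormal_basis_def
  proof (intro conjI ballI allI impI)
    show "L2_fun M b" if "b \<in> eigenbasis" for b
      using that by (rule eigenbasis_L2)
    show "(\<integral>x. b x * cnj (c x) \<partial>M) = (if b = c then 1 else 0)" if "b \<in> eigenbasis" "c \<in> eigenbasis" for b c
      using eigenbasis_orthonormal that unfolding orthonormal_def L2_inner_def by blast
    fix f and \<epsilon> :: real assume f: "L2_fun M f" and \<epsilon>: "\<epsilon> > 0"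
    then have "\<epsilon>\<^sup>2 > 0" by simp
    then obtain S a where S: "finite S" "S \<subseteq> eigenbasis" "L2_sq M (\<lambda>x. f x - (\<Sum>b\<in>S. a b * b x)) < \<epsilon>\<^sup>2"
      using assms[OF f] unfolding approximable_def by meson
    then have "sqrt (\<integral>x. (norm (f x - (\<Sum>b\<in>S. a b * b x)))\<^sup>2 \<partial>M) < \<epsilon>"
      using \<epsilon> unfolding L2_sq_def by (intro real_less_lsqrt) auto
    then show "\<exists>S a. finite S \<and> S \<subseteq> eigenbasis \<and> sqrt (\<integral>x. (norm (f x - (\<Sum>b\<in>S. a b * b x)))\<^sup>2 \<partial>M) < \<epsilon>"
      using S by blast
  qed
  then show ?thesis
    unfolding discrete_spectrum_def using eigenbasis_eigenfunction by blast
qed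

end

section \<open>From the failure of mean sensitivity to discrete spectrum\<close>

context invariant_relation
begin

text \<open>\<open>K b\<close> satisfies the equation for the same character, so one-dimensionality
  of the eigenspace applies. In particular \<open>K\<close> maps the span of the eigenbasis into
  itself up to null sets.\<close>

lemma K_unit_eigenfunction:
  assumes b: "unit_eigenfunction w b"
  shows "\<exists>c. AE x in M. K b x = c * b x"
proof -
  have b': "L2_fun M b" "\<And>j. AE x in M. b (T j x) = w j * b x"
    using b by (auto simp: unit_eigenfunction_def)
  show ?thesis
    using unit_eigenfunction_unique[OF K_L2[OF b'(1)] _ b] K_T_eigen[OF b'] by blast
qed

text \<open>Choose finite parts of the eigenbasis whose projections of \<open>f\<close> have almost maximal norm. By compactness
  the images of the residuals have a limit along a subsequence; it is orthogonal to all eigenfunctions and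
  hence vanishes. This avoids completeness of \<open>L\<^sup>2\<close>.\<close>

lemma K_approximable:
  assumes f: "L2_fun M f"
  shows "approximable (K f)"
  unfolding approximable_def
proof (intro conjI allI impI)
  show "L2_fun M (K f)" using f by (rule K_L2)
  define s where "s S = (\<Sum>b\<in>S. (norm (L2_inner M f b))\<^sup>2)" for S
  define \<F> where "\<F> = {S. finite S \<and> S \<subseteq> eigenbasis}"
  define \<sigma> where "\<sigma> = Sup (s ` \<F>)"
  have on: "orthonormal M S" if "S \<in> \<F>" for S
    using eigenbasis_orthonormal that unfolding orthonormal_def \<F>_def by blast
  have fin: "finite S" if "S \<in> \<F>" for S using that by (simp add: \<F>_def)
  have bdd: "bdd_above (s ` \<F>)"
    using bessel[OF on fin f] by (intro bdd_aboveI2[of _ _ "L2_sq M f"]) (simp add: s_def)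
  have s_le: "s S \<le> \<sigma>" if "S \<in> \<F>" for S
    unfolding \<sigma>_def using that bdd by (rule cSUP_upper)
  have "{} \<in> \<F>" by (simp add: \<F>_def)
  have "\<exists>S\<in>\<F>. \<sigma> - inverse (real (Suc n)) < s S" for n
  proof -
    have "\<sigma> - inverse (real (Suc n)) < (SUP S\<in>\<F>. s S)"
      by (simp add: \<sigma>_def)
    then show ?thesis
      using \<open>{} \<in> \<F>\<close> bdd by (subst (asm) less_cSUP_iff) auto
  qed
  then obtain S where S: "\<And>n. S n \<in> \<F>" and sS: "\<And>n. \<sigma> - inverse (real (Suc n)) < s (S n)"
    by metis
  define u where "u n = (\<lambda>x. f x - L2_proj M (S n) f x)" for n
  have L2u: "L2_fun M (u n)" for n
    unfolding u_def by (intro L2_diff f L2_proj_L2 on S)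
  have sq_u: "L2_sq M (u n) \<le> L2_sq M f" for n
  proof -
    have "L2_sq M (u n) = L2_sq M f - s (S n)"
      unfolding u_def s_def by (rule L2_sq_diff_proj[OF on fin f]) (rule S)+
    moreover have "0 \<le> s (S n)"
      unfolding s_def by (intro sum_nonneg) simp
    ultimately show ?thesis by simp
  qed
  have [measurable]: "K (u n) \<in> borel_measurable borel" for n
    by (intro K_borel L2_borel_measurable L2u)
  obtain r G where r: "strict_mono r" and "\<And>x. (\<lambda>n. K (u (r n)) x) \<longlonglongrightarrow> G x" and L2G: "L2_fun M G"
    and lim_inner: "\<And>g. L2_fun M g \<Longrightarrow> (\<lambda>n. L2_inner M (K (u (r n))) g) \<longlonglongrightarrow> L2_inner M G g"
    and lim_sq: "(\<lambda>n. L2_sq M (K (u (r n)))) \<longlonglongrightarrow> L2_sq M G"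
    by (rule K_compact[of u "L2_sq M f", OF L2u sq_u]) (rule that)
  have "orth G"
  proof (rule orth_eigenbasisI[OF L2G])
    fix b assume b: "b \<in> eigenbasis"
    obtain w where w: "unit_eigenfunction w b"
      using eigenbasisE[OF b] .
    obtain c where c: "AE x in M. K b x = c * b x"
      using K_unit_eigenfunction[OF w] by blast
    note L2b = eigenbasis_L2[OF b]
    note [measurable] = L2_borel_measurable[OF L2b] L2_borel_measurable[OF L2u]
    \<comment> \<open>For \<open>b\<close> in \<open>S n\<close> the residual is orthogonal to
      \<open>b\<close>. Otherwise adding \<open>b\<close> to \<open>S n\<close> would raise
      \<open>s\<close> by the squared coefficient of \<open>b\<close>, and \<open>s (S n)\<close> is
      within \<open>1/(n+1)\<close> of the supremum.\<close>
    have ub: "(norm (L2_inner M (u n) b))\<^sup>2 \<le> inverse (real (Suc n))" for n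
    proof -
      have eq: "L2_inner M (u n) b = L2_inner M f b - L2_inner M (L2_proj M (S n) f) b"
        unfolding u_def by (intro L2_inner_diff_left f L2_proj_L2 on S L2b)
      show ?thesis
      proof (cases "b \<in> S n")
        case True
        then show ?thesis
          unfolding eq L2_proj_inner[OF on[OF S] fin[OF S] True] by simp
      next
        case False
        have "L2_inner M (L2_proj M (S n) f) b = (\<Sum>e\<in>S n. L2_inner M f e * cnj (L2_inner M b e))"
          by (rule L2_inner_proj[OF on[OF S] fin[OF S] L2b])
        also have "\<dots> = 0"
        proof (intro sum.neutral ballI)
          fix e assume "e \<in> S n"
          then have "e \<in> eigenbasis" "e \<noteq> b" using S[of n] False by (auto simp: \<F>_def)
          then show "L2_inner M f e * cnj (L2_inner M b e) = 0"
            using eigenbasis_orthonormal b by (auto simp: orthonormal_def)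
        qed
        finally have "L2_inner M (u n) b = L2_inner M f b" using eq by simp
        moreover have "s (insert b (S n)) = (norm (L2_inner M f b))\<^sup>2 + s (S n)"
          unfolding s_def using False fin[OF S] by simp
        moreover have "s (insert b (S n)) \<le> \<sigma>"
          using S[of n] b by (intro s_le) (auto simp: \<F>_def)
        ultimately show ?thesis using sS[of n] by simp
      qed
    qed
    have "L2_inner M (K (u n)) b = cnj c * L2_inner M (u n) b" for n
    proof -
      have "L2_inner M (K (u n)) b = L2_inner M (u n) (K b)"
        by (rule K_adjoint[OF L2u L2b])
      also have "\<dots> = L2_inner M (u n) (\<lambda>x. c * b x)"
        unfolding L2_inner_def
      proof (rule integral_cong_AE)
        have [measurable]: "K b \<in> borel_measurable borel" by (rule K_borel) measurable
        show "(\<lambda>x. u n x * cnj (K b x)) \<in> borel_measurable M" "(\<lambda>x. u n x * cnj (c * b x)) \<in> borel_measurable M"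
          by measurable
        show "AE x in M. u n x * cnj (K b x) = u n x * cnj (c * b x)"
          using c by eventually_elim (simp only:)
      qed
      finally show ?thesis by (simp add: L2_inner_scale_right)
    qed
    moreover have "(\<lambda>n. L2_inner M (u n) b) \<longlonglongrightarrow> 0"
    proof (rule Lim_null_comparison)
      show "\<forall>\<^sub>F n in sequentially. norm (L2_inner M (u n) b) \<le> sqrt (inverse (real (Suc n)))"
        using ub by (intro always_eventually allI real_le_rsqrt)
      show "(\<lambda>n. sqrt (inverse (real (Suc n)))) \<longlonglongrightarrow> 0"
        using tendsto_real_sqrt[OF LIMSEQ_inverse_real_of_nat] by simp
    qed
    ultimately have "(\<lambda>n. L2_inner M (K (u n)) b) \<longlonglongrightarrow> cnj c * 0"
      by (simp only: tendsto_mult_left)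
    from LIMSEQ_subseq_LIMSEQ[OF this r] have "(\<lambda>n. L2_inner M (K (u (r n))) b) \<longlonglongrightarrow> 0"
      by (simp add: o_def)
    then show "L2_inner M G b = 0"
      using lim_inner[OF L2b] LIMSEQ_unique by fastforce
  qed
  then have "L2_sq M (K G) = 0"
    by (rule K_orth_eq_0)
  then have KG: "AE x in M. K G x = 0"
    using L2_sq_eq_0_iff[OF K_L2[OF L2G]] by simp
  \<comment> \<open>Moving \<open>K\<close> to \<open>G\<close>, which it annihilates almost
    everywhere; the limit along \<open>r\<close> then shows that \<open>G\<close> is orthogonal to
    itself.\<close>
  have "L2_inner M (K (u n)) G = 0" for n
    using L2_inner_eq_0[OF KG, of "u n"] L2_inner_commute[of M "u n" "K G"] K_adjoint[OF L2u L2G, of n] by simp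
  then have "L2_inner M G G = 0"
    using lim_inner[OF L2G] by (simp add: LIMSEQ_const_iff)
  then have G0: "L2_sq M G = 0"
    by (simp add: L2_inner_self)
  fix \<delta> :: real assume "\<delta> > 0"
  then have "\<forall>\<^sub>F n in sequentially. L2_sq M (K (u (r n))) < \<delta>"
    using lim_sq G0 by (intro order_tendstoD(2)) auto
  then obtain n where n: "L2_sq M (K (u n)) < \<delta>"
    using eventually_happens by fastforce
  have "\<exists>c. AE x in M. K b x = c * b x" if "b \<in> S n" for b
  proof -
    have "b \<in> eigenbasis" using that S[of n] by (auto simp: \<F>_def)
    then obtain w where "unit_eigenfunction w b" by (rule eigenbasisE)
    then show ?thesis by (rule K_unit_eigenfunction)
  qed
  then obtain c where c: "\<And>b. b \<in> S n \<Longrightarrow> AE x in M. K b x = c b * b x"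
    by metis
  have L2S: "L2_fun M b" if "b \<in> S n" for b
    using that S[of n] eigenbasis_L2 by (auto simp: \<F>_def)
  \<comment> \<open>\<open>K\<close> acts diagonally on the finite part, so the image of the
    projection is again a combination of basis elements and the remaining error is the image of the
    residual.\<close>
  have "AE x in M. K f x - (\<Sum>b\<in>S n. (L2_inner M f b * c b) * b x) = K (u n) x"
  proof -
    have "AE x in M. \<forall>b\<in>S n. K b x = c b * b x"
      using c fin[OF S] by (intro AE_finite_allI) auto
    then show ?thesis
    proof eventually_elim
      case (elim x)
      have "K (u n) x = K f x - K (L2_proj M (S n) f) x"
        unfolding u_def by (intro K_diff f L2_proj_L2 on S)
      also have "K (L2_proj M (S n) f) x = (\<Sum>b\<in>S n. L2_inner M f b * K b x)"
        unfolding L2_proj_def using L2S by (subst K_sum) (auto simp: K_scale intro!: L2_scale)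
      also have "\<dots> = (\<Sum>b\<in>S n. (L2_inner M f b * c b) * b x)"
        using elim by (intro sum.cong) auto
      finally show ?case ..
    qed
  qed
  then have "L2_sq M (\<lambda>x. K f x - (\<Sum>b\<in>S n. (L2_inner M f b * c b) * b x)) = L2_sq M (K (u n))"
    unfolding L2_sq_def
  proof (intro integral_cong_AE)
    have "L2_fun M (\<lambda>x. K f x - (\<Sum>b\<in>S n. (L2_inner M f b * c b) * b x))"
      using L2S by (intro L2_diff K_L2 f L2_sum L2_scale)
    from L2_measurable[OF this]
    show "(\<lambda>x. (norm (K f x - (\<Sum>b\<in>S n. (L2_inner M f b * c b) * b x)))\<^sup>2) \<in> borel_measurable M"
      by measurable
    show "AE x in M. (norm (K f x - (\<Sum>b\<in>S n. (L2_inner M f b * c b) * b x)))\<^sup>2 = (norm (K (u n) x))\<^sup>2"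
      if "AE x in M. K f x - (\<Sum>b\<in>S n. (L2_inner M f b * c b) * b x) = K (u n) x"
      using that by eventually_elim (simp only:)
  qed measurable
  then show "\<exists>S a. finite S \<and> S \<subseteq> eigenbasis \<and> L2_sq M (\<lambda>x. K f x - (\<Sum>b\<in>S. a b * b x)) < \<delta>"
    using n S[of n] by (intro exI[of _ "S n"] exI[of _ "\<lambda>b. L2_inner M f b * c b"]) (auto simp: \<F>_def)
qed

end

context folner_tds
begin

lemma not_mean_sensitive_imp_discrete_spectrum:
  assumes ns: "\<not> mean_sensitive \<nu> F M T"
  shows "discrete_spectrum M T"
proof (rule approximable_imp_discrete_spectrum, rule approximable_all)
  fix f :: "'x \<Rightarrow> complex" and C L :: real
  assume f: "f \<in> borel_measurable borel" and C: "\<And>x. norm (f x) \<le> C"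
    and L: "\<And>x y. norm (f x - f y) \<le> L * dist x y" "L \<ge> 0"
  have C0: "C \<ge> 0" using C norm_ge_zero order_trans by blast
  have L2f: "L2_fun M f"
    using f C by (intro L2_bounded[of _ C]) auto
  show "approximable f"
  proof (rule approximable_limit[OF L2f])
    fix \<delta> :: real assume \<delta>: "\<delta> > 0"
    \<comment> \<open>Makes the error bound \<open>2 * C * L * \<epsilon>\<close> of
      \<open>K_approximates_Lipschitz\<close> smaller than \<open>\<delta>\<close>; it can be fixed
      before \<open>mass\<close> is known, since that bound does not involve
      \<open>mass\<close>.\<close>
    define \<epsilon> where "\<epsilon> = \<delta> / (2 * C * L + 1)"
    have \<epsilon>: "\<epsilon> > 0"
      unfolding \<epsilon>_def using \<delta> C0 L(2) by (intro divide_pos_pos add_nonneg_pos mult_nonneg_nonneg) auto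
    interpret invariant_relation \<nu> F M T "\<lambda>x y. d_b \<nu> F T x y \<le> ereal \<epsilon>"
      by (rule d_b_invariant_relation)
    obtain A where A: "A \<in> sets M" "measure M A > 0" "\<And>x y. x \<in> A \<Longrightarrow> y \<in> A \<Longrightarrow> d_b \<nu> F T x y \<le> ereal \<epsilon>"
      using ns \<epsilon> unfolding mean_sensitive_def by (meson not_less)
    have mass: "mass > 0"
      using A by (rule mass_pos)
    have "approximable (\<lambda>x. inverse (of_real mass) * K f x)"
      by (intro approximable_scale K_approximable L2f)
    moreover have "L2_sq M (\<lambda>x. f x - K f x / of_real mass) \<le> 2 * C * L * \<epsilon>"
      by (rule K_approximates_Lipschitz[OF _ \<epsilon> mass f C L])
    moreover have "2 * C * L * \<epsilon> < \<delta>"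
    proof -
      have "0 < 2 * C * L + 1" using C0 L(2) by (intro add_nonneg_pos mult_nonneg_nonneg) auto
      then have "(2 * C * L + 1) * \<epsilon> = \<delta>" by (simp add: \<epsilon>_def)
      then show ?thesis using \<epsilon> by (simp add: distrib_right)
    qed
    ultimately show "\<exists>g. approximable g \<and> L2_sq M (\<lambda>x. f x - g x) < \<delta>"
      by (intro exI[of _ "\<lambda>x. inverse (of_real mass) * K f x"]) (auto simp: divide_inverse mult.commute)
  qed
qed

lemma L2_indicator_borel: "B \<in> sets borel \<Longrightarrow> L2_fun M (indicator B)"
  by (intro L2_indicator) simp

end

theorem theorem3p10:
  fixes \<nu> :: "'g::{topological_ab_group_add, t2_space} measure"
    and F :: "nat \<Rightarrow> 'g set"
    and M :: "'x::polish_space measure"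
    and T :: "'g \<Rightarrow> 'x \<Rightarrow> 'x"
  assumes "locally_compact_space (euclidean :: 'g topology)"
    and "haar_measure \<nu>"
    and "folner_sequence \<nu> F"
    and "satisfies_pointwise_ergodic_theorem \<nu> F"
    and "ergodic_TDS M T"
  shows "(mean_equicontinuous \<nu> F M T \<longleftrightarrow>
            (\<forall>B\<in>sets borel. fun_mean_equicontinuous \<nu> F M T (indicator B))) \<and>
         (mean_equicontinuous \<nu> F M T \<longleftrightarrow>
            (\<forall>f. L2_fun M f \<longrightarrow> fun_mean_equicontinuous \<nu> F M T f)) \<and>
         (mean_equicontinuous \<nu> F M T \<longleftrightarrow> discrete_spectrum M T) \<and>
         (mean_equicontinuous \<nu> F M T \<longleftrightarrow> \<not> mean_sensitive \<nu> F M T)"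
proof -
  interpret folner_tds \<nu> F M T
    using assms(2-) by unfold_locales
  have "mean_equicontinuous \<nu> F M T \<Longrightarrow> \<not> mean_sensitive \<nu> F M T"
    by (rule mean_equicontinuous_imp_not_mean_sensitive)
  moreover have "\<not> mean_sensitive \<nu> F M T \<Longrightarrow> discrete_spectrum M T"
    by (rule not_mean_sensitive_imp_discrete_spectrum)
  moreover have "discrete_spectrum M T \<Longrightarrow> \<forall>f. L2_fun M f \<longrightarrow> fun_mean_equicontinuous \<nu> F M T f"
    using discrete_spectrum_imp_fun_mean_equicontinuous by blast
  moreover have "\<forall>f. L2_fun M f \<longrightarrow> fun_mean_equicontinuous \<nu> F M T f \<Longrightarrow>
      \<forall>B\<in>sets borel. fun_mean_equicontinuous \<nu> F M T (indicator B)"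
    using L2_indicator_borel by blast
  moreover have "\<forall>B\<in>sets borel. fun_mean_equicontinuous \<nu> F M T (indicator B) \<Longrightarrow> mean_equicontinuous \<nu> F M T"
    using indicator_mean_equicontinuous_imp_mean_equicontinuous by blast
  ultimately show ?thesis
    by argo
qed

end
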